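(* Consider the system $\dot x=f(x)+g(x)u$ with running cost $r(x,u)=q(x)+u^TRu$, $R$ constant, as in the context. Let $r$, $d$ be positive integers as in the context and $\Omega\subset\mathbb{R}^n$ a compact set containing the origin as an interior point. Assume: (A2) there exists $V^{\rm o}\in\mathcal{P}$ such that $\mathcal{H}(V^{\rm o})=0$ on $\mathbb{R}^n$; let $u^{\rm o}=-\frac12R^{-1}g^T\nabla V^{\rm o}$; (A3) there exist $V_0:\mathbb{R}^n\to\mathbb{R}$ and $u_1:\mathbb{R}^n\to\mathbb{R}^m$ such that $V_0=p_0^T\vec m_{2,2r}(x)\in\mathbb{R}[x]_{2,2r}\cap\mathcal{P}$, $u_1=K_1\vec m_{1,d}(x)$ for a constant matrix $K_1$, and $\mathcal{L}(V_0,u_1)$ is SOS. Starting from $(V_0,u_1)$, generate $V_i=p_i^T\vec m_{2,2r}(x)$ and $u_{i+1}=K_{i+1}\vec m_{1,d}(x)$, $i=1,2,\dots$, as follows: form the data matrices $\Phi_i,\Xi_i,\Theta_i$ (defined in the context) along a solution of $\dot x=f(x)+g(x)(u_i(x)+e)$, and let $(p_i,K_{i+1})$ be an optimal solution $(p,K_p)$ of $$\min_{p,K_p}\ c^Tp\quad\text{s.t.}\quad \Phi_i\begin{bmatrix}l_p\\ \mathrm{vec}(K_p)\end{bmatrix}=\Xi_i+\Theta_ip,\quad l_p^T\vec m_{2,2d}(x)\text{ is SOS},\quad (p_{i-1}-p)^T\vec m_{2,2r}(x)\text{ is SOS},\qquad(\ast_i)$$ where $c=\int_\Omega\vec m_{2,2r}(x)\,dx$.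 Assume further: (A4) for each $i=1,2,\dots$ there exists an integer $q_{i0}$ such that $\mathrm{rank}(\Phi_i)=n_{2d}+mn_d$ whenever the number $q_i$ of data intervals satisfies $q_i\ge q_{i0}$; and $q_i\ge q_{i0}$ is used for every $i$. Then: 1) For each $i=1,2,\dots$, the optimization problem $(\ast_i)$ has a nonempty feasible set. 2) The sequences $\{V_i\}_{i=1}^\infty$ and $\{u_i\}_{i=1}^\infty$ satisfy: (a) for each $i\ge1$, the closed-loop system $\dot x=f(x)+g(x)u_i(x)$ is globally asymptotically stable at the origin; (b) for each $i\ge1$, $V_i\in\mathcal{P}$ and $V^{\rm o}(x_0)\le V_i(x_0)\le V_{i-1}(x_0)$ for all $x_0\in\mathbb{R}^n$; (c) there exists $V^*\in\mathbb{R}[x]_{2,2r}\cap\mathcal{P}$ such that $\lim_{i\to\infty}V_i(x_0)=V^*(x_0)$ for any $x_0\in\mathbb{R}^n$; (d) along the solutions $x(t)$ of $\dot x=f(x)+g(x)u^{\rm o}(x)$, $x(0)=x_0$, $$0\le V^*(x_0)-V^{\rm o}(x_0)\le-\int_0^\infty\mathcal{H}(V^*(x(t)))\,dt.$$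
   Context: Here $x\in\mathbb{R}^n$ is the state, $u\in\mathbb{R}^m$ the control, and $f:\mathbb{R}^n\to\mathbb{R}^n$, $g:\mathbb{R}^n\to\mathbb{R}^{n\times m}$ are polynomial mappings with $f(0)=0$. The function $q$ is a positive definite polynomial, and $R\in\mathbb{R}^{m\times m}$ is a constant symmetric positive definite matrix. (The integer $r$ and the running cost $r(x,u)$ are different objects, as are the function $q(x)$ and the integers $q_i$.) $\mathcal{P}$ is the set of continuously differentiable functions on $\mathbb{R}^n$ that are positive definite (zero at the origin, positive elsewhere) and proper (radially unbounded). $\nabla V$ is the gradient (a column vector). For $V\in\mathcal{C}^1$ and a control $u$, $$\mathcal{L}(V,u)=-\nabla V^T(x)\big(f(x)+g(x)u\big)-r(x,u),$$ $$\mathcal{H}(V)=\nabla V^T(x)f(x)+q(x)-\tfrac14\nabla V^T(x)g(x)R^{-1}g^T(x)\nabla V(x).$$ $\mathbb{R}[x]_{d_1,d_2}$ is the set of real polynomials in $x\in\mathbb{R}^n$ all of whose monomials have degree at least $d_1$ and at most $d_2$; $\vec m_{d_1,d_2}(x)$ is the column vector of all distinct monic monomials in $x$ of degree at least $d_1$ and at most $d_2$, in lexicographic order. "SOS" means: is a sum of squares of polynomials. $\deg$ of a vector or matrix of polynomials is the highest degree of its entries. $\mathrm{vec}$ stacks the columns of a matrix and $\otimes$ is the Kronecker product. The integer $d$ satisfies $$d\ge\tfrac12\max\{\deg(f)+2r-1,\ \deg(g)+2(2r-1),\ \deg(q),\ 2(2r-1)+2\deg(g)\}.$$ Let $n_d=\binom{n+d}{d}-1$,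 $n_{2d}=\binom{n+2d}{2d}-n-1$, $n_{2r}=\binom{n+2r}{2r}-n-1$ be the lengths of $\vec m_{1,d}$, $\vec m_{2,2d}$, $\vec m_{2,2r}$. In $(\ast_i)$ the unknowns are $p\in\mathbb{R}^{n_{2r}}$, $K_p\in\mathbb{R}^{m\times n_d}$ and the vector $l_p\in\mathbb{R}^{n_{2d}}$ tied to them by the linear equality constraint. Data: the exploration noise $e$ is a bounded time-varying $\mathbb{R}^m$-valued function. At step $i$, let $x(t)$ be a solution of $\dot x=f(x)+g(x)(u_i(x)+e)$ on $[t_{0,i},t_{q_i,i}]$, with sampling times $t_{0,i}<t_{1,i}<\dots<t_{q_i,i}$. Along this solution put $$\sigma_e=-\begin{bmatrix}\vec m_{2,2d}^T(x)& 2\,\vec m_{1,d}^T(x)\otimes e^TR\end{bmatrix}^T\in\mathbb{R}^{n_{2d}+mn_d},$$ $$\Phi_i=\begin{bmatrix}\int_{t_{0,i}}^{t_{1,i}}\sigma_e\,dt&\cdots&\int_{t_{q_i-1,i}}^{t_{q_i,i}}\sigma_e\,dt\end{bmatrix}^T\in\mathbb{R}^{q_i\times(n_{2d}+mn_d)},$$ $$\Xi_i=\begin{bmatrix}\int_{t_{0,i}}^{t_{1,i}}r(x,u_i)\,dt&\cdots&\int_{t_{q_i-1,i}}^{t_{q_i,i}}r(x,u_i)\,dt\end{bmatrix}^T\in\mathbb{R}^{q_i},$$ $$\Theta_i=\begin{bmatrix}\vec m_{2,2r}\big|_{t_{0,i}}^{t_{1,i}}&\cdots&\vec m_{2,2r}\big|_{t_{q_i-1,i}}^{t_{q_i,i}}\end{bmatrix}^T\in\mathbb{R}^{q_i\times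 n_{2r}},$$ where $\vec m_{2,2r}|_{s}^{t}=\vec m_{2,2r}(x(t))-\vec m_{2,2r}(x(s))$. It is understood that an optimal solution is selected at each step. *)

theory Defs
  imports
    "HOL-Analysis.Analysis"
    "HOL-Library.List_Lexorder"
    "Jordan_Normal_Form.DL_Rank"
begin

no_notation Matrix.vec_index (infixl \<open>$\<close> 100)
no_notation Matrix.scalar_prod (infix \<open>\<bullet>\<close> 70)
unbundle inner_syntax

text \<open>
  States and controls live in \<^typ>\<open>real^'n\<close> and \<^typ>\<open>real^'m\<close>.  Vectors and matrices whose
  size depends on the degrees are those of \<^theory>\<open>Jordan_Normal_Form.Matrix\<close>.  The linear order
  on the index types numbers the coordinates, so that the two kinds of vectors can be converted.
\<close>

definition coord :: "nat \<Rightarrow> 'n::{finite,linorder}" where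
  "coord k = sorted_list_of_set UNIV ! k"

definition to_vec :: "real^'n::{finite,linorder} \<Rightarrow> real Matrix.vec" where
  "to_vec x = Matrix.vec CARD('n) (\<lambda>k. x $ coord k)"

definition of_vec :: "real Matrix.vec \<Rightarrow> real^'n::{finite,linorder}" where
  "of_vec v = (\<chi> i. vec_index v (card {j. j < i}))"

lemma coord_card_less: "coord (card {j. j < i}) = (i :: 'n::{finite,linorder})"
proof -
  let ?xs = "sorted_list_of_set (UNIV :: 'n set)"
  have strict: "sorted_wrt (<) ?xs"
    by (rule strict_sorted_list_of_set)
  have "i \<in> set ?xs"
    by simp
  then obtain k where k: "k < length ?xs" "?xs ! k = i"
    unfolding in_set_conv_nth by blast
  have "{j. j < i} = (!) ?xs ` {..<k}"
  proof (intro equalityI subsetI)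
    fix j assume j: "j \<in> {j. j < i}"
    have "j \<in> set ?xs"
      by simp
    then obtain l where l: "l < length ?xs" "?xs ! l = j"
      unfolding in_set_conv_nth by blast
    have "l < k"
    proof (rule ccontr)
      assume "\<not> l < k"
      then have "k = l \<or> k < l" by auto
      then have "i \<le> j"
        using strict k l by (auto simp: sorted_wrt_iff_nth_less less_imp_le)
      then show False using j by auto
    qed
    then show "j \<in> (!) ?xs ` {..<k}" using l by auto
  next
    fix j assume "j \<in> (!) ?xs ` {..<k}"
    then show "j \<in> {j. j < i}"
      using strict k by (auto simp: sorted_wrt_iff_nth_less)
  qed
  moreover have "inj_on ((!) ?xs) {..<k}"
    using k(1) by (intro inj_on_nth) auto
  ultimately have "card {j. j < i} = k"
    by (simp add: card_image)
  then show ?thesis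
    using k by (simp add: coord_def)
qed

lemma of_vec_to_vec: "of_vec (to_vec x) = x"
proof -
  have "card {j. j < i} < CARD('a)" for i :: "'a::{finite,linorder}"
    by (rule psubset_card_mono) auto
  then show ?thesis
    by (simp add: of_vec_def to_vec_def coord_card_less vec_eq_iff)
qed

definition exponents :: "nat \<Rightarrow> nat \<Rightarrow> nat \<Rightarrow> nat list set" where
  "exponents n d1 d2 = {\<alpha>. length \<alpha> = n \<and> d1 \<le> sum_list \<alpha> \<and> sum_list \<alpha> \<le> d2}"

definition monomial :: "nat list \<Rightarrow> real^'n::{finite,linorder} \<Rightarrow> real" where
  "monomial \<alpha> x = (\<Prod>k<length \<alpha>. (x $ coord k) ^ (\<alpha> ! k))"

text \<open>Larger exponents come first, i.e. the order is lexicographic with \<open>x\<^sub>1 > x\<^sub>2 > \<dots>\<close>.\<close>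

definition monomials :: "nat \<Rightarrow> nat \<Rightarrow> real^'n::{finite,linorder} \<Rightarrow> real Matrix.vec" where
  "monomials d1 d2 x =
     vec_of_list (map (\<lambda>\<alpha>. monomial \<alpha> x) (rev (sorted_list_of_set (exponents CARD('n) d1 d2))))"

definition num_monomials1 :: "nat \<Rightarrow> nat \<Rightarrow> nat" where
  "num_monomials1 n d = ((n + d) choose d) - 1"

definition num_monomials2 :: "nat \<Rightarrow> nat \<Rightarrow> nat" where
  "num_monomials2 n d = ((n + d) choose d) - n - 1"

lemma finite_exponents: "finite (exponents n d1 d2)"
proof (rule finite_subset)
  show "exponents n d1 d2 \<subseteq> {\<alpha>. set \<alpha> \<subseteq> {..d2} \<and> length \<alpha> = n}"
    using member_le_sum_list by (fastforce simp: exponents_def)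
  show "finite {\<alpha>. set \<alpha> \<subseteq> {..d2} \<and> length \<alpha> = n}"
    by (rule finite_lists_length_eq) simp
qed

lemma card_exponents_eq: "card (exponents n k k) = (n + k - 1) choose k"
proof -
  have "exponents n k k = {\<alpha>. length \<alpha> = n \<and> sum_list \<alpha> = k}"
    by (auto simp: exponents_def)
  then show ?thesis
    by (simp add: card_length_sum_list add.commute)
qed

lemma card_exponents:
  assumes "n \<ge> 1"
  shows "card (exponents n 0 d) = (n + d) choose d"
proof (induction d)
  case 0
  show ?case using card_exponents_eq[of n 0] by simp
next
  case (Suc d)
  have "exponents n 0 (Suc d) = exponents n 0 d \<union> exponents n (Suc d) (Suc d)"
    "exponents n 0 d \<inter> exponents n (Suc d) (Suc d) = {}"
    by (auto simp: exponents_def)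
  then have "card (exponents n 0 (Suc d)) = card (exponents n 0 d) + card (exponents n (Suc d) (Suc d))"
    by (simp add: card_Un_disjoint finite_exponents)
  then show ?case
    using Suc card_exponents_eq[of n "Suc d"] by simp
qed

lemma card_exponents_diff:
  assumes "d1 \<le> Suc d2"
  shows "card (exponents n 0 d2) =
    card (exponents n d1 d2) + (\<Sum>k<d1. card (exponents n k k))"
  using assms
proof (induction d1)
  case 0
  show ?case by simp
next
  case (Suc d1)
  have "exponents n d1 d2 = exponents n d1 d1 \<union> exponents n (Suc d1) d2"
    "exponents n d1 d1 \<inter> exponents n (Suc d1) d2 = {}"
    using Suc.prems by (auto simp: exponents_def)
  then have "card (exponents n d1 d2) = card (exponents n d1 d1) + card (exponents n (Suc d1) d2)"
    by (simp add: card_Un_disjoint finite_exponents)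
  then show ?case using Suc by simp
qed

lemma dim_monomials1:
  "dim_vec (monomials 1 d (x :: real^'n::{finite,linorder})) = num_monomials1 CARD('n) d"
proof -
  have "CARD('n) \<ge> 1"
    by (simp add: Suc_leI)
  then show ?thesis
    using card_exponents_diff[of 1 d "CARD('n)"] card_exponents[of "CARD('n)" d]
      card_exponents_eq[of "CARD('n)" 0]
    by (simp add: monomials_def num_monomials1_def)
qed

lemma dim_monomials2:
  assumes "d \<ge> 1"
  shows "dim_vec (monomials 2 d (x :: real^'n::{finite,linorder})) = num_monomials2 CARD('n) d"
proof -
  have "CARD('n) \<ge> 1"
    by (simp add: Suc_leI)
  then show ?thesis
    using assms card_exponents_diff[of 2 d "CARD('n)"] card_exponents[of "CARD('n)" d]
      card_exponents_eq[of "CARD('n)" 0] card_exponents_eq[of "CARD('n)" 1]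
    by (simp add: monomials_def num_monomials2_def numeral_2_eq_2)
qed

text \<open>
  Real polynomials in \<open>n\<close> variables are identified with the functions they induce, which is
  harmless over an infinite field.  The zero polynomial gets degree 0.
\<close>

definition poly_space :: "nat \<Rightarrow> nat \<Rightarrow> (real^'n::{finite,linorder} \<Rightarrow> real) set" where
  "poly_space d1 d2 =
     {p. \<exists>a. p = (\<lambda>x. \<Sum>\<alpha>\<in>exponents CARD('n) d1 d2. a \<alpha> * monomial \<alpha> x)}"

definition is_polynomial :: "(real^'n::{finite,linorder} \<Rightarrow> real) \<Rightarrow> bool" where
  "is_polynomial p \<longleftrightarrow> (\<exists>d. p \<in> poly_space 0 d)"

definition poly_degree :: "(real^'n::{finite,linorder} \<Rightarrow> real) \<Rightarrow> nat" where
  "poly_degree p = (LEAST d. p \<in> poly_space 0 d)"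

definition degree_vec :: "(real^'n::{finite,linorder} \<Rightarrow> real^'k) \<Rightarrow> nat" where
  "degree_vec h = Max (range (\<lambda>i. poly_degree (\<lambda>x. h x $ i)))"

definition degree_mat :: "(real^'n::{finite,linorder} \<Rightarrow> real^'l^'k) \<Rightarrow> nat" where
  "degree_mat h = Max (range (\<lambda>(i, j). poly_degree (\<lambda>x. h x $ i $ j)))"

definition SOS :: "(real^'n::{finite,linorder} \<Rightarrow> real) \<Rightarrow> bool" where
  "SOS p \<longleftrightarrow> (\<exists>hs. (\<forall>h\<in>set hs. is_polynomial h) \<and> p = (\<lambda>x. \<Sum>h\<leftarrow>hs. (h x)\<^sup>2))"

definition positive_definite_fun :: "(real^'n \<Rightarrow> real) \<Rightarrow> bool" where
  "positive_definite_fun V \<longleftrightarrow> V 0 = 0 \<and> (\<forall>x. x \<noteq> 0 \<longrightarrow> V x > 0)"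

definition positive_definite_mat :: "real^'m^'m \<Rightarrow> bool" where
  "positive_definite_mat R \<longleftrightarrow> (\<forall>u. u \<noteq> 0 \<longrightarrow> u \<bullet> (R *v u) > 0)"

definition grad :: "(real^'n \<Rightarrow> real) \<Rightarrow> real^'n \<Rightarrow> real^'n" where
  "grad V x = (THE D. GDERIV V x :> D)"

definition class_P :: "(real^'n \<Rightarrow> real) set" where
  "class_P = {V. (\<forall>x. V differentiable (at x)) \<and> continuous_on UNIV (grad V) \<and>
     positive_definite_fun V \<and> filterlim V at_top at_infinity}"

definition running_cost :: "(real^'n \<Rightarrow> real) \<Rightarrow> real^'m^'m \<Rightarrow> real^'n \<Rightarrow> real^'m \<Rightarrow> real" where
  "running_cost q R x u = q x + u \<bullet> (R *v u)"

definition L_op :: "(real^'n \<Rightarrow> real^'n) \<Rightarrow> (real^'n \<Rightarrow> real^'m^'n) \<Rightarrow> (real^'n \<Rightarrow> real) \<Rightarrow>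
    real^'m^'m \<Rightarrow> (real^'n \<Rightarrow> real) \<Rightarrow> (real^'n \<Rightarrow> real^'m) \<Rightarrow> real^'n \<Rightarrow> real" where
  "L_op f g q R V u x =
     - (grad V x \<bullet> (f x + g x *v u x)) - running_cost q R x (u x)"

definition H_op :: "(real^'n \<Rightarrow> real^'n) \<Rightarrow> (real^'n \<Rightarrow> real^'m^'n) \<Rightarrow> (real^'n \<Rightarrow> real) \<Rightarrow>
    real^'m^'m \<Rightarrow> (real^'n \<Rightarrow> real) \<Rightarrow> real^'n \<Rightarrow> real" where
  "H_op f g q R V x = grad V x \<bullet> f x + q x
     - 1/4 * (grad V x \<bullet> (g x *v (matrix_inv R *v (transpose (g x) *v grad V x))))"

definition solution :: "(real^'n \<Rightarrow> real^'n) \<Rightarrow> (real \<Rightarrow> real^'n) \<Rightarrow> bool" where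
  "solution F x \<longleftrightarrow> (\<forall>t\<ge>0. (x has_vector_derivative F (x t)) (at t within {0..}))"

text \<open>
  Existence of a solution on \<open>[0, \<infinity>)\<close> for every initial state is part of the definition, so that
  stability and attractivity are not vacuous.
\<close>

definition globally_asymptotically_stable :: "(real^'n \<Rightarrow> real^'n) \<Rightarrow> bool" where
  "globally_asymptotically_stable F \<longleftrightarrow>
     (\<forall>x0. \<exists>x. solution F x \<and> x 0 = x0) \<and>
     (\<forall>\<epsilon>>0. \<exists>\<delta>>0. \<forall>x. solution F x \<and> norm (x 0) < \<delta> \<longrightarrow> (\<forall>t\<ge>0. norm (x t) < \<epsilon>)) \<and>
     (\<forall>x. solution F x \<longrightarrow> (x \<longlongrightarrow> 0) at_top)"

text \<open>
  Solutions in the sense of Caratheodory, for right-hand sides that are only measurable in time;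
  by the fundamental theorem of calculus every classical solution is one.
\<close>

definition caratheodory_solution ::
    "(real \<Rightarrow> real^'n \<Rightarrow> real^'n) \<Rightarrow> (real \<Rightarrow> real^'n) \<Rightarrow> real \<Rightarrow> real \<Rightarrow> bool" where
  "caratheodory_solution F x a b \<longleftrightarrow> continuous_on {a..b} x \<and>
     (\<forall>t\<in>{a..b}. ((\<lambda>s. F s (x s)) has_integral (x t - x a)) {a..t})"

text \<open>The improper integral over \<open>[0, \<infinity>)\<close>, which may be infinite.\<close>

definition has_improper_integral :: "(real \<Rightarrow> real) \<Rightarrow> ereal \<Rightarrow> bool" where
  "has_improper_integral h I \<longleftrightarrow> (\<forall>T\<ge>0. h integrable_on {0..T}) \<and>
     ((\<lambda>T. ereal (integral {0..T} h)) \<longlongrightarrow> I) at_top"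

definition value_poly :: "nat \<Rightarrow> real Matrix.vec \<Rightarrow> real^'n::{finite,linorder} \<Rightarrow> real" where
  "value_poly r p x = scalar_prod p (monomials 2 (2*r) x)"

definition feedback :: "nat \<Rightarrow> real mat \<Rightarrow>
    real^'n::{finite,linorder} \<Rightarrow> real^'m::{finite,linorder}" where
  "feedback d K x = of_vec (K *\<^sub>v monomials 1 d x)"

definition stack_columns :: "real mat \<Rightarrow> real Matrix.vec" where
  "stack_columns K = Matrix.vec (dim_row K * dim_col K)
     (\<lambda>k. K $$ (k mod dim_row K, k div dim_row K))"

text \<open>Kronecker product of two row vectors.\<close>

definition kronecker_vec :: "real Matrix.vec \<Rightarrow> real Matrix.vec \<Rightarrow> real Matrix.vec" where
  "kronecker_vec v w = Matrix.vec (dim_vec v * dim_vec w)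
     (\<lambda>k. vec_index v (k div dim_vec w) * vec_index w (k mod dim_vec w))"

definition sigma_e :: "real^'m::_^'m::{finite,linorder} \<Rightarrow> nat \<Rightarrow> real^'n::{finite,linorder} \<Rightarrow>
    real^'m::_ \<Rightarrow> real Matrix.vec" where
  "sigma_e R d x e =
     - (monomials 2 (2*d) x @\<^sub>v (2 \<cdot>\<^sub>v kronecker_vec (monomials 1 d x) (to_vec (e v* R))))"

text \<open>In the data matrices, \<open>\<tau> 0 < \<dots> < \<tau> N\<close> are the sampling times and \<open>x\<close> is the trajectory.\<close>

definition Phi :: "real^'m::_^'m::{finite,linorder} \<Rightarrow> nat \<Rightarrow> (real \<Rightarrow> real^'m::_) \<Rightarrow>
    (real \<Rightarrow> real^'n::{finite,linorder}) \<Rightarrow> (nat \<Rightarrow> real) \<Rightarrow> nat \<Rightarrow> real mat" where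
  "Phi R d e x \<tau> N =
     Matrix.mat N (num_monomials2 CARD('n) (2*d) + CARD('m) * num_monomials1 CARD('n) d)
       (\<lambda>(j, k). integral {\<tau> j..\<tau> (Suc j)} (\<lambda>t. vec_index (sigma_e R d (x t) (e t)) k))"

definition Xi :: "(real^'n \<Rightarrow> real) \<Rightarrow> real^'m^'m \<Rightarrow> (real^'n \<Rightarrow> real^'m) \<Rightarrow>
    (real \<Rightarrow> real^'n) \<Rightarrow> (nat \<Rightarrow> real) \<Rightarrow> nat \<Rightarrow> real Matrix.vec" where
  "Xi q R u x \<tau> N = Matrix.vec N
     (\<lambda>j. integral {\<tau> j..\<tau> (Suc j)} (\<lambda>t. running_cost q R (x t) (u (x t))))"

definition Theta :: "nat \<Rightarrow> (real \<Rightarrow> real^'n::{finite,linorder}) \<Rightarrow> (nat \<Rightarrow> real) \<Rightarrow> nat \<Rightarrow> real mat"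
  where
  "Theta r x \<tau> N = Matrix.mat N (num_monomials2 CARD('n) (2*r))
     (\<lambda>(j, k). vec_index (monomials 2 (2*r) (x (\<tau> (Suc j)))) k
             - vec_index (monomials 2 (2*r) (x (\<tau> j))) k)"

definition sampled_data :: "(real^'n \<Rightarrow> real^'n) \<Rightarrow> (real^'n \<Rightarrow> real^'m^'n) \<Rightarrow>
    (real \<Rightarrow> real^'m) \<Rightarrow> (real^'n \<Rightarrow> real^'m) \<Rightarrow>
    (real \<Rightarrow> real^'n) \<Rightarrow> (nat \<Rightarrow> real) \<Rightarrow> nat \<Rightarrow> bool" where
  "sampled_data f g e u x \<tau> N \<longleftrightarrow> (\<forall>k<N. \<tau> k < \<tau> (Suc k)) \<and>
     caratheodory_solution (\<lambda>t y. f y + g y *v (u y + e t)) x (\<tau> 0) (\<tau> N)"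

text \<open>
  Here the data are a family indexed by the number of data intervals: \<open>x N\<close> and \<open>\<tau> N\<close> are
  the trajectory and the sampling times when \<open>N\<close> intervals are used.
\<close>

definition rank_condition :: "real^'m::_^'m::{finite,linorder} \<Rightarrow> nat \<Rightarrow> (real \<Rightarrow> real^'m::_) \<Rightarrow>
    (nat \<Rightarrow> real \<Rightarrow> real^'n::{finite,linorder}) \<Rightarrow> (nat \<Rightarrow> nat \<Rightarrow> real) \<Rightarrow> nat \<Rightarrow> bool" where
  "rank_condition R d e x \<tau> N0 \<longleftrightarrow> (\<forall>N\<ge>N0. vec_space.rank N (Phi R d e (x N) (\<tau> N) N) =
     num_monomials2 CARD('n) (2*d) + CARD('m) * num_monomials1 CARD('n) d)"

text \<open>The last component of a feasible triple is the vector \<open>l\<^sub>p\<close>.\<close>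

definition feasible_set :: "(real^'n::{finite,linorder} \<Rightarrow> real) \<Rightarrow>
    real^'m::_^'m::{finite,linorder} \<Rightarrow> nat \<Rightarrow> nat \<Rightarrow> (real \<Rightarrow> real^'m::_) \<Rightarrow> (real^'n::_ \<Rightarrow> real^'m::_) \<Rightarrow>
    (real \<Rightarrow> real^'n::_) \<Rightarrow> (nat \<Rightarrow> real) \<Rightarrow> nat \<Rightarrow> real Matrix.vec \<Rightarrow>
    (real Matrix.vec \<times> real mat \<times> real Matrix.vec) set" where
  "feasible_set q R r d e u x \<tau> N p_prev = {(p, K, l).
     p \<in> carrier_vec (num_monomials2 CARD('n) (2*r)) \<and>
     K \<in> carrier_mat CARD('m) (num_monomials1 CARD('n) d) \<and>
     l \<in> carrier_vec (num_monomials2 CARD('n) (2*d)) \<and>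
     Phi R d e x \<tau> N *\<^sub>v (l @\<^sub>v stack_columns K) = Xi q R u x \<tau> N + Theta r x \<tau> N *\<^sub>v p \<and>
     SOS (\<lambda>y :: real^'n::_. scalar_prod l (monomials 2 (2*d) y)) \<and>
     SOS (\<lambda>y :: real^'n::_. scalar_prod (p_prev - p) (monomials 2 (2*r) y))}"

definition cost_vec :: "(real^'n::{finite,linorder}) set \<Rightarrow> nat \<Rightarrow> real Matrix.vec" where
  "cost_vec \<Omega> r = Matrix.vec (num_monomials2 CARD('n) (2*r))
     (\<lambda>k. integral \<Omega> (\<lambda>x. vec_index (monomials 2 (2*r) x) k))"

definition optimal_solution :: "(real^'n::{finite,linorder}) set \<Rightarrow> (real^'n::_ \<Rightarrow> real) \<Rightarrow>
    real^'m::_^'m::{finite,linorder} \<Rightarrow> nat \<Rightarrow> nat \<Rightarrow> (real \<Rightarrow> real^'m::_) \<Rightarrow> (real^'n::_ \<Rightarrow> real^'m::_) \<Rightarrow>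
    (real \<Rightarrow> real^'n::_) \<Rightarrow> (nat \<Rightarrow> real) \<Rightarrow> nat \<Rightarrow> real Matrix.vec \<Rightarrow>
    real Matrix.vec \<Rightarrow> real mat \<Rightarrow> bool" where
  "optimal_solution \<Omega> q R r d e u x \<tau> N p_prev p K \<longleftrightarrow>
     (\<exists>l. (p, K, l) \<in> feasible_set q R r d e u x \<tau> N p_prev) \<and>
     (\<forall>(p', K', l') \<in> feasible_set q R r d e u x \<tau> N p_prev.
        scalar_prod (cost_vec \<Omega> r) p \<le> scalar_prod (cost_vec \<Omega> r) p')"

end

theory Submission
  imports Defs
begin

text \<open>
  Write \<open>u' = - R\<^sup>-\<^sup>1 g\<^sup>T \<nabla>V / 2\<close> for the control that is greedy for \<open>V\<close>.  Completing the square gives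
  \<open>L(V, u) = - H(V) - (u - u')\<^sup>T R (u - u')\<close> for every control \<open>u\<close>.

  Along any sampled trajectory, the fundamental theorem of calculus applied to \<open>V = p\<^sup>T m\<close> shows that
  the coefficients of \<open>L(V, u\<^sub>i)\<close> and of \<open>u'\<close> solve the linear data equation.  By the rank condition
  they are its only solution for the given \<open>p\<close>, so a feasible triple consists of some \<open>V\<^sub>i\<close> with
  \<open>L(V\<^sub>i, u\<^sub>i)\<close> SOS and of its greedy control \<open>u\<^sub>i\<^sub>+\<^sub>1\<close>.  By the identity above, \<open>L(V\<^sub>i, u\<^sub>i\<^sub>+\<^sub>1)\<close>
  is SOS as well, whence \<open>p\<^sub>i\<close> is feasible in the next step and \<open>V\<^sub>i\<close> is a Lyapunov function for \<open>u\<^sub>i\<^sub>+\<^sub>1\<close>.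

  Since \<open>H(V\<^sub>o) = 0\<close>, the difference \<open>V\<^sub>i - V\<^sub>o\<close> decreases to \<open>0\<close> along the closed loop of \<open>u\<^sub>i\<close>, so
  \<open>V\<^sub>o \<le> V\<^sub>i\<close>.  Each coefficient of a polynomial of bounded degree is a fixed linear combination of
  finitely many of its values, so the decreasing sequence \<open>V\<^sub>i\<close> converges to a polynomial \<open>V\<^sup>*\<close>, the
  gradients converge too, and \<open>H(V\<^sup>*) \<le> 0\<close>.  The last estimate comes from integrating
  \<open>d/dt (V\<^sup>* - V\<^sub>o) \<ge> H(V\<^sup>*)\<close> along the optimal closed loop.
\<close>

subsection \<open>Ordinary differential equations\<close>

lemma indefinite_integral_has_vector_derivative_atLeast:
  fixes h :: "real \<Rightarrow> 'a::banach"
  assumes "continuous_on {a..} h" and "a \<le> t"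
  shows "((\<lambda>u. integral {a..u} h) has_vector_derivative h t) (at t within {a..})"
proof -
  have "((\<lambda>u. integral {a..u} h) has_vector_derivative h t) (at t within {a..t + 1})"
    using assms(2) by (intro integral_has_vector_derivative continuous_on_subset[OF assms(1)]) auto
  moreover have "at t within {a..t + 1} = at t within {a..}"
    by (rule at_within_nhd[of t "{..<t + 1}"]) auto
  ultimately show ?thesis by simp
qed

text \<open>
  If \<open>x\<close> solves \<open>x' = F x\<close>, \<open>x 0 = x0\<close>, then \<open>\<psi> t = exp (- k t) x t\<close> is a fixed point of this map.
  The weight (due to Bielecki) makes it a contraction on all of \<open>[0, \<infinity>)\<close>, so that no extension of
  local solutions is needed.  Negative times are only there to get functions on the whole type.
\<close>

definition weighted_picard :: "('a::banach \<Rightarrow> 'a) \<Rightarrow> 'a \<Rightarrow> real \<Rightarrow> (real \<Rightarrow> 'a) \<Rightarrow> real \<Rightarrow> 'a" where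
  "weighted_picard F x0 k \<psi> t =
     exp (- k * max 0 t) *\<^sub>R (x0 + integral {0..max 0 t} (\<lambda>s. F (exp (k * s) *\<^sub>R \<psi> s)))"

lemma continuous_on_weighted_vector_field:
  assumes "continuous_on UNIV F" and "continuous_on UNIV \<psi>"
  shows "continuous_on S (\<lambda>s. F (exp (k * s) *\<^sub>R \<psi> s :: 'a::banach))"
  by (rule continuous_on_compose2[OF assms(1)])
    (auto intro!: continuous_intros continuous_on_subset[OF assms(2)])

lemma continuous_on_weighted_picard:
  assumes "continuous_on UNIV F" and "continuous_on UNIV \<psi>"
  shows "continuous_on UNIV (weighted_picard F x0 k \<psi>)"
proof -
  let ?I = "\<lambda>u. integral {0..u} (\<lambda>s. F (exp (k * s) *\<^sub>R \<psi> s))"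
  have "continuous (at t within {0..}) ?I" if "t \<ge> 0" for t
    by (rule has_vector_derivative_continuous[OF indefinite_integral_has_vector_derivative_atLeast[OF
          continuous_on_weighted_vector_field[OF assms] that]])
  then have "continuous_on {0..} ?I"
    by (simp add: continuous_on_eq_continuous_within)
  then have "continuous_on UNIV (\<lambda>t. ?I (max 0 t))"
    by (rule continuous_on_compose2) (auto intro!: continuous_intros)
  then show ?thesis
    unfolding weighted_picard_def[abs_def] by (intro continuous_intros)
qed

lemma weighted_vector_field_diff_le:
  fixes F :: "'a::real_normed_vector \<Rightarrow> 'b::real_normed_vector"
  assumes lip: "L-lipschitz_on UNIV F" and "dist \<phi> \<psi> \<le> B"
  shows "norm (F (exp (k * s) *\<^sub>R \<phi>) - F (exp (k * s) *\<^sub>R \<psi>)) \<le> L * exp (k * s) * B"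
proof -
  have "norm (F (exp (k * s) *\<^sub>R \<phi>) - F (exp (k * s) *\<^sub>R \<psi>)) \<le>
      L * dist (exp (k * s) *\<^sub>R \<phi>) (exp (k * s) *\<^sub>R \<psi>)"
    using lipschitz_onD[OF lip] by (simp add: dist_norm)
  also have "\<dots> = L * exp (k * s) * dist \<phi> \<psi>"
    by (simp add: dist_norm scaleR_diff_right[symmetric])
  also have "\<dots> \<le> L * exp (k * s) * B"
    using assms(2) lipschitz_on_nonneg[OF lip] by (intro mult_left_mono) auto
  finally show ?thesis .
qed

lemma weighted_picard_contraction:
  assumes lip: "L-lipschitz_on UNIV F" and "k > 0"
    and cont: "continuous_on UNIV \<phi>" "continuous_on UNIV \<psi>"
    and dist: "\<And>s. dist (\<phi> s) (\<psi> s) \<le> B"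
  shows "dist (weighted_picard F x0 k \<phi> t) (weighted_picard F x0 k \<psi> t) \<le> L / k * B"
proof -
  define s where "s = max 0 t"
  have "L \<ge> 0" using lip by (rule lipschitz_on_nonneg)
  have "B \<ge> 0" using dist order_trans zero_le_dist by blast
  let ?G = "\<lambda>\<psi> s. F (exp (k * s) *\<^sub>R \<psi> s)"
  have integrable: "?G \<phi> integrable_on {0..s}" "?G \<psi> integrable_on {0..s}"
    using cont lipschitz_on_continuous_on[OF lip]
    by (auto intro!: integrable_continuous_interval continuous_on_weighted_vector_field)
  have weight: "((\<lambda>r. L * exp (k * r) * B) has_integral
      (L * exp (k * s) / k * B - L * exp (k * 0) / k * B)) {0..s}"
    by (rule fundamental_theorem_of_calculus)
      (use \<open>k > 0\<close> in \<open>auto simp: s_def has_real_derivative_iff_has_vector_derivative[symmetric]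
        intro!: derivative_eq_intros\<close>)
  have "norm (integral {0..s} (?G \<phi>) - integral {0..s} (?G \<psi>)) =
      norm (integral {0..s} (\<lambda>r. ?G \<phi> r - ?G \<psi> r))"
    using integrable by (simp add: Henstock_Kurzweil_Integration.integral_diff)
  also have "\<dots> \<le> integral {0..s} (\<lambda>r. L * exp (k * r) * B)"
    using integrable weight
    by (intro Henstock_Kurzweil_Integration.integral_norm_bound_integral integrable_diff
        weighted_vector_field_diff_le[OF lip dist]) auto
  also have "\<dots> \<le> L * exp (k * s) / k * B"
    using integral_unique[OF weight] \<open>L \<ge> 0\<close> \<open>B \<ge> 0\<close> \<open>k > 0\<close> by simp
  finally have integrals:
    "norm (integral {0..s} (?G \<phi>) - integral {0..s} (?G \<psi>)) \<le> L * exp (k * s) / k * B" .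
  have "dist (weighted_picard F x0 k \<phi> t) (weighted_picard F x0 k \<psi> t) =
      exp (- k * s) * norm (integral {0..s} (?G \<phi>) - integral {0..s} (?G \<psi>))"
    by (simp add: weighted_picard_def s_def dist_norm scaleR_diff_right[symmetric])
  also have "\<dots> \<le> exp (- k * s) * (L * exp (k * s) / k * B)"
    by (intro mult_left_mono integrals) simp
  also have "\<dots> = L / k * B"
    by (simp add: exp_minus)
  finally show ?thesis .
qed

lemma bounded_weighted_picard_zero:
  assumes "k > 0"
  shows "bounded (range (weighted_picard F x0 k (\<lambda>_. 0)))"
proof (rule boundedI)
  fix y assume "y \<in> range (weighted_picard F x0 k (\<lambda>_. 0))"
  then obtain t where y: "y = weighted_picard F x0 k (\<lambda>_. 0) t" by blast
  define s where "s = max 0 t"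
  have "k * s \<le> exp (k * s)" using exp_ge_add_one_self[of "k * s"] by linarith
  then have "exp (- k * s) * s \<le> 1 / k"
    using assms by (simp add: exp_minus field_simps)
  moreover have "exp (- k * s) \<le> 1" using assms by (simp add: s_def)
  moreover have "norm y \<le> exp (- k * s) * norm x0 + exp (- k * s) * s * norm (F 0)"
    using norm_triangle_ineq[of "exp (- k * s) *\<^sub>R x0" "(exp (- k * s) * s) *\<^sub>R F 0"]
    by (simp add: y weighted_picard_def s_def scaleR_add_right)
  ultimately show "norm y \<le> 1 * norm x0 + 1 / k * norm (F 0)"
    by (elim order_trans) (intro add_mono mult_right_mono norm_ge_zero)
qed

lemma weighted_picard_bcontfun:
  assumes lip: "L-lipschitz_on UNIV F" and "k > 0"
  shows "weighted_picard F x0 k (apply_bcontfun \<psi>) \<in> bcontfun"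
proof -
  obtain M where M: "\<And>t. norm (weighted_picard F x0 k (\<lambda>_. 0) t) \<le> M"
    using bounded_weighted_picard_zero[OF \<open>k > 0\<close>, of F x0] by (auto simp: bounded_iff)
  have "dist (apply_bcontfun \<psi> s) 0 \<le> norm \<psi>" for s
    using norm_bounded[of \<psi> s] by simp
  then have "dist (weighted_picard F x0 k (apply_bcontfun \<psi>) t) (weighted_picard F x0 k (\<lambda>_. 0) t)
      \<le> L / k * norm \<psi>" for t
    by (intro weighted_picard_contraction[OF assms]) auto
  then have "norm (weighted_picard F x0 k (apply_bcontfun \<psi>) t) \<le> M + L / k * norm \<psi>" for t
    unfolding dist_norm by (intro order_trans[OF norm_triangle_sub add_mono[OF M]])
  then show ?thesis
    using lipschitz_on_continuous_on[OF lip]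
    by (intro bcontfun_normI continuous_on_weighted_picard) auto
qed

lemma weighted_picard_fixed_point:
  assumes lip: "L-lipschitz_on UNIV F" and "k > 0" "L < k"
  obtains \<psi> where "continuous_on UNIV \<psi>" "weighted_picard F x0 k \<psi> = \<psi>"
proof -
  define T where "T \<psi> = Bcontfun (weighted_picard F x0 k (apply_bcontfun \<psi>))" for \<psi>
  have T: "apply_bcontfun (T \<psi>) = weighted_picard F x0 k (apply_bcontfun \<psi>)" for \<psi>
    unfolding T_def by (rule Bcontfun_inverse[OF weighted_picard_bcontfun[OF assms(1,2)]])
  have "dist (T \<phi>) (T \<psi>) \<le> L / k * dist \<phi> \<psi>" for \<phi> \<psi>
  proof (rule dist_bound)
    show "dist (T \<phi> t) (T \<psi> t) \<le> L / k * dist \<phi> \<psi>" for t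
      unfolding T by (intro weighted_picard_contraction[OF assms(1,2)] dist_bounded) auto
  qed
  then obtain \<psi> where "T \<psi> = \<psi>"
    using banach_fix_type[of "L / k" T] lipschitz_on_nonneg[OF lip] assms(2,3) by auto
  then have "weighted_picard F x0 k (apply_bcontfun \<psi>) = apply_bcontfun \<psi>"
    using T by metis
  then show thesis by (intro that[of "apply_bcontfun \<psi>"]) auto
qed

theorem lipschitz_imp_global_solution_exists:
  fixes F :: "'a::banach \<Rightarrow> 'a"
  assumes lip: "L-lipschitz_on UNIV F"
  obtains x where "x 0 = x0"
    "\<And>t. t \<ge> 0 \<Longrightarrow> (x has_vector_derivative F (x t)) (at t within {0..})"
proof -
  define k where "k = L + 1"
  have "k > 0" "L < k" using lipschitz_on_nonneg[OF lip] by (auto simp: k_def)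
  then obtain \<psi> where \<psi>: "continuous_on UNIV \<psi>" "weighted_picard F x0 k \<psi> = \<psi>"
    using weighted_picard_fixed_point[OF lip] by metis
  define x where "x t = exp (k * t) *\<^sub>R \<psi> t" for t
  have integral_eq: "x t = x0 + integral {0..t} (\<lambda>s. F (x s))" if "t \<ge> 0" for t
    using that fun_cong[OF \<psi>(2), of t, symmetric]
    by (simp add: x_def weighted_picard_def exp_minus)
  have cont: "continuous_on {0..} (\<lambda>s. F (x s))"
    unfolding x_def
    by (rule continuous_on_weighted_vector_field[OF lipschitz_on_continuous_on[OF lip] \<psi>(1)])
  show thesis
  proof
    show "x 0 = x0" using integral_eq[of 0] by simp
    fix t :: real assume t: "t \<ge> 0"
    have "((\<lambda>u. x0 + integral {0..u} (\<lambda>s. F (x s))) has_vector_derivative 0 + F (x t)) (at t within {0..})"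
      by (intro derivative_intros indefinite_integral_has_vector_derivative_atLeast cont t)
    then have "((\<lambda>u. x0 + integral {0..u} (\<lambda>s. F (x s))) has_vector_derivative F (x t)) (at t within {0..})"
      by simp
    then show "(x has_vector_derivative F (x t)) (at t within {0..})"
      by (rule has_vector_derivative_transform[rotated 2]) (use t integral_eq in auto)
  qed
qed

subsection \<open>The chain rule along Caratheodory solutions\<close>

lemma has_derivative_zero_compose_lipschitz:
  assumes U: "(U has_derivative (\<lambda>_. 0)) (at (x t))" and lip: "L-lipschitz_on S x" and "t \<in> S"
  shows "((\<lambda>s. U (x s)) has_derivative (\<lambda>_. 0)) (at t within S)"
  unfolding has_derivative_within_alt
proof (intro conjI allI impI)
  fix e :: real assume "e > 0"
  have "L \<ge> 0" using lip by (rule lipschitz_on_nonneg)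
  then have "e / (L + 1) > 0" using \<open>e > 0\<close> by simp
  then obtain d where d: "d > 0"
    "\<And>y. norm (y - x t) < d \<Longrightarrow> norm (U y - U (x t)) \<le> e / (L + 1) * norm (y - x t)"
    using U unfolding has_derivative_at_alt by (auto simp del: divide_const_simps)
  show "\<exists>d>0. \<forall>s\<in>S. norm (s - t) < d \<longrightarrow> norm (U (x s) - U (x t) - 0) \<le> e * norm (s - t)"
  proof (intro exI[of _ "d / (L + 1)"] conjI ballI impI)
    show "d / (L + 1) > 0" using d(1) \<open>L \<ge> 0\<close> by simp
    fix s assume s: "s \<in> S" "norm (s - t) < d / (L + 1)"
    have "norm (x s - x t) \<le> L * norm (s - t)"
      using lipschitz_onD[OF lip s(1) \<open>t \<in> S\<close>] by (simp add: dist_norm)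
    also have "\<dots> \<le> (L + 1) * norm (s - t)"
      by (intro mult_right_mono) auto
    finally have x: "norm (x s - x t) \<le> (L + 1) * norm (s - t)" .
    also have "\<dots> < d" using s(2) \<open>L \<ge> 0\<close> by (simp add: field_simps)
    finally have "norm (U (x s) - U (x t)) \<le> e / (L + 1) * norm (x s - x t)"
      by (rule d(2))
    also have "\<dots> \<le> e / (L + 1) * ((L + 1) * norm (s - t))"
      using x \<open>e / (L + 1) > 0\<close> by (intro mult_left_mono) auto
    finally show "norm (U (x s) - U (x t) - 0) \<le> e * norm (s - t)"
      using \<open>L \<ge> 0\<close> by simp
  qed
qed simp

lemma lipschitz_on_indefinite_integral:
  fixes \<phi> :: "real \<Rightarrow> 'a::banach"
  assumes int: "\<phi> integrable_on {a..b}" and bound: "\<And>t. t \<in> {a..b} \<Longrightarrow> norm (\<phi> t) \<le> M" and "0 \<le> M"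
  shows "M-lipschitz_on {a..b} (\<lambda>t. integral {a..t} \<phi>)"
proof (rule lipschitz_onI)
  have increment: "dist (integral {a..t} \<phi>) (integral {a..s} \<phi>) \<le> M * (t - s)"
    if "a \<le> s" "s \<le> t" "t \<le> b" for s t
  proof -
    have "integral {a..s} \<phi> + integral {s..t} \<phi> = integral {a..t} \<phi>"
      using that
      by (intro Henstock_Kurzweil_Integration.integral_combine integrable_on_subinterval[OF int]) auto
    then have "dist (integral {a..t} \<phi>) (integral {a..s} \<phi>) = norm (integral {s..t} \<phi>)"
      by (metis add_diff_cancel_left' dist_norm)
    also have "\<dots> \<le> M * (t - s)"
      using has_integral_bound_real[OF \<open>0 \<le> M\<close>, of "{}" \<phi> "integral {s..t} \<phi>" s t]
        integrable_integral[OF integrable_on_subinterval[OF int, of s t]] bound that by auto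
    finally show ?thesis .
  qed
  show "dist (integral {a..s} \<phi>) (integral {a..t} \<phi>) \<le> M * dist s t" if "s \<in> {a..b}" "t \<in> {a..b}" for s t
    using increment[of s t] increment[of t s] that
    by (cases "s \<le> t") (auto simp: dist_real_def dist_commute)
qed (rule \<open>0 \<le> M\<close>)

lemma integrable_continuous_inner_bounded_measurable:
  fixes h w :: "real \<Rightarrow> 'a::euclidean_space"
  assumes h: "continuous_on {a..b} h" and w: "w \<in> borel_measurable (lebesgue_on {a..b})"
    and bound: "\<And>t. t \<in> {a..b} \<Longrightarrow> norm (w t) \<le> B"
  shows "(\<lambda>t. h t \<bullet> w t) integrable_on {a..b}"
proof (rule measurable_bounded_by_integrable_imp_integrable)
  have "h \<in> borel_measurable (lebesgue_on {a..b})"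
    by (rule continuous_imp_measurable_on_sets_lebesgue[OF h]) simp
  then show "(\<lambda>t. h t \<bullet> w t) \<in> borel_measurable (lebesgue_on {a..b})"
    using w by (rule borel_measurable_inner)
  show "(\<lambda>t. norm (h t) * B) integrable_on {a..b}"
    by (intro integrable_continuous_interval continuous_intros h)
  show "norm (h t \<bullet> w t) \<le> norm (h t) * B" if "t \<in> {a..b}" for t
    using Cauchy_Schwarz_ineq2[of "h t" "w t"] mult_left_mono[OF bound[OF that], of "norm (h t)"]
    by simp
qed simp

lemma indefinite_integral_has_derivative_zero:
  fixes h :: "real \<Rightarrow> 'a::banach"
  assumes "h integrable_on {a..b}" and t: "t \<in> {a..b}" "h t = 0" and "(h \<longlongrightarrow> 0) (at t within {a..b})"
  shows "((\<lambda>s. integral {a..s} h) has_derivative (\<lambda>_. 0)) (at t within {a..b})"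
  using integral_has_vector_derivative_continuous_at[of h a b t "{}"] assms
  by (simp add: continuous_within has_vector_derivative_def)

lemma tendsto_inner_bounded_zero:
  assumes D: "(D \<longlongrightarrow> 0) (at t within S)" and bound: "\<And>s. s \<in> S \<Longrightarrow> norm (\<phi> s) \<le> M"
  shows "((\<lambda>s. D s \<bullet> \<phi> s) \<longlongrightarrow> 0) (at t within S)"
proof (rule Lim_null_comparison)
  have "norm (D s \<bullet> \<phi> s) \<le> norm (D s) * M" if "s \<in> S" for s
    using Cauchy_Schwarz_ineq2[of "D s" "\<phi> s"] mult_left_mono[OF bound[OF that], of "norm (D s)"] by simp
  then show "\<forall>\<^sub>F s in at t within S. norm (D s \<bullet> \<phi> s) \<le> norm (D s) * M"
    by (simp add: eventually_at_filter)
  show "((\<lambda>s. norm (D s) * M) \<longlongrightarrow> 0) (at t within S)"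
    by (intro tendsto_mult_left_zero tendsto_norm_zero D)
qed

lemma lipschitz_on_of_integral_equation:
  fixes x :: "real \<Rightarrow> 'a::banach"
  assumes "a \<le> b"
    and \<phi>: "\<phi> integrable_on {a..b}" "\<And>t. t \<in> {a..b} \<Longrightarrow> norm (\<phi> t) \<le> M"
    and x: "\<And>t. t \<in> {a..b} \<Longrightarrow> x t = x a + integral {a..t} \<phi>"
  shows "M-lipschitz_on {a..b} x"
proof -
  have "0 \<le> M" using order_trans[OF norm_ge_zero \<phi>(2)[of a]] \<open>a \<le> b\<close> by simp
  moreover have "dist (x s) (x t) = dist (integral {a..s} \<phi>) (integral {a..t} \<phi>)"
    if "s \<in> {a..b}" "t \<in> {a..b}" for s t
    using x[OF that(1)] x[OF that(2)] by (metis dist_add_cancel)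
  ultimately show ?thesis
    using lipschitz_on_indefinite_integral[OF \<phi>] by (simp add: lipschitz_on_def)
qed

text \<open>
  \<open>V (x t) - \<integral> DV (x s) \<bullet> \<phi> s ds\<close> has derivative zero at every point \<open>t\<close>, although \<open>x\<close> need not be
  differentiable anywhere: replacing \<open>DV (x s)\<close> by \<open>DV (x s) - DV (x t)\<close> makes the integrand
  continuous at \<open>t\<close>.
\<close>

lemma value_minus_integral_has_derivative_zero:
  fixes x :: "real \<Rightarrow> 'a::euclidean_space" and V :: "'a \<Rightarrow> real"
  assumes t: "t \<in> {a..b}" and lip: "M-lipschitz_on {a..b} x"
    and \<phi>: "\<phi> integrable_on {a..b}" "\<And>s. s \<in> {a..b} \<Longrightarrow> norm (\<phi> s) \<le> M"
    and x: "\<And>s. s \<in> {a..b} \<Longrightarrow> x s = x a + integral {a..s} \<phi>"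
    and V: "GDERIV V (x t) :> DV (x t)" and DV: "continuous_on {a..b} (\<lambda>s. DV (x s))"
    and int: "(\<lambda>s. DV (x s) \<bullet> \<phi> s) integrable_on {a..b}"
  shows "((\<lambda>s. V (x s) - integral {a..s} (\<lambda>s. DV (x s) \<bullet> \<phi> s)) has_derivative (\<lambda>_. 0))
    (at t within {a..b})"
proof -
  define c where "c = DV (x t)"
  let ?h = "\<lambda>s. DV (x s) \<bullet> \<phi> s" and ?\<psi> = "\<lambda>s. (DV (x s) - c) \<bullet> \<phi> s"
  have int_c: "(\<lambda>s. c \<bullet> \<phi> s) integrable_on {a..b}"
    using integrable_linear[OF \<phi>(1) bounded_linear_inner_right[of c]] by (simp add: o_def)
  have "((\<lambda>s. DV (x s) - c) \<longlongrightarrow> 0) (at t within {a..b})"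
    using DV t by (intro Lim_null[THEN iffD1]) (simp add: continuous_on_def c_def)
  then have "((\<lambda>s. integral {a..s} ?\<psi>) has_derivative (\<lambda>_. 0)) (at t within {a..b})"
    using integrable_diff[OF int int_c] t
    by (intro indefinite_integral_has_derivative_zero tendsto_inner_bounded_zero[OF _ \<phi>(2)])
      (auto simp: inner_diff_left c_def)
  moreover have "((\<lambda>y. V y - c \<bullet> y) has_derivative (\<lambda>h. h \<bullet> c - c \<bullet> h)) (at (x t))"
    using V unfolding gderiv_def c_def by (intro derivative_intros)
  then have "((\<lambda>s. V (x s) - c \<bullet> x s) has_derivative (\<lambda>_. 0)) (at t within {a..b})"
    by (intro has_derivative_zero_compose_lipschitz[OF _ lip t]) (simp add: inner_commute)
  ultimately have "((\<lambda>s. V (x s) - c \<bullet> x s - integral {a..s} ?\<psi> + c \<bullet> x a) has_derivative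
      (\<lambda>_. 0 - 0 + 0)) (at t within {a..b})"
    by (intro derivative_intros)
  then show ?thesis
  proof (rule has_derivative_transform[OF t, rotated, OF has_derivative_eq_rhs])
    fix s assume s: "s \<in> {a..b}"
    then have "integral {a..s} ?\<psi> = integral {a..s} ?h - c \<bullet> integral {a..s} \<phi>"
      using integral_diff[OF integrable_on_subinterval[OF int] integrable_on_subinterval[OF int_c], of a s]
        integral_linear[OF integrable_on_subinterval[OF \<phi>(1)] bounded_linear_inner_right, of a s c]
      by (simp add: inner_diff_left o_def)
    then show "V (x s) - integral {a..s} ?h = V (x s) - c \<bullet> x s - integral {a..s} ?\<psi> + c \<bullet> x a"
      using x[OF s] by (simp add: inner_add_right)
  qed simp
qed

lemma chain_rule_indefinite_integral:
  fixes x :: "real \<Rightarrow> 'a::euclidean_space" and V :: "'a \<Rightarrow> real"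
  assumes "a \<le> b"
    and \<phi>: "\<phi> integrable_on {a..b}" "\<And>t. t \<in> {a..b} \<Longrightarrow> norm (\<phi> t) \<le> M"
    and x: "\<And>t. t \<in> {a..b} \<Longrightarrow> x t = x a + integral {a..t} \<phi>"
    and V: "\<And>y. GDERIV V y :> DV y" and DV: "continuous_on UNIV DV"
  shows "((\<lambda>t. DV (x t) \<bullet> \<phi> t) has_integral (V (x b) - V (x a))) {a..b}"
proof -
  let ?h = "\<lambda>t. DV (x t) \<bullet> \<phi> t"
  have lip: "M-lipschitz_on {a..b} x" by (rule lipschitz_on_of_integral_equation[OF \<open>a \<le> b\<close> \<phi> x])
  have cont: "continuous_on {a..b} (\<lambda>t. DV (x t))"
    by (rule continuous_on_compose2[OF DV lipschitz_on_continuous_on[OF lip]]) auto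
  have int: "?h integrable_on {a..b}"
    using integrable_imp_measurable[OF \<phi>(1)] \<phi>(2)
    by (rule integrable_continuous_inner_bounded_measurable[OF cont])
  have "V (x b) - integral {a..b} ?h = V (x a) - integral {a..a} ?h"
    using value_minus_integral_has_derivative_zero[OF _ lip \<phi> x V cont int] \<open>a \<le> b\<close>
    by (intro has_derivative_zero_unique[of "{a..b}"]) auto
  then have "integral {a..b} ?h = V (x b) - V (x a)" by simp
  then show ?thesis using integrable_integral[OF int] by simp
qed

lemma caratheodory_solution_chain_rule:
  assumes sol: "caratheodory_solution F x a b" and "a \<le> c" "c \<le> d" "d \<le> b"
    and bound: "\<And>t. t \<in> {c..d} \<Longrightarrow> norm (F t (x t)) \<le> M"
    and V: "\<And>y. GDERIV V y :> DV y" and DV: "continuous_on UNIV DV"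
  shows "((\<lambda>t. DV (x t) \<bullet> F t (x t)) has_integral (V (x d) - V (x c))) {c..d}"
proof (rule chain_rule_indefinite_integral[OF \<open>c \<le> d\<close> _ bound _ V DV])
  let ?\<phi> = "\<lambda>t. F t (x t)"
  have int: "(?\<phi> has_integral (x t - x a)) {a..t}" if "t \<in> {a..b}" for t
    using sol that by (simp add: caratheodory_solution_def)
  have int_d: "?\<phi> integrable_on {a..d}"
    using assms by (intro has_integral_integrable[OF int]) auto
  then show "?\<phi> integrable_on {c..d}"
    by (rule integrable_on_subinterval) (use assms in auto)
  show "x t = x c + integral {c..t} ?\<phi>" if t: "t \<in> {c..d}" for t
  proof -
    have "integral {a..c} ?\<phi> + integral {c..t} ?\<phi> = integral {a..t} ?\<phi>"
      using t \<open>a \<le> c\<close>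
      by (intro Henstock_Kurzweil_Integration.integral_combine integrable_on_subinterval[OF int_d]) auto
    moreover have "integral {a..c} ?\<phi> = x c - x a" "integral {a..t} ?\<phi> = x t - x a"
      using t assms(2-4) by (auto intro!: integral_unique int)
    ultimately show ?thesis by (simp add: algebra_simps)
  qed
qed

subsection \<open>Gradients and the class of Lyapunov functions\<close>

lemma GDERIV_unique:
  assumes "GDERIV V y :> D" and "GDERIV V y :> D'"
  shows "D = D'"
proof -
  have "(\<lambda>h. h \<bullet> D) = (\<lambda>h. h \<bullet> D')"
    using assms unfolding gderiv_def by (rule has_derivative_unique)
  then show ?thesis by (metis vector_eq_ldot)
qed

lemma grad_eqI: "GDERIV V y :> D \<Longrightarrow> grad V y = D"
  unfolding grad_def by (rule the_equality) (auto intro: GDERIV_unique)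

lemma GDERIV_grad:
  fixes y :: "real^'n"
  assumes "V differentiable (at y)"
  shows "GDERIV V y :> grad V y"
proof -
  obtain V' where V': "(V has_derivative V') (at y)"
    using assms by (auto simp: differentiable_def)
  then have "linear V'" by (rule has_derivative_linear)
  then have "V' = (\<lambda>h. h \<bullet> adjoint V' 1)"
    by (simp add: adjoint_works)
  then have "GDERIV V y :> adjoint V' 1"
    using V' by (simp add: gderiv_def)
  then show ?thesis using grad_eqI by metis
qed

lemma GDERIV_compose_has_vector_derivative:
  assumes x: "(x has_vector_derivative v) (at t within S)" and V: "GDERIV V (x t) :> D"
  shows "((\<lambda>t. V (x t)) has_real_derivative D \<bullet> v) (at t within S)"
proof -
  have "((\<lambda>t. V (x t)) has_derivative (\<lambda>h. (h *\<^sub>R v) \<bullet> D)) (at t within S)"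
    using has_derivative_compose[of x "\<lambda>h. h *\<^sub>R v" t S V "\<lambda>h. h \<bullet> D"] x V
    by (simp add: has_vector_derivative_def gderiv_def)
  moreover have "(\<lambda>h. (h *\<^sub>R v) \<bullet> D) = (*) (D \<bullet> v)"
    by (auto simp: inner_commute)
  ultimately show ?thesis by (simp add: has_field_derivative_def)
qed

lemma positive_definite_fun_nonneg: "positive_definite_fun V \<Longrightarrow> V y \<ge> 0"
  by (cases "y = 0") (auto simp: positive_definite_fun_def less_imp_le)

lemma
  fixes V :: "real^'n \<Rightarrow> real"
  assumes "V \<in> class_P"
  shows class_P_GDERIV: "GDERIV V y :> grad V y"
    and class_P_zero: "V 0 = 0"
    and class_P_pos: "y \<noteq> 0 \<Longrightarrow> V y > 0"
    and class_P_at_top: "filterlim V at_top at_infinity"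
    and class_P_continuous_on: "continuous_on S V"
  using assms
  by (auto simp: class_P_def positive_definite_fun_def intro: GDERIV_grad
      intro!: continuous_at_imp_continuous_on differentiable_imp_continuous_within)

lemma class_P_mono:
  fixes V W :: "real^'n \<Rightarrow> real"
  assumes V: "V \<in> class_P" and le: "\<And>y. V y \<le> W y" and "W 0 = 0"
    and W: "\<And>y. GDERIV W y :> grad W y" "continuous_on UNIV (grad W)"
  shows "W \<in> class_P"
proof -
  have "W y > 0" if "y \<noteq> 0" for y
    using class_P_pos[OF V that] le[of y] by linarith
  moreover have "filterlim W at_top at_infinity"
    by (rule filterlim_at_top_mono[OF class_P_at_top[OF V]]) (simp add: le)
  moreover have "W differentiable at y" for y
    using W(1)[of y] unfolding gderiv_def differentiable_def by blast
  ultimately show ?thesis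
    using W(2) \<open>W 0 = 0\<close> by (simp add: class_P_def positive_definite_fun_def)
qed

lemma compact_sublevel_set_of_proper:
  fixes V :: "'a::{real_normed_vector,heine_borel} \<Rightarrow> real"
  assumes "continuous_on UNIV V" and "filterlim V at_top at_infinity"
  shows "compact {y. V y \<le> c}"
proof -
  have "\<forall>\<^sub>F y in at_infinity. V y \<ge> c + 1"
    using assms(2) by (simp add: filterlim_at_top)
  then obtain B where B: "\<And>y. norm y \<ge> B \<Longrightarrow> V y \<ge> c + 1"
    by (auto simp: eventually_at_infinity)
  have "norm y \<le> B" if "V y \<le> c" for y
    using B[of y] that by linarith
  then have "bounded {y. V y \<le> c}" by (auto intro: boundedI)
  moreover have "closed {y. V y \<le> c}"
    by (intro closed_Collect_le assms continuous_on_const)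
  ultimately show ?thesis by (simp add: compact_eq_bounded_closed)
qed

lemma class_P_compact_sublevel_set: "V \<in> class_P \<Longrightarrow> compact {y. V y \<le> c}"
  by (intro compact_sublevel_set_of_proper class_P_continuous_on class_P_at_top)

lemma class_P_bounded_below_outside_ball:
  fixes V :: "real^'n \<Rightarrow> real"
  assumes V: "V \<in> class_P" and "\<epsilon> > 0"
  obtains m where "m > 0" "\<And>y. norm y \<ge> \<epsilon> \<Longrightarrow> V y \<ge> m"
proof -
  define S where "S = {y. V y \<le> 1} \<inter> {y. \<epsilon> \<le> norm y}"
  have S: "compact S"
    unfolding S_def
    by (intro compact_Int_closed class_P_compact_sublevel_set[OF V] closed_Collect_le continuous_intros)
  show thesis
  proof (cases "S = {}")
    case True
    then show thesis by (intro that[of 1]) (force simp: S_def)+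
  next
    case False
    then obtain z where z: "z \<in> S" "\<And>y. y \<in> S \<Longrightarrow> V z \<le> V y"
      using continuous_attains_inf[OF S _ class_P_continuous_on[OF V]] by blast
    then have "z \<noteq> 0" using \<open>\<epsilon> > 0\<close> by (auto simp: S_def)
    then have "V z > 0" by (rule class_P_pos[OF V])
    moreover have "V y \<ge> min 1 (V z)" if "norm y \<ge> \<epsilon>" for y
      using z(2)[of y] that by (cases "V y \<le> 1") (auto simp: S_def)
    ultimately show thesis by (intro that[of "min 1 (V z)"]) auto
  qed
qed

subsection \<open>Lyapunov's direct method\<close>

lemma has_real_derivative_le_imp_increment_le:
  fixes \<phi> :: "real \<Rightarrow> real"
  assumes "s \<le> t" and "{s..t} \<subseteq> S"
    and deriv: "\<And>r. r \<in> {s..t} \<Longrightarrow> (\<phi> has_real_derivative \<phi>' r) (at r within S)"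
    and le: "\<And>r. r \<in> {s..t} \<Longrightarrow> \<phi>' r \<le> c"
  shows "\<phi> t - \<phi> s \<le> c * (t - s)"
proof (cases "s = t")
  case False
  then have "s < t" using \<open>s \<le> t\<close> by simp
  then obtain r where r: "r \<in> {s<..<t}" "\<phi> t - \<phi> s = \<phi>' r * (t - s)"
    using mvt_simple[of s t \<phi> "\<lambda>r. (*) (\<phi>' r)"] has_field_derivative_subset[OF deriv \<open>{s..t} \<subseteq> S\<close>]
    unfolding has_field_derivative_def by (metis atLeastAtMost_iff)
  then show ?thesis
    using le[of r] \<open>s < t\<close> by (auto intro: mult_right_mono)
qed simp

lemma solution_has_vector_derivative:
  "solution F x \<Longrightarrow> t \<ge> 0 \<Longrightarrow> (x has_vector_derivative F (x t)) (at t within {0..})"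
  by (simp add: solution_def)

lemma solution_continuous_on: "solution F x \<Longrightarrow> continuous_on {0..} x"
  using solution_has_vector_derivative has_vector_derivative_continuous
  by (force simp: continuous_on_eq_continuous_within)

lemma value_along_solution_has_derivative:
  assumes "solution F x" and "\<And>y. GDERIV V y :> grad V y" and "t \<ge> 0"
  shows "((\<lambda>t. V (x t)) has_real_derivative grad V (x t) \<bullet> F (x t)) (at t within {0..})"
  by (rule GDERIV_compose_has_vector_derivative[OF solution_has_vector_derivative assms(2)]) fact+

lemma value_along_solution_increment_le:
  assumes "solution F x" and "\<And>y. GDERIV V y :> grad V y" and "0 \<le> s" "s \<le> t"
    and "\<And>r. r \<in> {s..t} \<Longrightarrow> grad V (x r) \<bullet> F (x r) \<le> c"
  shows "V (x t) - V (x s) \<le> c * (t - s)"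
proof (rule has_real_derivative_le_imp_increment_le[where S = "{0..}"])
  show "((\<lambda>t. V (x t)) has_real_derivative grad V (x r) \<bullet> F (x r)) (at r within {0..})"
    if "r \<in> {s..t}" for r
    using that assms(3) by (intro value_along_solution_has_derivative[OF assms(1,2)]) auto
qed (use assms(3-5) in auto)

lemma Lyapunov_nonincreasing:
  assumes "V \<in> class_P" and "solution F x" and "\<And>y. grad V y \<bullet> F y \<le> 0" and "0 \<le> s" "s \<le> t"
  shows "V (x t) \<le> V (x s)"
  using value_along_solution_increment_le[of F x V s t 0] class_P_GDERIV assms by auto

lemma Lyapunov_becomes_small:
  fixes V :: "real^'n \<Rightarrow> real"
  assumes V: "V \<in> class_P" and x: "solution F x"
    and q: "continuous_on UNIV q" "positive_definite_fun q"
    and decrease: "\<And>y. grad V y \<bullet> F y \<le> - q y" and "c > 0"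
  shows "\<exists>t\<ge>0. V (x t) < c"
proof (rule ccontr)
  assume "\<not> ?thesis"
  then have ge: "V (x t) \<ge> c" if "t \<ge> 0" for t using that by force
  define S where "S = {y. V y \<le> V (x 0)} \<inter> {y. c \<le> V y}"
  have "compact S"
    unfolding S_def
    by (intro compact_Int_closed class_P_compact_sublevel_set[OF V] closed_Collect_le
        class_P_continuous_on[OF V] continuous_intros)
  moreover have "grad V y \<bullet> F y \<le> 0" for y
    using decrease[of y] positive_definite_fun_nonneg[OF q(2), of y] by linarith
  then have in_S: "x t \<in> S" if "t \<ge> 0" for t
    using Lyapunov_nonincreasing[OF V x, of 0 t] that ge[OF that] by (auto simp: S_def)
  moreover have "S \<noteq> {}" using in_S[of 0] by auto
  ultimately obtain z where z: "z \<in> S" "\<And>y. y \<in> S \<Longrightarrow> q z \<le> q y"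
    using continuous_attains_inf[of S q] continuous_on_subset[OF q(1) subset_UNIV] by blast
  have "z \<noteq> 0" using z(1) \<open>c > 0\<close> class_P_zero[OF V] by (auto simp: S_def)
  then have "q z > 0" using q(2) by (simp add: positive_definite_fun_def)
  define T where "T = V (x 0) / q z"
  have "T \<ge> 0" using \<open>q z > 0\<close> ge[of 0] \<open>c > 0\<close> by (simp add: T_def)
  have "grad V (x r) \<bullet> F (x r) \<le> - q z" if "r \<in> {0..T}" for r
    using decrease[of "x r"] z(2)[OF in_S] that by force
  then have "V (x T) - V (x 0) \<le> - q z * (T - 0)"
    by (intro value_along_solution_increment_le[OF x class_P_GDERIV[OF V]]) (use \<open>T \<ge> 0\<close> in auto)
  then have "V (x T) \<le> 0" using \<open>q z > 0\<close> by (simp add: T_def)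
  then show False using ge[OF \<open>T \<ge> 0\<close>] \<open>c > 0\<close> by simp
qed

lemma Lyapunov_tendsto_0:
  fixes V :: "real^'n \<Rightarrow> real"
  assumes V: "V \<in> class_P" and x: "solution F x"
    and q: "continuous_on UNIV q" "positive_definite_fun q"
    and decrease: "\<And>y. grad V y \<bullet> F y \<le> - q y"
  shows "(x \<longlongrightarrow> 0) at_top"
proof (rule tendstoI)
  fix \<epsilon> :: real assume "\<epsilon> > 0"
  then obtain m where m: "m > 0" "\<And>y. norm y \<ge> \<epsilon> \<Longrightarrow> V y \<ge> m"
    using class_P_bounded_below_outside_ball[OF V] by metis
  obtain t0 where t0: "t0 \<ge> 0" "V (x t0) < m"
    using Lyapunov_becomes_small[OF assms m(1)] by blast
  have "grad V y \<bullet> F y \<le> 0" for y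
    using decrease[of y] positive_definite_fun_nonneg[OF q(2), of y] by linarith
  then have "norm (x t) < \<epsilon>" if "t \<ge> t0" for t
    using Lyapunov_nonincreasing[OF V x _ t0(1) that] t0(2) m(2)[of "x t"] by force
  then show "\<forall>\<^sub>F t in at_top. dist (x t) 0 < \<epsilon>"
    by (auto simp: eventually_at_top_linorder)
qed

lemma Lyapunov_stable:
  fixes V :: "real^'n \<Rightarrow> real"
  assumes V: "V \<in> class_P" and nonincreasing: "\<And>y. grad V y \<bullet> F y \<le> 0" and "\<epsilon> > 0"
  shows "\<exists>\<delta>>0. \<forall>x. solution F x \<and> norm (x 0) < \<delta> \<longrightarrow> (\<forall>t\<ge>0. norm (x t) < \<epsilon>)"
proof -
  obtain m where m: "m > 0" "\<And>y. norm y \<ge> \<epsilon> \<Longrightarrow> V y \<ge> m"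
    using class_P_bounded_below_outside_ball[OF V \<open>\<epsilon> > 0\<close>] by metis
  obtain \<delta> where \<delta>: "\<delta> > 0" "\<And>y. dist y 0 < \<delta> \<Longrightarrow> dist (V y) (V 0) < m"
    using class_P_continuous_on[OF V, of UNIV] m(1) unfolding continuous_on_iff by blast
  have "norm (x t) < \<epsilon>" if "solution F x" "norm (x 0) < \<delta>" "t \<ge> 0" for x t
    using Lyapunov_nonincreasing[OF V that(1) nonincreasing order_refl that(3)] m(2)[of "x t"]
      \<delta>(2)[of "x 0"] that(2) class_P_zero[OF V] by (force simp: dist_real_def)
  with \<delta>(1) show ?thesis by blast
qed

lemma continuous_stays_below_barrier:
  fixes u :: "real \<Rightarrow> real"
  assumes cont: "continuous_on {a..} u" and start: "u a < c"
    and barrier: "\<And>T. a \<le> T \<Longrightarrow> (\<And>s. s \<in> {a..T} \<Longrightarrow> u s \<le> c) \<Longrightarrow> u T < c"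
    and "a \<le> t"
  shows "u t < c"
proof (rule ccontr)
  assume "\<not> u t < c"
  define E where "E = {a..} \<inter> u -` {c..}"
  have "closed E"
    unfolding E_def by (intro continuous_closed_preimage cont) auto
  moreover have E: "t \<in> E" "bdd_below E"
    using \<open>\<not> u t < c\<close> \<open>a \<le> t\<close> by (auto simp: E_def intro: bdd_belowI)
  ultimately have Inf_E: "Inf E \<in> E" using closed_contains_Inf by blast
  have before: "u s < c" if "a \<le> s" "s < Inf E" for s
    using that cInf_lower[OF _ E(2), of s] by (force simp: E_def)
  have "u (Inf E) \<le> c"
  proof (rule ccontr)
    assume "\<not> ?thesis"
    then obtain s where "a \<le> s" "s \<le> Inf E" "u s = c"
      using IVT'[of u a c "Inf E"] start Inf_E continuous_on_subset[OF cont, of "{a..Inf E}"]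
      by (auto simp: E_def)
    then show False using before[of s] \<open>\<not> u (Inf E) \<le> c\<close> by (cases "s = Inf E") auto
  qed
  then have "u s \<le> c" if "s \<in> {a..Inf E}" for s
    using before[of s] that by (cases "s = Inf E") auto
  then have "u (Inf E) < c" using Inf_E by (intro barrier) (auto simp: E_def)
  then show False using Inf_E by (simp add: E_def)
qed

lemma lipschitz_on_compose_closest_point:
  fixes F :: "'a::euclidean_space \<Rightarrow> 'b::metric_space"
  assumes S: "convex S" "closed S" "S \<noteq> {}" and F: "L-lipschitz_on S F"
  shows "L-lipschitz_on UNIV (\<lambda>y. F (closest_point S y))"
proof -
  have "1-lipschitz_on UNIV (closest_point S)"
    using closest_point_lipschitz[OF S] by (intro lipschitz_onI) auto
  then have "(L * 1)-lipschitz_on UNIV (\<lambda>y. F (closest_point S y))"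
    by (rule lipschitz_on_compose2)
      (use S in \<open>auto intro: lipschitz_on_subset[OF F] closest_point_in_set\<close>)
  then show ?thesis by simp
qed

text \<open>
  Composing \<open>F\<close> with the projection to a ball makes it globally Lipschitz.  The solution of the
  modified equation never leaves the ball, where both vector fields agree.
\<close>

lemma Lyapunov_solution_exists:
  fixes V :: "real^'n \<Rightarrow> real"
  assumes V: "V \<in> class_P" and lip: "\<And>\<rho>. \<exists>L. L-lipschitz_on (cball 0 \<rho>) F"
    and nonincreasing: "\<And>y. grad V y \<bullet> F y \<le> 0"
  shows "\<exists>x. solution F x \<and> x 0 = x0"
proof -
  obtain \<rho> where \<rho>: "\<rho> > 0" "\<And>y. V y \<le> V x0 \<Longrightarrow> norm y < \<rho>"
    using compact_imp_bounded[OF class_P_compact_sublevel_set[OF V, of "V x0"]]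
    by (auto simp: bounded_pos_less)
  define P where "P = closest_point (cball (0 :: real^'n) \<rho>)"
  obtain L where "L-lipschitz_on (cball 0 \<rho>) F" using lip by blast
  then have "L-lipschitz_on UNIV (\<lambda>y. F (P y))"
    unfolding P_def using \<rho>(1) by (intro lipschitz_on_compose_closest_point) auto
  then obtain x where x: "x 0 = x0"
    "\<And>t. t \<ge> 0 \<Longrightarrow> (x has_vector_derivative F (P (x t))) (at t within {0..})"
    using lipschitz_imp_global_solution_exists[of L "\<lambda>y. F (P y)" x0] by metis
  then have sol: "solution (\<lambda>y. F (P y)) x" by (simp add: solution_def)
  have P_id: "P y = y" if "norm y \<le> \<rho>" for y
    unfolding P_def using that by (intro closest_point_self) simp
  have "norm (x t) < \<rho>" if "t \<ge> 0" for t
  proof (rule continuous_stays_below_barrier[OF _ _ _ that])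
    show "continuous_on {0..} (\<lambda>t. norm (x t))"
      by (intro continuous_on_norm solution_continuous_on[OF sol])
    show "norm (x 0) < \<rho>" using \<rho>(2) x(1) by simp
    fix T :: real assume "0 \<le> T" and "\<And>s. s \<in> {0..T} \<Longrightarrow> norm (x s) \<le> \<rho>"
    then have "V (x T) - V (x 0) \<le> 0 * (T - 0)"
      using P_id nonincreasing
      by (intro value_along_solution_increment_le[OF sol class_P_GDERIV[OF V]]) auto
    then show "norm (x T) < \<rho>" using \<rho>(2) x(1) by simp
  qed
  then have "solution F x"
    using x(2) P_id by (simp add: solution_def less_imp_le)
  with x(1) show ?thesis by blast
qed

theorem Lyapunov_globally_asymptotically_stable:
  fixes V :: "real^'n \<Rightarrow> real"
  assumes V: "V \<in> class_P" and lip: "\<And>\<rho>. \<exists>L. L-lipschitz_on (cball 0 \<rho>) F"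
    and q: "continuous_on UNIV q" "positive_definite_fun q"
    and decrease: "\<And>y. grad V y \<bullet> F y \<le> - q y"
  shows "globally_asymptotically_stable F"
proof -
  have "grad V y \<bullet> F y \<le> 0" for y
    using decrease[of y] positive_definite_fun_nonneg[OF q(2), of y] by linarith
  then show ?thesis
    unfolding globally_asymptotically_stable_def
    using Lyapunov_solution_exists[OF V lip] Lyapunov_stable[OF V] Lyapunov_tendsto_0[OF V _ q decrease]
    by blast
qed

subsection \<open>Polynomial functions\<close>

abbreviation coord_index :: "'n::{finite,linorder} \<Rightarrow> nat" where
  "coord_index i \<equiv> card {j. j < i}"

lemma bij_coord: "bij_betw coord {..<CARD('n)} (UNIV :: 'n::{finite,linorder} set)"
  using bij_betw_nth[of "sorted_list_of_set (UNIV :: 'n set)"]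
  by (simp add: coord_def[abs_def])

lemma coord_index_less_CARD: "coord_index (i :: 'n::{finite,linorder}) < CARD('n)"
  by (rule psubset_card_mono) auto

lemma coord_index_coord:
  assumes "k < CARD('n::{finite,linorder})"
  shows "coord_index (coord k :: 'n) = k"
  using inj_onD[OF bij_betw_imp_inj_on[OF bij_coord[where 'n='n]], of "coord_index (coord k :: 'n)" k]
    assms coord_index_less_CARD coord_card_less by auto

lemma inner_vec_coord:
  "(v :: real^'n::{finite,linorder}) \<bullet> w = (\<Sum>k<CARD('n). v $ coord k * w $ coord k)"
  unfolding inner_vec_def
  using sum.reindex_bij_betw[OF bij_coord[where 'n='n], of "\<lambda>i. v $ i * w $ i"] by simp

declare finite_exponents [simp]

lemma poly_spaceI:
  fixes p :: "real^'n::{finite,linorder} \<Rightarrow> real"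
  assumes "\<And>x. p x = (\<Sum>\<alpha>\<in>exponents CARD('n) d1 d2. a \<alpha> * monomial \<alpha> x)"
  shows "p \<in> poly_space d1 d2"
  using assms unfolding poly_space_def by blast

lemma poly_spaceE:
  fixes p :: "real^'n::{finite,linorder} \<Rightarrow> real"
  assumes "p \<in> poly_space d1 d2"
  obtains a where "p = (\<lambda>x. \<Sum>\<alpha>\<in>exponents CARD('n) d1 d2. a \<alpha> * monomial \<alpha> x)"
  using assms unfolding poly_space_def by blast

lemma monomial_in_poly_space:
  assumes "\<alpha> \<in> exponents CARD('n::{finite,linorder}) d1 d2"
  shows "(monomial \<alpha> :: real^'n::_ \<Rightarrow> real) \<in> poly_space d1 d2"
proof (rule poly_spaceI)
  show "monomial \<alpha> x = (\<Sum>\<beta>\<in>exponents CARD('n) d1 d2. (if \<beta> = \<alpha> then 1 else 0) * monomial \<beta> x)"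
    for x :: "real^'n::_"
    using assms by (simp add: if_distrib[of "\<lambda>c. c * _"] sum.delta cong: if_cong)
qed

lemma poly_space_0: "(\<lambda>x. 0) \<in> poly_space d1 d2"
  by (rule poly_spaceI[where a = "\<lambda>_. 0"]) simp

lemma poly_space_add:
  assumes "p \<in> poly_space d1 d2" and "q \<in> poly_space d1 d2"
  shows "(\<lambda>x. p x + q x) \<in> poly_space d1 d2"
proof -
  obtain a where "p = (\<lambda>x. \<Sum>\<alpha>\<in>exponents CARD('a) d1 d2. a \<alpha> * monomial \<alpha> x)"
    using assms(1) by (rule poly_spaceE)
  moreover obtain b where "q = (\<lambda>x. \<Sum>\<alpha>\<in>exponents CARD('a) d1 d2. b \<alpha> * monomial \<alpha> x)"
    using assms(2) by (rule poly_spaceE)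
  ultimately have "p x + q x = (\<Sum>\<alpha>\<in>exponents CARD('a) d1 d2. (a \<alpha> + b \<alpha>) * monomial \<alpha> x)" for x
    by (simp add: distrib_right sum.distrib)
  then show ?thesis by (rule poly_spaceI)
qed

lemma poly_space_cmult:
  assumes "p \<in> poly_space d1 d2"
  shows "(\<lambda>x. c * p x) \<in> poly_space d1 d2"
proof -
  obtain a where "p = (\<lambda>x. \<Sum>\<alpha>\<in>exponents CARD('a) d1 d2. a \<alpha> * monomial \<alpha> x)"
    using assms by (rule poly_spaceE)
  then have "c * p x = (\<Sum>\<alpha>\<in>exponents CARD('a) d1 d2. (c * a \<alpha>) * monomial \<alpha> x)" for x
    by (simp add: sum_distrib_left mult.assoc)
  then show ?thesis by (rule poly_spaceI)
qed

lemma poly_space_uminus: "p \<in> poly_space d1 d2 \<Longrightarrow> (\<lambda>x. - p x) \<in> poly_space d1 d2"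
  using poly_space_cmult[of p d1 d2 "- 1"] by simp

lemma poly_space_diff:
  "p \<in> poly_space d1 d2 \<Longrightarrow> q \<in> poly_space d1 d2 \<Longrightarrow> (\<lambda>x. p x - q x) \<in> poly_space d1 d2"
  using poly_space_add[OF _ poly_space_uminus, of p d1 d2 q] by simp

lemma poly_space_sum:
  "(\<And>i. i \<in> I \<Longrightarrow> p i \<in> poly_space d1 d2) \<Longrightarrow> (\<lambda>x. \<Sum>i\<in>I. p i x) \<in> poly_space d1 d2"
  by (induction I rule: infinite_finite_induct) (auto intro: poly_space_0 poly_space_add)

lemma poly_space_induct [consumes 1, case_names monomial zero add cmult]:
  fixes p :: "real^'n::{finite,linorder} \<Rightarrow> real"
  assumes p: "p \<in> poly_space d1 d2"
    and monomial: "\<And>\<alpha>. \<alpha> \<in> exponents CARD('n) d1 d2 \<Longrightarrow> P (monomial \<alpha>)"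
    and zero: "P (\<lambda>x. 0)"
    and add: "\<And>p q. P p \<Longrightarrow> P q \<Longrightarrow> P (\<lambda>x. p x + q x)"
    and cmult: "\<And>c p. P p \<Longrightarrow> P (\<lambda>x. c * p x)"
  shows "P p"
proof -
  obtain a where a: "p = (\<lambda>x. \<Sum>\<alpha>\<in>exponents CARD('n) d1 d2. a \<alpha> * monomial \<alpha> x)"
    using p by (rule poly_spaceE)
  have "P (\<lambda>x. \<Sum>\<alpha>\<in>A. a \<alpha> * monomial \<alpha> x)" if "A \<subseteq> exponents CARD('n) d1 d2" for A
    using finite_subset[OF that finite_exponents] that
    by (induction A rule: finite_induct) (auto intro!: zero add cmult monomial)
  then show ?thesis using a by simp
qed

lemma poly_space_mono:
  assumes "p \<in> poly_space d1 d2" and "d1' \<le> d1" "d2 \<le> d2'"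
  shows "p \<in> poly_space d1' d2'"
  using assms(1)
proof (induction rule: poly_space_induct)
  case (monomial \<alpha>)
  then show ?case using assms(2,3) by (intro monomial_in_poly_space) (auto simp: exponents_def)
qed (auto intro: poly_space_0 poly_space_add poly_space_cmult)

lemma sum_list_map2_plus:
  fixes xs ys :: "'a::comm_monoid_add list"
  shows "length xs = length ys \<Longrightarrow> sum_list (map2 (+) xs ys) = sum_list xs + sum_list ys"
  by (induction xs ys rule: list_induct2) (auto simp: ac_simps)

lemma monomial_mult:
  assumes "length \<alpha> = length \<beta>"
  shows "monomial \<alpha> x * monomial \<beta> x = monomial (map2 (+) \<alpha> \<beta>) x"
  using assms by (simp add: monomial_def power_add prod.distrib)

lemma poly_space_mult:
  fixes p q :: "real^'n::{finite,linorder} \<Rightarrow> real"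
  assumes "p \<in> poly_space a b" and "q \<in> poly_space c d"
  shows "(\<lambda>x. p x * q x) \<in> poly_space (a + c) (b + d)"
  using assms(1)
proof (induction rule: poly_space_induct)
  case (monomial \<alpha>)
  from assms(2) show ?case
  proof (induction rule: poly_space_induct)
    case (monomial \<beta>)
    have "(\<lambda>x :: real^'n::_. monomial \<alpha> x * monomial \<beta> x) = monomial (map2 (+) \<alpha> \<beta>)"
      using monomial \<open>\<alpha> \<in> _\<close> by (auto simp: exponents_def monomial_mult)
    also have "\<dots> \<in> poly_space (a + c) (b + d)"
      using monomial \<open>\<alpha> \<in> _\<close>
      by (intro monomial_in_poly_space) (auto simp: exponents_def sum_list_map2_plus)
    finally show ?case .
  next
    case (cmult k p)
    then show ?case using poly_space_cmult[OF cmult, of k] by (simp add: mult.left_commute)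
  qed (auto simp: distrib_left intro: poly_space_0 poly_space_add)
next
  case (cmult k p)
  then show ?case using poly_space_cmult[OF cmult, of k] by (simp add: mult.assoc)
qed (auto simp: distrib_right intro: poly_space_0 poly_space_add)

lemma poly_space_inner:
  assumes "\<And>i. (\<lambda>y. v y $ i) \<in> poly_space a b" and "\<And>i. (\<lambda>y. w y $ i) \<in> poly_space a' b'"
  shows "(\<lambda>y. v y \<bullet> w y) \<in> poly_space (a + a') (b + b')"
  unfolding inner_vec_def inner_real_def by (intro poly_space_sum poly_space_mult assms)

lemma poly_space_matrix_vector_mult:
  assumes "\<And>i j. (\<lambda>y. A y $ i $ j) \<in> poly_space a b" and "\<And>i. (\<lambda>y. v y $ i) \<in> poly_space a' b'"
  shows "(\<lambda>y. (A y *v v y) $ i) \<in> poly_space (a + a') (b + b')"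
  unfolding matrix_vector_mult_def vec_lambda_beta by (intro poly_space_sum poly_space_mult assms)

lemma poly_space_const: "(\<lambda>x :: real^'n::{finite,linorder}. c) \<in> poly_space 0 0"
proof -
  have "(monomial (replicate CARD('n) 0) :: real^'n::_ \<Rightarrow> real) \<in> poly_space 0 0"
    by (rule monomial_in_poly_space) (simp add: exponents_def sum_list_replicate)
  moreover have "monomial (replicate CARD('n) 0) = (\<lambda>x :: real^'n::_. 1)"
    by (simp add: monomial_def fun_eq_iff)
  ultimately show ?thesis using poly_space_cmult[of "\<lambda>x. 1" 0 0 c] by simp
qed

lemma poly_space_const_matrix_vector_mult:
  assumes "\<And>i. (\<lambda>y. v y $ i) \<in> poly_space a b"
  shows "(\<lambda>y. (A *v v y) $ i) \<in> poly_space a b"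
  using poly_space_matrix_vector_mult[OF poly_space_const assms] by simp

lemma poly_space_homogeneous:
  fixes p :: "real^'n::{finite,linorder} \<Rightarrow> real"
  assumes "p \<in> poly_space k k"
  shows "p (t *\<^sub>R x) = t ^ k * p x"
  using assms
proof (induction rule: poly_space_induct)
  case (monomial \<alpha>)
  then have "length \<alpha> = CARD('n)" "k = (\<Sum>l<CARD('n). \<alpha> ! l)"
    by (auto simp: exponents_def sum_list_sum_nth atLeast0LessThan)
  then show ?case
    by (simp add: monomial_def power_mult_distrib prod.distrib power_sum)
qed (auto simp: distrib_left)

lemma poly_space_at_0:
  assumes "p \<in> poly_space d1 d2" and "d1 \<ge> 1"
  shows "p (0 :: real^'n::{finite,linorder}) = 0"
  using assms(1)
proof (induction rule: poly_space_induct)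
  case (monomial \<alpha>)
  then have "monomial \<alpha> (0 *\<^sub>R 0 :: real^'n::_) = 0 ^ sum_list \<alpha> * monomial \<alpha> (0 :: real^'n::_)"
    by (intro poly_space_homogeneous monomial_in_poly_space) (simp add: exponents_def)
  then show ?case
    using monomial assms(2) by (simp add: exponents_def power_0_left del: sum_list_eq_0_iff)
qed auto

lemma poly_space_split_lowest_degree:
  fixes p :: "real^'n::{finite,linorder} \<Rightarrow> real"
  assumes "p \<in> poly_space k d"
  obtains p1 p2 where "p1 \<in> poly_space k k" "p2 \<in> poly_space (Suc k) d" "p = (\<lambda>x. p1 x + p2 x)"
proof -
  have "\<exists>p1\<in>poly_space k k. \<exists>p2\<in>poly_space (Suc k) d. p = (\<lambda>x. p1 x + p2 x)"
    using assms
  proof (induction rule: poly_space_induct)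
    case (monomial \<alpha>)
    show ?case
    proof (cases "sum_list \<alpha> = k")
      case True
      then have "(monomial \<alpha> :: real^'n::_ \<Rightarrow> real) \<in> poly_space k k"
        using monomial by (intro monomial_in_poly_space) (simp add: exponents_def)
      then show ?thesis by (intro bexI[of _ "monomial \<alpha>"] bexI[of _ "\<lambda>_. 0"]) (auto simp: poly_space_0)
    next
      case False
      then have "(monomial \<alpha> :: real^'n::_ \<Rightarrow> real) \<in> poly_space (Suc k) d"
        using monomial by (intro monomial_in_poly_space) (simp add: exponents_def)
      then show ?thesis by (intro bexI[of _ "\<lambda>_. 0"] bexI[of _ "monomial \<alpha>"]) (auto simp: poly_space_0)
    qed
  next
    case zero
    show ?case by (intro bexI[of _ "\<lambda>_. 0"]) (auto simp: poly_space_0)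
  next
    case (add p q)
    then obtain p1 p2 q1 q2 where "p1 \<in> poly_space k k" "p2 \<in> poly_space (Suc k) d"
      "q1 \<in> poly_space k k" "q2 \<in> poly_space (Suc k) d"
      "p = (\<lambda>x. p1 x + p2 x)" "q = (\<lambda>x. q1 x + q2 x)" by blast
    then show ?case
      by (intro bexI[of _ "\<lambda>x. p1 x + q1 x"] bexI[of _ "\<lambda>x. p2 x + q2 x"]) (auto intro: poly_space_add)
  next
    case (cmult c p)
    then obtain p1 p2 where "p1 \<in> poly_space k k" "p2 \<in> poly_space (Suc k) d" "p = (\<lambda>x. p1 x + p2 x)"
      by blast
    then show ?case
      by (intro bexI[of _ "\<lambda>x. c * p1 x"] bexI[of _ "\<lambda>x. c * p2 x"])
        (auto simp: distrib_left intro: poly_space_cmult)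
  qed
  then show thesis using that by blast
qed

lemma poly_space_1_of_zero:
  fixes p :: "real^'n::{finite,linorder} \<Rightarrow> real"
  assumes "p \<in> poly_space 0 d" and "p 0 = 0"
  shows "p \<in> poly_space 1 d"
proof -
  obtain p1 p2 where p: "p1 \<in> poly_space 0 0" "p2 \<in> poly_space 1 d" "p = (\<lambda>x. p1 x + p2 x)"
    using assms(1) by (auto elim: poly_space_split_lowest_degree)
  have "p1 x = p1 0" for x
    using poly_space_homogeneous[OF p(1), of 0 x] by simp
  moreover have "p1 0 = 0"
    using assms(2) poly_space_at_0[OF p(2)] by (simp add: p(3))
  ultimately show ?thesis using p by simp
qed

definition monomial_grad :: "nat list \<Rightarrow> real^'n::{finite,linorder} \<Rightarrow> real^'n::_" where
  "monomial_grad \<alpha> x = (\<chi> i. let k = coord_index i in real (\<alpha> ! k) * monomial (\<alpha>[k := \<alpha> ! k - 1]) x)"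

lemma GDERIV_monomial:
  fixes x :: "real^'n::{finite,linorder}"
  assumes "length \<alpha> = CARD('n)"
  shows "GDERIV (monomial \<alpha>) x :> monomial_grad \<alpha> x"
proof -
  let ?n = "CARD('n)"
  have product_rule: "((\<lambda>x. \<Prod>k<?n. (x $ coord k) ^ (\<alpha> ! k)) has_derivative
     (\<lambda>h. \<Sum>k<?n. (of_nat (\<alpha> ! k) * h $ coord k * (x $ coord k) ^ (\<alpha> ! k - 1)) *
        (\<Prod>l\<in>{..<?n} - {k}. (x $ coord l) ^ (\<alpha> ! l)))) (at x)"
    by (intro has_derivative_prod has_derivative_power bounded_linear_imp_has_derivative
        bounded_linear_vec_nth)
  have summand: "(of_nat (\<alpha> ! k) * h $ coord k * (x $ coord k) ^ (\<alpha> ! k - 1)) *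
        (\<Prod>l\<in>{..<?n} - {k}. (x $ coord l) ^ (\<alpha> ! l)) = h $ coord k * monomial_grad \<alpha> x $ coord k"
    if "k < ?n" for k h
  proof -
    have "monomial (\<alpha>[k := \<alpha> ! k - 1]) x = (x $ coord k) ^ (\<alpha> ! k - 1) *
       (\<Prod>l\<in>{..<?n} - {k}. (x $ coord l) ^ (\<alpha>[k := \<alpha> ! k - 1] ! l))"
      unfolding monomial_def
      using prod.remove[of "{..<?n}" k "\<lambda>l. (x $ coord l) ^ (\<alpha>[k := \<alpha> ! k - 1] ! l)"] that assms
      by simp
    also have "(\<Prod>l\<in>{..<?n} - {k}. (x $ coord l) ^ (\<alpha>[k := \<alpha> ! k - 1] ! l)) =
        (\<Prod>l\<in>{..<?n} - {k}. (x $ coord l) ^ (\<alpha> ! l))"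
      by (intro prod.cong) auto
    finally show ?thesis
      using that by (simp add: monomial_grad_def coord_index_coord Let_def)
  qed
  have "((\<lambda>x. \<Prod>k<?n. (x $ coord k) ^ (\<alpha> ! k)) has_derivative
     (\<lambda>h. \<Sum>k<?n. h $ coord k * monomial_grad \<alpha> x $ coord k)) (at x)"
    by (rule has_derivative_eq_rhs[OF product_rule]) (intro ext sum.cong refl summand, simp)
  then show ?thesis
    unfolding gderiv_def inner_vec_coord by (simp add: assms monomial_def[of \<alpha>, abs_def])
qed

lemma monomial_grad_in_poly_space:
  assumes "\<alpha> \<in> exponents CARD('n) d1 d2"
  shows "(\<lambda>x :: real^'n::{finite,linorder}. monomial_grad \<alpha> x $ i) \<in> poly_space (d1 - 1) (d2 - 1)"
proof -
  define k where "k = coord_index i"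
  have "(\<lambda>x :: real^'n::_. real (\<alpha> ! k) * monomial (\<alpha>[k := \<alpha> ! k - 1]) x) \<in> poly_space (d1 - 1) (d2 - 1)"
  proof (cases "\<alpha> ! k = 0")
    case True
    then show ?thesis by (simp add: poly_space_0)
  next
    case False
    moreover have "k < length \<alpha>"
      using assms coord_index_less_CARD[of i] by (simp add: k_def exponents_def)
    ultimately have "sum_list (\<alpha>[k := \<alpha> ! k - 1]) = sum_list \<alpha> - 1"
      by (simp add: sum_list_update)
    then show ?thesis
      using assms by (intro poly_space_cmult monomial_in_poly_space) (auto simp: exponents_def)
  qed
  then show ?thesis by (simp add: monomial_grad_def k_def Let_def)
qed

lemma poly_space_GDERIV_exists:
  fixes p :: "real^'n::{finite,linorder} \<Rightarrow> real"
  assumes "p \<in> poly_space d1 d2"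
  shows "\<exists>D. (\<forall>x. GDERIV p x :> D x) \<and> (\<forall>i. (\<lambda>x. D x $ i) \<in> poly_space (d1 - 1) (d2 - 1))"
  using assms
proof (induction rule: poly_space_induct)
  case (monomial \<alpha>)
  then have "length \<alpha> = CARD('n)" by (simp add: exponents_def)
  with monomial show ?case
    by (intro exI[of _ "monomial_grad \<alpha>"] conjI allI GDERIV_monomial monomial_grad_in_poly_space)
next
  case zero
  show ?case by (rule exI[of _ "\<lambda>_. 0"]) (auto simp: GDERIV_const poly_space_0)
next
  case (add p q)
  then obtain D E where "\<forall>x. GDERIV p x :> D x" "\<forall>i. (\<lambda>x. D x $ i) \<in> poly_space (d1 - 1) (d2 - 1)"
    "\<forall>x. GDERIV q x :> E x" "\<forall>i. (\<lambda>x. E x $ i) \<in> poly_space (d1 - 1) (d2 - 1)" by blast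
  then show ?case
    by (intro exI[of _ "\<lambda>x. D x + E x"]) (auto intro: GDERIV_add poly_space_add)
next
  case (cmult c p)
  then obtain D where D: "\<forall>x. GDERIV p x :> D x" "\<forall>i. (\<lambda>x. D x $ i) \<in> poly_space (d1 - 1) (d2 - 1)"
    by blast
  then have "GDERIV (\<lambda>x. c * p x) x :> c *\<^sub>R D x" for x
    using GDERIV_mult[OF GDERIV_const[of c], of p x "D x"] by simp
  with D(2) show ?case
    by (intro exI[of _ "\<lambda>x. c *\<^sub>R D x"]) (auto intro: poly_space_cmult)
qed

lemma
  fixes p :: "real^'n::{finite,linorder} \<Rightarrow> real"
  assumes "p \<in> poly_space d1 d2"
  shows poly_space_GDERIV: "GDERIV p x :> grad p x"
    and poly_space_grad: "(\<lambda>x. grad p x $ i) \<in> poly_space (d1 - 1) (d2 - 1)"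
proof -
  obtain D where D: "\<And>x. GDERIV p x :> D x" "\<And>i. (\<lambda>x. D x $ i) \<in> poly_space (d1 - 1) (d2 - 1)"
    using poly_space_GDERIV_exists[OF assms] by blast
  moreover have "grad p = D" using grad_eqI[OF D(1)] by auto
  ultimately show "GDERIV p x :> grad p x" "(\<lambda>x. grad p x $ i) \<in> poly_space (d1 - 1) (d2 - 1)"
    by auto
qed

text \<open>A nonnegative polynomial vanishing at the origin has a minimum there, hence no linear part.\<close>

lemma poly_space_2_of_nonneg:
  fixes p :: "real^'n::{finite,linorder} \<Rightarrow> real"
  assumes "p \<in> poly_space 0 d" and "p 0 = 0" and nonneg: "\<And>x. p x \<ge> 0"
  shows "p \<in> poly_space 2 d"
proof -
  obtain p1 p2 where p: "p1 \<in> poly_space 1 1" "p2 \<in> poly_space 2 d" "p = (\<lambda>x. p1 x + p2 x)"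
    using poly_space_1_of_zero[OF assms(1,2)]
    by (auto elim: poly_space_split_lowest_degree simp: numeral_2_eq_2)
  have "p1 x = 0" for x
  proof -
    have "grad p2 0 $ i = 0" for i
      using poly_space_at_0[OF poly_space_grad[OF p(2)]] by simp
    then have "grad p2 (0 *\<^sub>R x) = 0" by (simp add: Finite_Cartesian_Product.vec_eq_iff)
    then have "((\<lambda>t. p2 (t *\<^sub>R x)) has_real_derivative 0 \<bullet> x) (at 0)"
      using poly_space_GDERIV[OF p(2), of "0 *\<^sub>R x"]
      by (intro GDERIV_compose_has_vector_derivative) (auto intro!: derivative_eq_intros)
    then have "((\<lambda>t. t * p1 x + p2 (t *\<^sub>R x)) has_real_derivative p1 x) (at 0)"
      by (auto intro!: derivative_eq_intros)
    then have "((\<lambda>t. p (t *\<^sub>R x)) has_real_derivative p1 x) (at 0)"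
      using poly_space_homogeneous[OF p(1)] by (simp add: p(3))
    then show ?thesis
      by (rule DERIV_local_min[of _ _ _ 1]) (use assms(2) nonneg in auto)
  qed
  then show ?thesis using p by simp
qed

subsection \<open>Pointwise limits of polynomials of bounded degree\<close>

definition lagrange_basis :: "'a::field set \<Rightarrow> 'a \<Rightarrow> 'a poly" where
  "lagrange_basis A x = (\<Prod>y\<in>A - {x}. Polynomial.smult (1 / (x - y)) [:- y, 1:])"

lemma poly_lagrange_basis:
  assumes "finite A" and "z \<in> A"
  shows "poly (lagrange_basis A x) z = (if x = z then 1 else 0)"
proof -
  have eval: "poly (lagrange_basis A x) z = (\<Prod>y\<in>A - {x}. (z - y) / (x - y))"
    by (simp add: lagrange_basis_def poly_prod diff_divide_distrib)
  show ?thesis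
  proof (cases "x = z")
    case True
    then have "(\<Prod>y\<in>A - {x}. (z - y) / (x - y)) = 1" by (intro prod.neutral) auto
    then show ?thesis unfolding eval using True by (simp only: if_P)
  next
    case False
    then have "\<exists>y\<in>A - {x}. (z - y) / (x - y) = 0" using \<open>z \<in> A\<close> by (intro bexI[of _ z]) auto
    then show ?thesis using False \<open>finite A\<close> by (simp add: eval prod_zero)
  qed
qed

lemma degree_lagrange_basis_less:
  assumes "finite A" and "x \<in> A"
  shows "Polynomial.degree (lagrange_basis A x) < card A"
proof -
  have "Polynomial.degree (lagrange_basis A x) \<le>
      (\<Sum>y\<in>A - {x}. Polynomial.degree (Polynomial.smult (1 / (x - y)) [:- y, 1:]))"
    unfolding lagrange_basis_def
    by (rule order_trans[OF degree_prod_sum_le]) (use \<open>finite A\<close> in \<open>simp_all add: o_def\<close>)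
  also have "\<dots> \<le> (\<Sum>y\<in>A - {x}. 1)"
    by (intro sum_mono order_trans[OF degree_smult_le]) simp
  also have "\<dots> < card A"
    using card_Diff1_less[OF assms] by simp
  finally show ?thesis .
qed

lemma inverse_vandermonde_exists:
  fixes A :: "'a::field set"
  assumes "finite A"
  shows "\<exists>w. \<forall>j<card A. (\<Sum>x\<in>A. w x * x ^ j) = (if j = m then 1 else 0)"
proof -
  have "(\<Sum>x\<in>A. Polynomial.coeff (lagrange_basis A x) m * x ^ j) = (if j = m then 1 else 0)"
    if j: "j < card A" for j
  proof -
    let ?p = "\<Sum>x\<in>A. Polynomial.smult (x ^ j) (lagrange_basis A x)"
    have "?p = Polynomial.monom 1 j"
    proof (rule poly_eqI_degree[of A])
      show "poly ?p y = poly (Polynomial.monom 1 j) y" if "y \<in> A" for y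
        using that assms
        by (simp add: poly_sum poly_monom poly_lagrange_basis if_distrib[of "\<lambda>c. _ * c"] cong: if_cong)
      show "card A > Polynomial.degree ?p"
        using j degree_lagrange_basis_less[OF assms]
        by (intro degree_sum_less) (auto intro: le_less_trans[OF degree_smult_le])
    qed (use j in \<open>simp add: degree_monom_eq\<close>)
    then have "Polynomial.coeff ?p m = Polynomial.coeff (Polynomial.monom 1 j) m" by simp
    then show ?thesis by (simp add: coeff_sum mult.commute)
  qed
  then show ?thesis by (intro exI[of _ "\<lambda>x. Polynomial.coeff (lagrange_basis A x) m"]) simp
qed

definition grid_point :: "(nat \<Rightarrow> real) \<Rightarrow> real^'n::{finite,linorder}" where
  "grid_point \<kappa> = (\<chi> i. \<kappa> (coord_index i))"

lemma monomial_grid_point: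
  assumes "length \<alpha> = CARD('n)"
  shows "monomial \<alpha> (grid_point \<kappa> :: real^'n::{finite,linorder}) = (\<Prod>k<CARD('n). \<kappa> k ^ (\<alpha> ! k))"
  using assms by (simp add: monomial_def grid_point_def coord_index_coord)

text \<open>By interpolation on a grid, every coefficient is a linear combination of finitely many values.\<close>

lemma coefficient_functional_exists:
  assumes "length \<alpha> = CARD('n::{finite,linorder})"
  shows "\<exists>G w. finite G \<and> (\<forall>\<beta>\<in>exponents CARD('n) 0 d.
    (\<Sum>\<kappa>\<in>G. w \<kappa> * monomial \<beta> (grid_point \<kappa> :: real^'n::_)) = (if \<beta> = \<alpha> then 1 else 0))"
proof -
  let ?n = "CARD('n)"
  define A where "A = real ` {..d}"
  have A: "finite A" "card A = Suc d" by (auto simp: A_def card_image)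
  have "\<exists>w. \<forall>j\<le>d. (\<Sum>x\<in>A. w x * x ^ j) = (if j = \<alpha> ! k then 1 else 0)" for k
    using inverse_vandermonde_exists[OF A(1)] unfolding A(2) less_Suc_eq_le .
  then obtain w where w: "\<And>k. \<forall>j\<le>d. (\<Sum>x\<in>A. w k x * x ^ j) = (if j = \<alpha> ! k then 1 else 0)"
    by metis
  define G where "G = PiE {..<?n} (\<lambda>_. A)"
  have "(\<Sum>\<kappa>\<in>G. (\<Prod>k<?n. w k (\<kappa> k)) * monomial \<beta> (grid_point \<kappa> :: real^'n::_)) = (if \<beta> = \<alpha> then 1 else 0)"
    if "\<beta> \<in> exponents ?n 0 d" for \<beta>
  proof -
    have \<beta>: "length \<beta> = ?n" "\<And>k. k < ?n \<Longrightarrow> \<beta> ! k \<le> d"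
      using that elem_le_sum_list[of _ \<beta>] by (auto simp: exponents_def intro: order_trans)
    have "(\<Sum>\<kappa>\<in>G. (\<Prod>k<?n. w k (\<kappa> k)) * monomial \<beta> (grid_point \<kappa> :: real^'n::_)) =
        (\<Prod>k<?n. \<Sum>x\<in>A. w k x * x ^ (\<beta> ! k))"
      unfolding G_def using A(1) \<beta>(1) by (simp add: prod_sum_PiE monomial_grid_point prod.distrib)
    also have "\<dots> = (\<Prod>k<?n. if \<beta> ! k = \<alpha> ! k then 1 else 0)"
      using \<beta>(2) by (intro prod.cong refl) (simp add: w)
    also have "\<dots> = (if \<beta> = \<alpha> then 1 else 0)"
      using \<beta>(1) assms by (auto simp: list_eq_iff_nth_eq intro!: prod_zero)
    finally show ?thesis .
  qed
  moreover have "finite G" using A(1) by (simp add: G_def finite_PiE)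
  ultimately show ?thesis
    by (intro exI[of _ G] exI[of _ "\<lambda>\<kappa>. \<Prod>k<?n. w k (\<kappa> k)"] conjI ballI)
qed

lemma poly_space_coefficient_functional:
  assumes "\<alpha> \<in> exponents CARD('n::{finite,linorder}) d1 d2"
  obtains G w where "\<And>a. (\<Sum>\<kappa>\<in>G. w \<kappa> * (\<Sum>\<beta>\<in>exponents CARD('n) d1 d2.
    a \<beta> * monomial \<beta> (grid_point \<kappa> :: real^'n::_))) = a \<alpha>"
proof -
  let ?E = "exponents CARD('n) d1 d2"
  obtain G w where coefficient: "\<And>\<beta>. \<beta> \<in> exponents CARD('n) 0 d2 \<Longrightarrow>
      (\<Sum>\<kappa>\<in>G. w \<kappa> * monomial \<beta> (grid_point \<kappa> :: real^'n::_)) = (if \<beta> = \<alpha> then 1 else 0)"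
    using coefficient_functional_exists[of \<alpha> d2, where 'n='n] assms by (auto simp: exponents_def)
  have "(\<Sum>\<kappa>\<in>G. w \<kappa> * (\<Sum>\<beta>\<in>?E. a \<beta> * monomial \<beta> (grid_point \<kappa> :: real^'n::_))) = a \<alpha>" for a
  proof -
    have "(\<Sum>\<kappa>\<in>G. w \<kappa> * (\<Sum>\<beta>\<in>?E. a \<beta> * monomial \<beta> (grid_point \<kappa> :: real^'n::_))) =
        (\<Sum>\<beta>\<in>?E. a \<beta> * (\<Sum>\<kappa>\<in>G. w \<kappa> * monomial \<beta> (grid_point \<kappa> :: real^'n::_)))"
      unfolding sum_distrib_left by (subst sum.swap) (simp add: mult.left_commute)
    also have "\<dots> = (\<Sum>\<beta>\<in>?E. a \<beta> * (if \<beta> = \<alpha> then 1 else 0))"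
      by (intro sum.cong refl) (simp add: coefficient exponents_def)
    also have "\<dots> = a \<alpha>" using assms by (simp add: if_distrib[of "\<lambda>c. _ * c"] cong: if_cong)
    finally show ?thesis .
  qed
  then show thesis by (rule that)
qed

lemma grad_monomial_sum:
  fixes x :: "real^'n::{finite,linorder}"
  assumes "A \<subseteq> exponents CARD('n) d1 d2"
  shows "grad (\<lambda>x. \<Sum>\<alpha>\<in>A. a \<alpha> * monomial \<alpha> x) x = (\<Sum>\<alpha>\<in>A. a \<alpha> *\<^sub>R monomial_grad \<alpha> x)"
proof (rule grad_eqI)
  have "GDERIV (monomial \<alpha>) x :> monomial_grad \<alpha> x" if "\<alpha> \<in> A" for \<alpha>
    using that assms by (intro GDERIV_monomial) (auto simp: exponents_def)
  then show "GDERIV (\<lambda>x. \<Sum>\<alpha>\<in>A. a \<alpha> * monomial \<alpha> x) x :> (\<Sum>\<alpha>\<in>A. a \<alpha> *\<^sub>R monomial_grad \<alpha> x)"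
    by (auto simp: gderiv_def inner_sum_right intro!: derivative_eq_intros sum.cong)
qed

lemma
  fixes p :: "nat \<Rightarrow> real^'n::{finite,linorder} \<Rightarrow> real"
  assumes p: "\<And>k. p k \<in> poly_space d1 d2" and lim: "\<And>x. (\<lambda>k. p k x) \<longlonglongrightarrow> h x"
  shows poly_space_pointwise_limit: "h \<in> poly_space d1 d2"
    and grad_pointwise_limit: "(\<lambda>k. grad (p k) x) \<longlonglongrightarrow> grad h x"
proof -
  let ?E = "exponents CARD('n) d1 d2"
  have "\<exists>a. p k = (\<lambda>x. \<Sum>\<alpha>\<in>?E. a \<alpha> * monomial \<alpha> x)" for k
    using p[of k] by (blast elim: poly_spaceE)
  then obtain a where a: "\<And>k. p k = (\<lambda>x. \<Sum>\<alpha>\<in>?E. a k \<alpha> * monomial \<alpha> x)"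
    by metis
  have "\<exists>s. (\<lambda>k. a k \<alpha>) \<longlonglongrightarrow> s" if \<alpha>: "\<alpha> \<in> ?E" for \<alpha>
  proof -
    obtain G w where "\<And>a. (\<Sum>\<kappa>\<in>G. w \<kappa> * (\<Sum>\<beta>\<in>?E. a \<beta> * monomial \<beta> (grid_point \<kappa> :: real^'n::_))) = a \<alpha>"
      by (rule poly_space_coefficient_functional[OF \<alpha>]) blast
    then have "(\<lambda>k. a k \<alpha>) = (\<lambda>k. \<Sum>\<kappa>\<in>G. w \<kappa> * p k (grid_point \<kappa>))"
      by (simp add: a)
    moreover have "(\<lambda>k. \<Sum>\<kappa>\<in>G. w \<kappa> * p k (grid_point \<kappa>)) \<longlonglongrightarrow> (\<Sum>\<kappa>\<in>G. w \<kappa> * h (grid_point \<kappa>))"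
      by (intro tendsto_intros lim)
    ultimately show ?thesis by auto
  qed
  then obtain s where s: "\<And>\<alpha>. \<alpha> \<in> ?E \<Longrightarrow> (\<lambda>k. a k \<alpha>) \<longlonglongrightarrow> s \<alpha>" by metis
  have "(\<lambda>k. p k x) \<longlonglongrightarrow> (\<Sum>\<alpha>\<in>?E. s \<alpha> * monomial \<alpha> x)" for x
    unfolding a by (intro tendsto_intros s)
  then have h: "h = (\<lambda>x. \<Sum>\<alpha>\<in>?E. s \<alpha> * monomial \<alpha> x)"
    using LIMSEQ_unique[OF lim] by blast
  then show "h \<in> poly_space d1 d2" by (blast intro: poly_spaceI)
  show "(\<lambda>k. grad (p k) x) \<longlonglongrightarrow> grad h x"
    unfolding a h grad_monomial_sum[OF order_refl] by (intro tendsto_intros s)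
qed

subsection \<open>Closure properties, continuity and Lipschitz bounds\<close>

lemma is_polynomialI: "p \<in> poly_space d1 d2 \<Longrightarrow> is_polynomial p"
  unfolding is_polynomial_def using poly_space_mono[of p d1 d2 0 d2] by auto

lemma is_polynomial_poly_degree: "is_polynomial p \<Longrightarrow> p \<in> poly_space 0 (poly_degree p)"
  unfolding is_polynomial_def poly_degree_def by (rule LeastI_ex)

lemma is_polynomial_common_degree:
  assumes "is_polynomial p" and "is_polynomial q"
  obtains d where "p \<in> poly_space 0 d" "q \<in> poly_space 0 d"
proof
  let ?d = "max (poly_degree p) (poly_degree q)"
  show "p \<in> poly_space 0 ?d" "q \<in> poly_space 0 ?d"
    using assms by (auto intro: poly_space_mono[OF is_polynomial_poly_degree])
qed

lemma is_polynomial_const: "is_polynomial (\<lambda>x. c)"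
  using poly_space_const by (rule is_polynomialI)

lemma is_polynomial_add: "is_polynomial p \<Longrightarrow> is_polynomial q \<Longrightarrow> is_polynomial (\<lambda>x. p x + q x)"
  by (erule (1) is_polynomial_common_degree) (rule is_polynomialI[OF poly_space_add])

lemma is_polynomial_diff: "is_polynomial p \<Longrightarrow> is_polynomial q \<Longrightarrow> is_polynomial (\<lambda>x. p x - q x)"
  by (erule (1) is_polynomial_common_degree) (rule is_polynomialI[OF poly_space_diff])

lemma is_polynomial_mult: "is_polynomial p \<Longrightarrow> is_polynomial q \<Longrightarrow> is_polynomial (\<lambda>x. p x * q x)"
  by (erule (1) is_polynomial_common_degree) (rule is_polynomialI[OF poly_space_mult])

lemma is_polynomial_sum:
  "(\<And>i. i \<in> I \<Longrightarrow> is_polynomial (p i)) \<Longrightarrow> is_polynomial (\<lambda>x. \<Sum>i\<in>I. p i x)"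
  by (induction I rule: infinite_finite_induct) (simp_all add: is_polynomial_const is_polynomial_add)

lemma is_polynomial_GDERIV: "is_polynomial p \<Longrightarrow> GDERIV p x :> grad p x"
  unfolding is_polynomial_def by (blast intro: poly_space_GDERIV)

lemma is_polynomial_continuous_on: "is_polynomial p \<Longrightarrow> continuous_on S p"
  by (intro continuous_at_imp_continuous_on ballI
      has_derivative_continuous[OF is_polynomial_GDERIV[unfolded gderiv_def]])

lemma is_polynomial_continuous_on_grad:
  assumes "is_polynomial p"
  shows "continuous_on S (grad p)"
proof -
  have "is_polynomial (\<lambda>x. grad p x $ i)" for i
    by (rule is_polynomialI[OF poly_space_grad[OF is_polynomial_poly_degree[OF assms]]])
  then have "continuous_on S (\<lambda>x. \<chi> i. grad p x $ i)"
    by (intro continuous_on_vec_lambda is_polynomial_continuous_on)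
  then show ?thesis by simp
qed

lemma GDERIV_bounded_imp_lipschitz_on:
  assumes "convex S" and deriv: "\<And>y. y \<in> S \<Longrightarrow> GDERIV V y :> D y"
    and bound: "\<And>y. y \<in> S \<Longrightarrow> norm (D y) \<le> B" and "0 \<le> B"
  shows "B-lipschitz_on S V"
proof (rule lipschitz_onI)
  fix x y assume xy: "x \<in> S" "y \<in> S"
  have "norm (V x - V y) \<le> B * norm (x - y)"
  proof (rule differentiable_bound[OF \<open>convex S\<close> _ _ xy])
    fix z assume z: "z \<in> S"
    show "(V has_derivative (\<lambda>h. h \<bullet> D z)) (at z within S)"
      using deriv[OF z] by (simp add: gderiv_def has_derivative_at_withinI)
    show "onorm (\<lambda>h. h \<bullet> D z) \<le> B"
    proof (rule onorm_bound[OF \<open>0 \<le> B\<close>])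
      show "norm (h \<bullet> D z) \<le> B * norm h" for h
        using Cauchy_Schwarz_ineq2[of "D z" h] mult_right_mono[OF bound[OF z], of "norm h"]
        by (simp add: inner_commute)
    qed
  qed
  then show "dist (V x) (V y) \<le> B * dist x y" by (simp add: dist_norm)
qed (rule \<open>0 \<le> B\<close>)

lemma is_polynomial_lipschitz_on_cball:
  fixes p :: "real^'n::{finite,linorder} \<Rightarrow> real"
  assumes "is_polynomial p"
  shows "\<exists>L. L-lipschitz_on (cball 0 \<rho>) p"
proof -
  have "bounded (grad p ` cball 0 \<rho>)"
    by (intro compact_imp_bounded compact_continuous_image is_polynomial_continuous_on_grad assms
        compact_cball)
  then obtain B where "B > 0" "\<And>y. y \<in> cball 0 \<rho> \<Longrightarrow> norm (grad p y) \<le> B"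
    by (auto simp: bounded_pos)
  then have "B-lipschitz_on (cball 0 \<rho>) p"
    by (intro GDERIV_bounded_imp_lipschitz_on[where D = "grad p"] is_polynomial_GDERIV assms) auto
  then show ?thesis by blast
qed

lemma lipschitz_on_vec_components:
  fixes F :: "'a::metric_space \<Rightarrow> real^'k"
  assumes "\<And>i. \<exists>L. L-lipschitz_on S (\<lambda>x. F x $ i)"
  shows "\<exists>L. L-lipschitz_on S F"
proof -
  obtain L where L: "\<And>i. (L i)-lipschitz_on S (\<lambda>x. F x $ i)"
    using assms by metis
  have "(\<Sum>i\<in>UNIV. L i)-lipschitz_on S F"
  proof (rule lipschitz_onI)
    fix x y assume "x \<in> S" "y \<in> S"
    have "dist (F x) (F y) \<le> (\<Sum>i\<in>UNIV. \<bar>(F x - F y) $ i\<bar>)"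
      unfolding dist_norm by (rule norm_le_l1_cart)
    also have "\<dots> \<le> (\<Sum>i\<in>UNIV. L i * dist x y)"
      using lipschitz_onD[OF L \<open>x \<in> S\<close> \<open>y \<in> S\<close>] by (intro sum_mono) (simp add: dist_real_def)
    finally show "dist (F x) (F y) \<le> (\<Sum>i\<in>UNIV. L i) * dist x y"
      by (simp add: sum_distrib_right)
  qed (intro sum_nonneg lipschitz_on_nonneg[OF L])
  then show ?thesis by blast
qed

subsection \<open>Coefficient vectors\<close>

definition exponent_list :: "nat \<Rightarrow> nat \<Rightarrow> nat \<Rightarrow> nat list list" where
  "exponent_list n d1 d2 = rev (sorted_list_of_set (exponents n d1 d2))"

lemma set_exponent_list [simp]: "set (exponent_list n d1 d2) = exponents n d1 d2"
  by (simp add: exponent_list_def)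

lemma length_exponent_list [simp]: "length (exponent_list n d1 d2) = card (exponents n d1 d2)"
  by (simp add: exponent_list_def)

lemma monomials_carrier_vec:
  "monomials d1 d2 (x :: real^'n::{finite,linorder}) \<in> carrier_vec (card (exponents CARD('n) d1 d2))"
  by (simp add: monomials_def carrier_vecI)

lemma vec_index_monomials:
  assumes "k < card (exponents CARD('n) d1 d2)"
  shows "vec_index (monomials d1 d2 (x :: real^'n::{finite,linorder})) k =
    monomial (exponent_list CARD('n) d1 d2 ! k) x"
  using assms by (simp add: monomials_def vec_of_list_index exponent_list_def)

lemma vec_index_monomials_in_poly_space:
  assumes "k < card (exponents CARD('n) d1 d2)"
  shows "(\<lambda>x :: real^'n::{finite,linorder}. vec_index (monomials d1 d2 x) k) \<in> poly_space d1 d2"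
proof -
  have "exponent_list CARD('n) d1 d2 ! k \<in> exponents CARD('n) d1 d2"
    using assms nth_mem[of k "exponent_list CARD('n) d1 d2"] by simp
  then show ?thesis
    unfolding vec_index_monomials[OF assms] by (rule monomial_in_poly_space)
qed

lemma scalar_prod_monomials_in_poly_space:
  "(\<lambda>x :: real^'n::{finite,linorder}. scalar_prod a (monomials d1 d2 x)) \<in> poly_space d1 d2"
  unfolding scalar_prod_def carrier_vecD[OF monomials_carrier_vec]
  by (intro poly_space_sum poly_space_cmult vec_index_monomials_in_poly_space) simp

lemma poly_space_scalar_prodE:
  fixes p :: "real^'n::{finite,linorder} \<Rightarrow> real"
  assumes "p \<in> poly_space d1 d2"
  obtains a where "a \<in> carrier_vec (card (exponents CARD('n) d1 d2))"
    "p = (\<lambda>x. scalar_prod a (monomials d1 d2 x))"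
proof -
  let ?E = "exponents CARD('n) d1 d2"
  obtain b where b: "p = (\<lambda>x. \<Sum>\<alpha>\<in>?E. b \<alpha> * monomial \<alpha> x)"
    using assms by (rule poly_spaceE)
  define a where "a = Matrix.vec (card ?E) (\<lambda>k. b (exponent_list CARD('n) d1 d2 ! k))"
  have "p x = scalar_prod a (monomials d1 d2 x)" for x
  proof -
    have "p x = sum_list (map (\<lambda>\<alpha>. b \<alpha> * monomial \<alpha> x) (exponent_list CARD('n) d1 d2))"
      unfolding b by (subst sum_list_distinct_conv_sum_set) (auto simp: exponent_list_def)
    then show ?thesis
      by (simp add: sum_list_sum_nth scalar_prod_def carrier_vecD[OF monomials_carrier_vec]
          vec_index_monomials a_def)
  qed
  then show thesis by (intro that[of a]) (auto simp: a_def)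
qed

subsection \<open>Sums of squares\<close>

definition quadratic_form :: "'i set \<Rightarrow> ('i \<Rightarrow> 'i \<Rightarrow> real) \<Rightarrow> ('i \<Rightarrow> real) \<Rightarrow> real" where
  "quadratic_form A a v = (\<Sum>i\<in>A. \<Sum>j\<in>A. a i j * v i * v j)"

lemma quadratic_form_cong:
  "(\<And>i. i \<in> A \<Longrightarrow> v i = w i) \<Longrightarrow> quadratic_form A a v = quadratic_form A a w"
  unfolding quadratic_form_def by (intro sum.cong) auto

lemma quadratic_form_insert:
  assumes "finite A" "k \<notin> A" and sym: "\<And>i j. a i j = a j i"
  shows "quadratic_form (insert k A) a v =
    a k k * (v k)\<^sup>2 + 2 * v k * (\<Sum>j\<in>A. a k j * v j) + quadratic_form A a v"
proof -
  have "quadratic_form (insert k A) a v =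
      a k k * v k * v k + (\<Sum>j\<in>A. a k j * v k * v j) + ((\<Sum>i\<in>A. a i k * v i * v k) + quadratic_form A a v)"
    using assms(1,2) by (simp add: quadratic_form_def sum.distrib)
  moreover have "(\<Sum>j\<in>A. a k j * v k * v j) = v k * (\<Sum>j\<in>A. a k j * v j)"
    "(\<Sum>i\<in>A. a i k * v i * v k) = v k * (\<Sum>j\<in>A. a k j * v j)"
    by (auto simp: sum_distrib_left sym[of _ k] intro!: sum.cong)
  ultimately show ?thesis by (simp add: power2_eq_square)
qed

definition schur_complement :: "'i \<Rightarrow> ('i \<Rightarrow> 'i \<Rightarrow> real) \<Rightarrow> 'i \<Rightarrow> 'i \<Rightarrow> real" where
  "schur_complement k a i j = a i j - a k i * a k j / a k k"

lemma quadratic_form_insert_complete_square: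
  assumes "finite A" "k \<notin> A" and sym: "\<And>i j. a i j = a j i" and "a k k \<noteq> 0"
  shows "quadratic_form (insert k A) a v =
    a k k * (v k + (\<Sum>j\<in>A. a k j * v j) / a k k)\<^sup>2 + quadratic_form A (schur_complement k a) v"
proof -
  define s where "s = (\<Sum>j\<in>A. a k j * v j)"
  have "s\<^sup>2 / a k k = quadratic_form A (\<lambda>i j. a k i * a k j / a k k) v"
    unfolding s_def quadratic_form_def power2_eq_square sum_product sum_divide_distrib
    by (simp add: mult.assoc mult.left_commute divide_simps)
  then have "quadratic_form A (schur_complement k a) v = quadratic_form A a v - s\<^sup>2 / a k k"
    by (simp add: quadratic_form_def schur_complement_def left_diff_distrib sum_subtractf)
  moreover have "a k k * (v k + s / a k k)\<^sup>2 = a k k * (v k)\<^sup>2 + 2 * v k * s + s\<^sup>2 / a k k"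
    using \<open>a k k \<noteq> 0\<close> by (simp add: field_simps power2_eq_square)
  ultimately show ?thesis
    by (simp add: quadratic_form_insert[OF assms(1,2) sym] s_def)
qed

definition positive_definite_form :: "'i set \<Rightarrow> ('i \<Rightarrow> 'i \<Rightarrow> real) \<Rightarrow> bool" where
  "positive_definite_form A a \<longleftrightarrow> (\<forall>v. (\<exists>i\<in>A. v i \<noteq> 0) \<longrightarrow> quadratic_form A a v > 0)"

lemma positive_definite_form_pos:
  "positive_definite_form A a \<Longrightarrow> i \<in> A \<Longrightarrow> v i \<noteq> 0 \<Longrightarrow> quadratic_form A a v > 0"
  unfolding positive_definite_form_def by blast

lemma positive_definite_form_diagonal_pos:
  assumes "finite A" "k \<notin> A" and sym: "\<And>i j. a i j = a j i"
    and pos: "positive_definite_form (insert k A) a"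
  shows "a k k > 0"
proof -
  let ?\<delta> = "\<lambda>i. if i = k then 1 else 0 :: real"
  have "quadratic_form A a ?\<delta> = quadratic_form A a (\<lambda>_. 0)"
    using \<open>k \<notin> A\<close> by (intro quadratic_form_cong) auto
  also have "\<dots> = 0" by (simp add: quadratic_form_def)
  finally have "quadratic_form A a ?\<delta> = 0" .
  moreover have "(\<Sum>j\<in>A. a k j * ?\<delta> j) = 0"
    using \<open>k \<notin> A\<close> by (intro sum.neutral) auto
  ultimately have "quadratic_form (insert k A) a ?\<delta> = a k k"
    unfolding quadratic_form_insert[OF assms(1,2) sym] by simp
  then show ?thesis using positive_definite_form_pos[OF pos, of k ?\<delta>] by simp
qed

lemma positive_definite_form_schur_complement:
  assumes A: "finite A" "k \<notin> A" and sym: "\<And>i j. a i j = a j i"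
    and pos: "positive_definite_form (insert k A) a"
  shows "positive_definite_form A (schur_complement k a)"
  unfolding positive_definite_form_def
proof (intro allI impI)
  fix v :: "'a \<Rightarrow> real" assume "\<exists>i\<in>A. v i \<noteq> 0"
  then obtain i where i: "i \<in> A" "v i \<noteq> 0" by blast
  define w where "w = v(k := - (\<Sum>j\<in>A. a k j * v j) / a k k)"
  have w_on_A: "w j = v j" if "j \<in> A" for j using that A(2) by (auto simp: w_def)
  then have "(\<Sum>j\<in>A. a k j * w j) = (\<Sum>j\<in>A. a k j * v j)" by (intro sum.cong) auto
  then have "w k + (\<Sum>j\<in>A. a k j * w j) / a k k = 0" by (simp add: w_def)
  then have "quadratic_form (insert k A) a w = quadratic_form A (schur_complement k a) w"
    using quadratic_form_insert_complete_square[OF A sym, where v = w]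
      positive_definite_form_diagonal_pos[OF A sym pos] by simp
  moreover have "quadratic_form A (schur_complement k a) w = quadratic_form A (schur_complement k a) v"
    by (rule quadratic_form_cong) (rule w_on_A)
  ultimately show "quadratic_form A (schur_complement k a) v > 0"
    using positive_definite_form_pos[OF pos, of i w] i w_on_A by simp
qed

lemma positive_definite_form_sum_of_squares:
  fixes a :: "'i \<Rightarrow> 'i \<Rightarrow> real"
  assumes "finite A" and "\<And>i j. a i j = a j i" and "positive_definite_form A a"
  shows "\<exists>ws. \<forall>v. quadratic_form A a v = (\<Sum>w\<leftarrow>ws. (\<Sum>i\<in>A. w i * v i)\<^sup>2)"
  using assms
proof (induction A arbitrary: a rule: finite_induct)
  case empty
  show ?case by (rule exI[of _ "[]"]) (simp add: quadratic_form_def)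
next
  case (insert k A a)
  have "a k k > 0" by (rule positive_definite_form_diagonal_pos[OF insert.hyps insert.prems])
  have "schur_complement k a i j = schur_complement k a j i" for i j
    using insert.prems(1)[of i j] by (simp add: schur_complement_def mult.commute)
  then obtain ws where ws: "\<And>v. quadratic_form A (schur_complement k a) v = (\<Sum>w\<leftarrow>ws. (\<Sum>i\<in>A. w i * v i)\<^sup>2)"
    using insert.IH positive_definite_form_schur_complement[OF insert.hyps insert.prems] by blast
  define c where "c = sqrt (a k k)"
  have c: "c > 0" "a k k = c * c" using \<open>a k k > 0\<close> by (auto simp: c_def)
  define w0 where "w0 = (\<lambda>i. a k i / c)(k := c)"
  have w0: "(\<Sum>i\<in>insert k A. w0 i * v i)\<^sup>2 = a k k * (v k + (\<Sum>j\<in>A. a k j * v j) / a k k)\<^sup>2" for v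
  proof -
    have "(\<Sum>i\<in>A. w0 i * v i) = (\<Sum>i\<in>A. a k i * v i) / c"
      using insert.hyps by (auto simp: w0_def sum_divide_distrib intro!: sum.cong)
    moreover have "w0 k = c" by (simp add: w0_def)
    ultimately have "(\<Sum>i\<in>insert k A. w0 i * v i) = c * (v k + (\<Sum>j\<in>A. a k j * v j) / a k k)"
      using insert.hyps c by (simp add: distrib_left)
    then show ?thesis using c(2) by (simp add: power2_eq_square)
  qed
  have extend: "(\<Sum>i\<in>insert k A. (w(k := 0)) i * v i) = (\<Sum>i\<in>A. w i * v i)" for w v :: "'i \<Rightarrow> real"
    using insert.hyps by (auto intro!: sum.cong)
  have "quadratic_form (insert k A) a v =
      a k k * (v k + (\<Sum>j\<in>A. a k j * v j) / a k k)\<^sup>2 + quadratic_form A (schur_complement k a) v" for v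
    using \<open>a k k > 0\<close> by (intro quadratic_form_insert_complete_square insert) auto
  then have "quadratic_form (insert k A) a v =
      (\<Sum>w\<leftarrow>w0 # map (\<lambda>w. w(k := 0)) ws. (\<Sum>i\<in>insert k A. w i * v i)\<^sup>2)" for v
    unfolding ws list.map sum_list.Cons w0 map_map o_def extend .
  then show ?case by (intro exI allI)
qed

lemma inner_matrix_vector_eq_quadratic_form:
  "v \<bullet> (R *v v) = quadratic_form UNIV (\<lambda>i j. R $ i $ j) (\<lambda>i. (v :: real^'m) $ i)"
  by (simp add: quadratic_form_def inner_vec_def matrix_vector_mult_def sum_distrib_left mult.commute
      mult.left_commute)

lemma SOS_0: "SOS (\<lambda>x. 0)"
  unfolding SOS_def by (rule exI[of _ "[]"]) simp

lemma SOS_nonneg: "SOS p \<Longrightarrow> p x \<ge> 0"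
  unfolding SOS_def by (auto intro!: sum_list_nonneg)

lemma SOS_add:
  assumes "SOS p" and "SOS q"
  shows "SOS (\<lambda>x. p x + q x)"
proof -
  obtain hs ks where "\<forall>h\<in>set (hs @ ks). is_polynomial h"
    "p = (\<lambda>x. \<Sum>h\<leftarrow>hs. (h x)\<^sup>2)" "q = (\<lambda>x. \<Sum>h\<leftarrow>ks. (h x)\<^sup>2)"
    using assms by (auto simp: SOS_def)
  then show ?thesis
    unfolding SOS_def by (intro exI[of _ "hs @ ks"]) auto
qed

lemma SOS_quadratic_form:
  fixes v :: "real^'n::{finite,linorder} \<Rightarrow> real^'m"
  assumes R_sym: "transpose R = R" and R_pd: "positive_definite_mat R"
    and v: "\<And>i. is_polynomial (\<lambda>x. v x $ i)"
  shows "SOS (\<lambda>x. v x \<bullet> (R *v v x))"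
proof -
  have "\<exists>ws. \<forall>c. quadratic_form UNIV (\<lambda>i j. R $ i $ j) c = (\<Sum>w\<leftarrow>ws. (\<Sum>i\<in>UNIV. w i * c i)\<^sup>2)"
  proof (rule positive_definite_form_sum_of_squares)
    show "R $ i $ j = R $ j $ i" for i j
      using arg_cong[OF R_sym, of "\<lambda>A. A $ j $ i"] by (simp add: transpose_def)
    have "quadratic_form UNIV (\<lambda>i j. R $ i $ j) c > 0" if "\<exists>i\<in>UNIV. c i \<noteq> 0" for c
    proof -
      from that obtain i where "(\<chi> i. c i) $ i \<noteq> (0 :: real^'m) $ i" by auto
      then have "(\<chi> i. c i) \<noteq> 0" by metis
      then have "(\<chi> i. c i) \<bullet> (R *v (\<chi> i. c i)) > 0"
        using R_pd unfolding positive_definite_mat_def by blast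
      then show ?thesis
        unfolding inner_matrix_vector_eq_quadratic_form by (simp add: quadratic_form_def)
    qed
    then show "positive_definite_form UNIV (\<lambda>i j. R $ i $ j)"
      unfolding positive_definite_form_def by blast
  qed simp
  then obtain ws where ws: "\<And>c. quadratic_form UNIV (\<lambda>i j. R $ i $ j) c = (\<Sum>w\<leftarrow>ws. (\<Sum>i\<in>UNIV. w i * c i)\<^sup>2)"
    by blast
  let ?hs = "map (\<lambda>w x. \<Sum>i\<in>UNIV. w i * v x $ i) ws"
  have "\<forall>h\<in>set ?hs. is_polynomial h"
    by (auto intro!: is_polynomial_sum is_polynomial_mult is_polynomial_const v)
  moreover have "(\<lambda>x. v x \<bullet> (R *v v x)) = (\<lambda>x. \<Sum>h\<leftarrow>?hs. (h x)\<^sup>2)"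
    unfolding inner_matrix_vector_eq_quadratic_form ws by (simp add: o_def)
  ultimately show ?thesis unfolding SOS_def by (intro exI[of _ ?hs] conjI)
qed

subsection \<open>Policy improvement\<close>

lemma positive_definite_mat_mult_matrix_inv:
  fixes R :: "real^'m^'m"
  assumes "positive_definite_mat R"
  shows "R *v (matrix_inv R *v w) = w"
proof -
  have "x = 0" if "R *v x = 0" for x
    using assms that unfolding positive_definite_mat_def by (metis inner_zero_right less_irrefl)
  then have "invertible R"
    unfolding invertible_left_inverse matrix_left_invertible_ker by blast
  then have "R ** matrix_inv R = Finite_Cartesian_Product.mat 1"
    unfolding invertible_def matrix_inv_def by (rule someI2_ex) simp
  then show ?thesis by (simp add: matrix_vector_mul_assoc)
qed

locale quadratic_cost_system =
  fixes f :: "real^'n \<Rightarrow> real^'n"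
    and g :: "real^'n \<Rightarrow> real^'m^'n"
    and q :: "real^'n \<Rightarrow> real"
    and R :: "real^'m^'m"
  assumes R_sym: "transpose R = R" and R_pd: "positive_definite_mat R"
begin

abbreviation "closed_loop u \<equiv> \<lambda>y. f y + g y *v u y"
abbreviation "L \<equiv> L_op f g q R"
abbreviation "H \<equiv> H_op f g q R"

definition greedy :: "(real^'n \<Rightarrow> real) \<Rightarrow> real^'n \<Rightarrow> real^'m" where
  "greedy V y = - (1/2) *\<^sub>R (matrix_inv R *v (transpose (g y) *v grad V y))"

lemma inner_R_commute: "v \<bullet> (R *v w) = w \<bullet> (R *v v)"
  by (metis R_sym dot_lmul_matrix inner_commute transpose_matrix_vector)

lemma inner_R_nonneg: "v \<bullet> (R *v v) \<ge> 0"
  using R_pd unfolding positive_definite_mat_def by (cases "v = 0") (auto simp: less_imp_le)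

lemma grad_inner_input: "grad V y \<bullet> (g y *v w) = - 2 * (greedy V y \<bullet> (R *v w))"
proof -
  have "R *v greedy V y = - (1/2) *\<^sub>R (transpose (g y) *v grad V y)"
    unfolding greedy_def matrix_vector_mult_scaleR
    by (simp add: positive_definite_mat_mult_matrix_inv[OF R_pd])
  then have "(transpose (g y) *v grad V y) \<bullet> w = - 2 * ((R *v greedy V y) \<bullet> w)"
    by simp
  also have "(R *v greedy V y) \<bullet> w = greedy V y \<bullet> (R *v w)"
    by (subst inner_commute) (rule inner_R_commute)
  finally show ?thesis by (simp add: dot_lmul_matrix)
qed

lemma H_eq: "H V y = grad V y \<bullet> f y + q y - greedy V y \<bullet> (R *v greedy V y)"
proof -
  have inv: "matrix_inv R *v (transpose (g y) *v grad V y) = (- 2) *\<^sub>R greedy V y"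
    by (simp add: greedy_def)
  show ?thesis
    unfolding H_op_def inv grad_inner_input matrix_vector_mult_scaleR inner_scaleR_right by simp
qed

lemma L_eq:
  "L V u y = - (grad V y \<bullet> f y) + 2 * (greedy V y \<bullet> (R *v u y)) - q y - u y \<bullet> (R *v u y)"
  unfolding L_op_def running_cost_def inner_add_right grad_inner_input by simp

lemma L_complete_square:
  "L V u y = - H V y - (u y - greedy V y) \<bullet> (R *v (u y - greedy V y))"
  unfolding L_eq H_eq matrix_vector_mult_diff_distrib
  by (simp add: inner_diff_left inner_diff_right inner_R_commute[of "u y" "greedy V y"])

lemma L_greedy: "L V (greedy V) y = - H V y"
  by (simp add: L_complete_square)

lemma L_policy_improvement:
  "L V (greedy V) y = L V u y + (u y - greedy V y) \<bullet> (R *v (u y - greedy V y))"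
  by (simp add: L_complete_square)

lemma L_le_minus_H: "L V u y \<le> - H V y"
  by (simp add: L_complete_square inner_R_nonneg)

lemma grad_inner_closed_loop: "grad V y \<bullet> closed_loop u y = - running_cost q R y (u y) - L V u y"
  by (simp add: L_op_def)

lemma closed_loop_decrease:
  assumes "L V u y \<ge> 0"
  shows "grad V y \<bullet> closed_loop u y \<le> - q y"
  unfolding grad_inner_closed_loop running_cost_def
  using assms inner_R_nonneg[of "u y"] by linarith

lemma H_tendsto:
  assumes "(\<lambda>i. grad (V i) y) \<longlonglongrightarrow> grad W y"
  shows "(\<lambda>i. H (V i) y) \<longlonglongrightarrow> H W y"
  unfolding H_op_def
  by (intro tendsto_intros assms bounded_linear.tendsto[OF matrix_vector_mul_bounded_linear])

text \<open>The running costs of the two functions cancel.\<close>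

lemma value_difference_has_derivative:
  assumes "solution (closed_loop u) z" and "\<And>y. GDERIV V y :> grad V y" "\<And>y. GDERIV W y :> grad W y"
    and "t \<ge> 0"
  shows "((\<lambda>t. V (z t) - W (z t)) has_real_derivative L W u (z t) - L V u (z t)) (at t within {0..})"
proof -
  have "((\<lambda>t. V (z t) - W (z t)) has_real_derivative
      grad V (z t) \<bullet> closed_loop u (z t) - grad W (z t) \<bullet> closed_loop u (z t)) (at t within {0..})"
    using assms by (intro DERIV_diff value_along_solution_has_derivative)
  then show ?thesis by (simp add: grad_inner_closed_loop)
qed

end

lemma GDERIV_tendsto_compose:
  assumes "(z \<longlongrightarrow> y) F" and "GDERIV V y :> D"
  shows "((\<lambda>t. V (z t)) \<longlongrightarrow> V y) F"
  using assms by (auto simp: gderiv_def intro: isCont_tendsto_compose has_derivative_continuous)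

lemma antimono_tendsto_INF_at_top:
  fixes J :: "real \<Rightarrow> 'a::{complete_linorder,linorder_topology}"
  assumes antimono: "\<And>s t. a \<le> s \<Longrightarrow> s \<le> t \<Longrightarrow> J t \<le> J s"
  shows "(J \<longlongrightarrow> (INF t\<in>{a..}. J t)) at_top"
proof (rule order_tendstoI)
  fix c assume "c < (INF t\<in>{a..}. J t)"
  then have "c < J t" if "t \<ge> a" for t
    using that by (metis INF_lower atLeast_iff less_le_trans)
  then show "\<forall>\<^sub>F t in at_top. c < J t" by (auto simp: eventually_at_top_linorder)
next
  fix c assume "(INF t\<in>{a..}. J t) < c"
  then obtain s where "s \<ge> a" "J s < c" unfolding INF_less_iff by auto
  then have "J t < c" if "t \<ge> s" for t
    using antimono[OF _ that] by (metis le_less_trans)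
  then show "\<forall>\<^sub>F t in at_top. J t < c" by (auto simp: eventually_at_top_linorder)
qed

lemma has_improper_integral_nonpos:
  assumes int: "\<And>T. h integrable_on {0..T}" and nonpos: "\<And>t. h t \<le> 0"
  shows "has_improper_integral h (INF T\<in>{0..}. ereal (integral {0..T} h))"
proof -
  have "integral {0..T} h \<le> integral {0..S} h" if "0 \<le> S" "S \<le> T" for S T
  proof -
    have "integral {0..S} h + integral {S..T} h = integral {0..T} h"
      by (rule Henstock_Kurzweil_Integration.integral_combine[OF that int])
    moreover have "integral {S..T} h \<le> integral {S..T} (\<lambda>_. 0)"
      using that by (intro integral_le integrable_on_subinterval[OF int[of T]] nonpos integrable_0) auto
    ultimately show ?thesis by simp
  qed
  then show ?thesis
    unfolding has_improper_integral_def by (intro conjI allI impI int antimono_tendsto_INF_at_top) simp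
qed

context quadratic_cost_system
begin

lemma optimal_value_le:
  assumes Vo: "\<And>y. GDERIV Vo y :> grad Vo y" "Vo 0 = 0" "\<And>y. H Vo y = 0"
    and V: "\<And>y. GDERIV V y :> grad V y" "V 0 = 0" "\<And>y. L V u y \<ge> 0"
    and z: "solution (closed_loop u) z" "(z \<longlongrightarrow> 0) at_top"
  shows "Vo (z 0) \<le> V (z 0)"
proof -
  define \<phi> where "\<phi> t = V (z t) - Vo (z t)" for t
  have "\<phi> t - \<phi> 0 \<le> 0 * (t - 0)" if "t \<ge> 0" for t
  proof (rule has_real_derivative_le_imp_increment_le[OF that])
    show "(\<phi> has_real_derivative L Vo u (z s) - L V u (z s)) (at s within {0..})" if "s \<in> {0..t}" for s
      unfolding \<phi>_def[abs_def] using that by (intro value_difference_has_derivative z Vo V) auto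
    show "L Vo u (z s) - L V u (z s) \<le> 0" for s
      using L_le_minus_H[of Vo u "z s"] V(3)[of "z s"] by (simp add: Vo(3))
  qed auto
  then have "\<forall>\<^sub>F t in at_top. \<phi> t \<le> \<phi> 0"
    by (auto simp: eventually_at_top_linorder)
  moreover have "(\<phi> \<longlongrightarrow> V 0 - Vo 0) at_top"
    unfolding \<phi>_def[abs_def]
    by (rule tendsto_diff[OF GDERIV_tendsto_compose[OF z(2) V(1)] GDERIV_tendsto_compose[OF z(2) Vo(1)]])
  ultimately have "V 0 - Vo 0 \<le> \<phi> 0" by (intro tendsto_upperbound) auto
  then show ?thesis by (simp add: \<phi>_def Vo V)
qed

lemma optimal_loop_value_difference_le:
  assumes Vo: "\<And>y. GDERIV Vo y :> grad Vo y" "\<And>y. H Vo y = 0"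
    and V: "\<And>y. GDERIV V y :> grad V y"
    and z: "solution (closed_loop (greedy Vo)) z" and "T \<ge> 0"
    and int: "(\<lambda>t. H V (z t)) integrable_on {0..T}"
  shows "integral {0..T} (\<lambda>t. H V (z t)) \<le> (V (z T) - Vo (z T)) - (V (z 0) - Vo (z 0))"
proof (rule has_integral_le[OF integrable_integral[OF int]])
  let ?\<phi>' = "\<lambda>t. L Vo (greedy Vo) (z t) - L V (greedy Vo) (z t)"
  show "(?\<phi>' has_integral (V (z T) - Vo (z T)) - (V (z 0) - Vo (z 0))) {0..T}"
  proof (rule fundamental_theorem_of_calculus[OF \<open>T \<ge> 0\<close>])
    fix t assume "t \<in> {0..T}"
    then have "((\<lambda>t. V (z t) - Vo (z t)) has_real_derivative ?\<phi>' t) (at t within {0..})"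
      by (intro value_difference_has_derivative z Vo V) auto
    then have "((\<lambda>t. V (z t) - Vo (z t)) has_real_derivative ?\<phi>' t) (at t within {0..T})"
      by (rule has_field_derivative_subset) auto
    then show "((\<lambda>t. V (z t) - Vo (z t)) has_vector_derivative ?\<phi>' t) (at t within {0..T})"
      by (simp add: has_real_derivative_iff_has_vector_derivative)
  qed
  show "H V (z t) \<le> ?\<phi>' t" for t
    using L_le_minus_H[of V "greedy Vo" "z t"] by (simp add: L_greedy Vo(2))
qed

lemma optimal_loop_bound:
  assumes Vo: "\<And>y. GDERIV Vo y :> grad Vo y" "Vo 0 = 0" "\<And>y. H Vo y = 0"
    and V: "\<And>y. GDERIV V y :> grad V y" "V 0 = 0" "\<And>y. H V y \<le> 0" "continuous_on UNIV (H V)"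
    and z: "solution (closed_loop (greedy Vo)) z" "(z \<longlongrightarrow> 0) at_top"
  shows "\<exists>I. has_improper_integral (\<lambda>t. H V (z t)) I \<and> ereal (V (z 0) - Vo (z 0)) \<le> - I"
proof -
  define h where "h t = H V (z t)" for t
  define I where "I = (INF T\<in>{0..}. ereal (integral {0..T} h))"
  define \<phi> where "\<phi> t = V (z t) - Vo (z t)" for t
  have "continuous_on {0..T} h" for T
    unfolding h_def
    by (rule continuous_on_compose2[OF V(4) continuous_on_subset[OF solution_continuous_on[OF z(1)]]]) auto
  then have int: "h integrable_on {0..T}" for T by (rule integrable_continuous_interval)
  then have improper: "has_improper_integral h I"
    unfolding I_def by (rule has_improper_integral_nonpos) (simp add: h_def V(3))
  have "(\<phi> \<longlongrightarrow> V 0 - Vo 0) at_top"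
    unfolding \<phi>_def[abs_def]
    by (rule tendsto_diff[OF GDERIV_tendsto_compose[OF z(2) V(1)] GDERIV_tendsto_compose[OF z(2) Vo(1)]])
  then have upper: "((\<lambda>T. ereal (\<phi> T - \<phi> 0)) \<longlongrightarrow> ereal (V 0 - Vo 0 - \<phi> 0)) at_top"
    by (intro tendsto_intros)
  have lower: "((\<lambda>T. ereal (integral {0..T} h)) \<longlongrightarrow> I) at_top"
    using improper by (simp add: has_improper_integral_def)
  have "integral {0..T} h \<le> \<phi> T - \<phi> 0" if "T \<ge> 0" for T
    unfolding \<phi>_def h_def[abs_def]
    using int[of T] that by (intro optimal_loop_value_difference_le Vo V z) (simp_all add: h_def[abs_def])
  then have "\<forall>\<^sub>F T in at_top. ereal (integral {0..T} h) \<le> ereal (\<phi> T - \<phi> 0)"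
    by (auto simp: eventually_at_top_linorder)
  then have "I \<le> ereal (V 0 - Vo 0 - \<phi> 0)"
    by (rule tendsto_le[OF trivial_limit_at_top_linorder upper lower])
  then have "ereal (\<phi> 0) \<le> - I"
    using ereal_minus_le_minus[of "ereal (- \<phi> 0)" I] by (simp add: Vo V)
  with improper show ?thesis by (auto simp: h_def[abs_def] \<phi>_def)
qed

end

subsection \<open>The data matrices\<close>

abbreviation coeff_vecs :: "nat \<Rightarrow> nat \<Rightarrow> real Matrix.vec set" where
  "coeff_vecs n d \<equiv> carrier_vec (num_monomials2 n (2*d))"

abbreviation gain_mats :: "nat \<Rightarrow> nat \<Rightarrow> nat \<Rightarrow> real mat set" where
  "gain_mats n m d \<equiv> carrier_mat m (num_monomials1 n d)"

abbreviation num_unknowns :: "nat \<Rightarrow> nat \<Rightarrow> nat \<Rightarrow> nat" where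
  "num_unknowns n m d \<equiv> num_monomials2 n (2*d) + m * num_monomials1 n d"

lemma distinct_cols_of_full_column_rank:
  fixes A :: "'a::field mat"
  assumes A: "A \<in> carrier_mat n nc" and rank: "vec_space.rank n A = nc"
  shows "distinct (cols A)"
proof (rule ccontr)
  interpret vec_space "TYPE('a)" n .
  assume "\<not> distinct (cols A)"
  then have "card (set (cols A)) \<noteq> length (cols A)" using card_distinct by blast
  then have "card (set (cols A)) < nc"
    using A card_length[of "cols A"] by simp
  moreover obtain S where S: "maximal S (\<lambda>T. T \<subseteq> set (cols A) \<and> lin_indpt T)"
    using maximal_exists[of "(\<lambda>T. T \<subseteq> set (cols A) \<and> lin_indpt T)" "card (set (cols A))" "{}"]
    by (meson List.finite_set card_mono empty_iff empty_subsetI finite_lin_indpt2 rev_finite_subset)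
  then have "card S \<le> card (set (cols A))" by (simp add: card_mono maximal_def)
  ultimately show False
    using rank_card_indpt[OF A S] rank by simp
qed

lemma inj_on_mult_mat_vec_of_full_column_rank:
  fixes A :: "'a::field mat"
  assumes A: "A \<in> carrier_mat n nc" and rank: "vec_space.rank n A = nc"
  shows "inj_on ((*\<^sub>v) A) (carrier_vec nc)"
proof (rule inj_onI)
  interpret vec_space "TYPE('a)" n .
  fix v w assume vw: "v \<in> carrier_vec nc" "w \<in> carrier_vec nc" "A *\<^sub>v v = A *\<^sub>v w"
  have dist: "distinct (cols A)" by (rule distinct_cols_of_full_column_rank[OF A rank])
  have "A *\<^sub>v (v - w) = 0\<^sub>v n"
    using A vw by (simp add: mult_minus_distrib_mat_vec)
  then have "v - w = 0\<^sub>v nc"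
    using lin_depI[OF A, of "v - w"] full_rank_lin_indpt[OF A rank dist] vw dist by auto
  show "v = w"
  proof (rule eq_vecI)
    fix i assume "i < dim_vec w"
    then show "vec_index v i = vec_index w i"
      using arg_cong[OF \<open>v - w = 0\<^sub>v nc\<close>, of "\<lambda>u. vec_index u i"] vw by simp
  qed (use vw in simp)
qed

lemma sum_div_mod:
  fixes h :: "nat \<Rightarrow> nat \<Rightarrow> 'a::comm_monoid_add"
  shows "(\<Sum>k<a * b. h (k div b) (k mod b)) = (\<Sum>i<a. \<Sum>j<b. h i j)"
proof -
  have "(\<Sum>k\<in>{i * b..<i * b + b}. h (k div b) (k mod b)) = (\<Sum>j<b. h i j)" for i
    using sum.shift_bounds_nat_ivl[of "\<lambda>k. h (k div b) (k mod b)" 0 "i * b" b]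
    by (simp add: atLeast0LessThan add.commute)
  then show ?thesis by (simp flip: sum.nat_group)
qed

lemma stack_columns_carrier_vec:
  "K \<in> carrier_mat a b \<Longrightarrow> stack_columns K \<in> carrier_vec (a * b)"
  by (auto simp: stack_columns_def)

lemma vec_index_stack_columns:
  assumes "K \<in> carrier_mat a b" "i < a" "j < b"
  shows "vec_index (stack_columns K) (j * a + i) = K $$ (i, j)"
proof -
  have "j * a + i < Suc j * a" using assms by simp
  also have "\<dots> \<le> b * a" using assms by (intro mult_le_mono1) simp
  finally show ?thesis using assms by (simp add: stack_columns_def mult.commute)
qed

lemma stack_columns_inject:
  assumes K: "K \<in> carrier_mat a b" "K' \<in> carrier_mat a b" and eq: "stack_columns K = stack_columns K'"
  shows "K = K'"
proof (rule eq_matI)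
  fix i j assume "i < dim_row K'" "j < dim_col K'"
  then have "i < a" "j < b" using K by auto
  then show "K $$ (i, j) = K' $$ (i, j)"
    using vec_index_stack_columns[OF K(1)] vec_index_stack_columns[OF K(2)] eq by metis
qed (use K in auto)

lemma scalar_prod_kronecker_vec_stack_columns:
  assumes K: "K \<in> carrier_mat a b" and m: "m \<in> carrier_vec b" and w: "w \<in> carrier_vec a"
  shows "scalar_prod (kronecker_vec m w) (stack_columns K) = scalar_prod w (K *\<^sub>v m)"
proof -
  have "scalar_prod (kronecker_vec m w) (stack_columns K) =
      (\<Sum>k<b * a. vec_index m (k div a) * vec_index w (k mod a) * K $$ (k mod a, k div a))"
    using K m w by (auto simp: scalar_prod_def kronecker_vec_def stack_columns_def atLeast0LessThan
        mult.commute intro!: sum.cong)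
  also have "\<dots> = (\<Sum>j<b. \<Sum>i<a. vec_index m j * vec_index w i * K $$ (i, j))"
    by (rule sum_div_mod)
  also have "\<dots> = (\<Sum>i<a. \<Sum>j<b. vec_index m j * vec_index w i * K $$ (i, j))"
    by (rule sum.swap)
  also have "\<dots> = scalar_prod w (K *\<^sub>v m)"
    using K m w by (auto simp: scalar_prod_def atLeast0LessThan sum_distrib_left ac_simps intro!: sum.cong)
  finally show ?thesis .
qed

lemma to_vec_carrier_vec: "to_vec (w :: real^'m::{finite,linorder}) \<in> carrier_vec CARD('m)"
  by (simp add: to_vec_def)

lemma scalar_prod_to_vec:
  assumes "v \<in> carrier_vec CARD('m::{finite,linorder})"
  shows "scalar_prod (to_vec (w :: real^'m::_)) v = w \<bullet> of_vec v"
  using assms coord_index_coord[where 'n='m]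
  by (auto simp: scalar_prod_def to_vec_def of_vec_def inner_vec_coord atLeast0LessThan intro!: sum.cong)

lemma card_exponents_num_monomials1:
  "card (exponents CARD('n::{finite,linorder}) 1 d) = num_monomials1 CARD('n) d"
  using dim_monomials1[of d "0 :: real^'n::_"]
    carrier_vecD[OF monomials_carrier_vec[of 1 d "0 :: real^'n::_"]] by simp

lemma card_exponents_num_monomials2:
  assumes "d \<ge> 1"
  shows "card (exponents CARD('n::{finite,linorder}) 2 d) = num_monomials2 CARD('n) d"
  using dim_monomials2[OF assms, of "0 :: real^'n::_"]
    carrier_vecD[OF monomials_carrier_vec[of 2 d "0 :: real^'n::_"]] by simp

lemma monomials1_carrier_vec:
  "monomials 1 d (y :: real^'n::{finite,linorder}) \<in> carrier_vec (num_monomials1 CARD('n) d)"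
  by (intro carrier_vecI dim_monomials1)

lemma monomials2_carrier_vec:
  "d \<ge> 1 \<Longrightarrow> monomials 2 d (y :: real^'n::{finite,linorder}) \<in> carrier_vec (num_monomials2 CARD('n) d)"
  by (intro carrier_vecI dim_monomials2)

lemma value_poly_in_poly_space: "value_poly r p \<in> poly_space 2 (2*r)"
  unfolding value_poly_def[abs_def] by (rule scalar_prod_monomials_in_poly_space)

lemma feedback_in_poly_space:
  fixes K :: "real mat"
  assumes "K \<in> carrier_mat CARD('m::{finite,linorder}) k"
  shows "(\<lambda>y :: real^'n::{finite,linorder}. (feedback d K y :: real^'m::_) $ i) \<in> poly_space 1 d"
proof -
  have "(feedback d K y :: real^'m::_) $ i = scalar_prod (row K (coord_index i)) (monomials 1 d y)"
    for y :: "real^'n::_"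
    using assms coord_index_less_CARD[of i] by (simp add: feedback_def of_vec_def)
  then show ?thesis by (simp add: scalar_prod_monomials_in_poly_space)
qed

lemma poly_space_feedbackE:
  fixes u :: "real^'n::{finite,linorder} \<Rightarrow> real^'m::{finite,linorder}"
  assumes "\<And>i. (\<lambda>y. u y $ i) \<in> poly_space 1 d"
  obtains K where "K \<in> gain_mats CARD('n) CARD('m) d" "feedback d K = u"
proof -
  let ?k = "num_monomials1 CARD('n) d"
  have "\<exists>a. a \<in> carrier_vec ?k \<and> (\<lambda>y. u y $ i) = (\<lambda>y. scalar_prod a (monomials 1 d y))" for i
    by (rule poly_space_scalar_prodE[OF assms[of i]]) (auto simp flip: card_exponents_num_monomials1)
  then obtain a where a: "\<And>i. a i \<in> carrier_vec ?k" "\<And>i y. u y $ i = scalar_prod (a i) (monomials 1 d y)"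
    by metis
  define K where "K = mat_of_rows ?k (map (\<lambda>k. a (coord k)) [0..<CARD('m)])"
  have K: "K \<in> carrier_mat CARD('m) ?k"
    using mat_of_rows_carrier(1)[of ?k "map (\<lambda>k. a (coord k)) [0..<CARD('m)]"] by (simp add: K_def)
  have row: "row K (coord_index i) = a i" for i
    using coord_index_less_CARD[of i] a(1) by (simp add: K_def coord_card_less)
  have "(feedback d K y :: real^'m::_) $ i = u y $ i" for y i
    using K coord_index_less_CARD[of i] by (simp add: feedback_def of_vec_def row a(2))
  then have "feedback d K = u" by (simp add: fun_eq_iff Finite_Cartesian_Product.vec_eq_iff)
  with K show thesis by (rule that)
qed

lemma scalar_prod_sigma_e:
  fixes R :: "real^'m::{finite,linorder}^'m::_" and y :: "real^'n::{finite,linorder}"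
  assumes "d \<ge> 1"
    and K: "K \<in> gain_mats CARD('n) CARD('m) d"
    and l: "l \<in> coeff_vecs CARD('n) d"
  shows "scalar_prod (sigma_e R d y w) (l @\<^sub>v stack_columns K) =
    - scalar_prod l (monomials 2 (2*d) y) - 2 * (w \<bullet> (R *v feedback d K y))"
proof -
  have m: "monomials 2 (2*d) y \<in> coeff_vecs CARD('n) d"
    using \<open>d \<ge> 1\<close> by (intro monomials2_carrier_vec) simp
  let ?k = "kronecker_vec (monomials 1 d y) (to_vec (w v* R))"
  have k: "?k \<in> carrier_vec (CARD('m) * num_monomials1 CARD('n) d)"
    using dim_monomials1[of d y]
    by (auto simp: kronecker_vec_def to_vec_def mult.commute intro!: carrier_vecI)
  note stack = stack_columns_carrier_vec[OF K]
  have "scalar_prod (sigma_e R d y w) (l @\<^sub>v stack_columns K) =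
      - scalar_prod (monomials 2 (2*d) y @\<^sub>v (2 \<cdot>\<^sub>v ?k)) (l @\<^sub>v stack_columns K)"
    unfolding sigma_e_def using m l k stack by (intro scalar_prod_uminus_left) auto
  also have "scalar_prod (monomials 2 (2*d) y @\<^sub>v (2 \<cdot>\<^sub>v ?k)) (l @\<^sub>v stack_columns K) =
      scalar_prod (monomials 2 (2*d) y) l + scalar_prod (2 \<cdot>\<^sub>v ?k) (stack_columns K)"
    using m l k stack by (intro scalar_prod_append) auto
  also have "scalar_prod (2 \<cdot>\<^sub>v ?k) (stack_columns K) = 2 * scalar_prod ?k (stack_columns K)"
    using k stack by (intro scalar_prod_smult_left) auto
  also have "scalar_prod ?k (stack_columns K) = scalar_prod (to_vec (w v* R)) (K *\<^sub>v monomials 1 d y)"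
    by (rule scalar_prod_kronecker_vec_stack_columns[OF K monomials1_carrier_vec to_vec_carrier_vec])
  also have "\<dots> = (w v* R) \<bullet> feedback d K y"
    unfolding feedback_def
    by (rule scalar_prod_to_vec[OF mult_mat_vec_carrier[OF K monomials1_carrier_vec]])
  also have "\<dots> = w \<bullet> (R *v feedback d K y)" by (rule dot_lmul_matrix)
  also have "scalar_prod (monomials 2 (2*d) y) l = scalar_prod l (monomials 2 (2*d) y)"
    by (rule comm_scalar_prod[OF m l])
  finally show ?thesis by simp
qed

lemma vec_index_sigma_e:
  fixes y :: "real^'n::{finite,linorder}" and w :: "real^'m::{finite,linorder}"
  assumes "d \<ge> 1" and "k < num_unknowns CARD('n) CARD('m) d"
  shows "vec_index (sigma_e R d y w) k =
    (if k < num_monomials2 CARD('n) (2*d) then - vec_index (monomials 2 (2*d) y) k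
     else let l = k - num_monomials2 CARD('n) (2*d)
       in - 2 * vec_index (monomials 1 d y) (l div CARD('m)) * (w \<bullet> column (coord (l mod CARD('m))) R))"
proof -
  have "(w v* R) $ i = w \<bullet> column i R" for i
    by (simp add: vector_matrix_mult_def inner_vec_def column_def mult.commute)
  then show ?thesis
    using assms dim_monomials1[of d y] dim_monomials2[of "2*d" y]
    by (simp add: sigma_e_def kronecker_vec_def to_vec_def Let_def mult.commute del: One_nat_def)
qed

lemma continuous_on_vec_index_monomials:
  assumes x: "continuous_on S x" and k: "k < card (exponents CARD('n) d1 d2)"
  shows "continuous_on S (\<lambda>t. vec_index (monomials d1 d2 (x t :: real^'n::{finite,linorder})) k)"
  using is_polynomial_continuous_on[OF is_polynomialI[OF vec_index_monomials_in_poly_space[OF k]], of UNIV]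
  by (rule continuous_on_compose2[OF _ x]) simp

lemma integrable_vec_index_sigma_e:
  fixes R :: "real^'m::{finite,linorder}^'m::_" and x :: "real \<Rightarrow> real^'n::{finite,linorder}"
  assumes d: "d \<ge> 1" and x: "continuous_on {a..b} x"
    and e: "bounded (range e)" "e \<in> borel_measurable lebesgue"
    and k: "k < num_unknowns CARD('n) CARD('m) d"
  shows "(\<lambda>t. vec_index (sigma_e R d (x t) (e t)) k) integrable_on {a..b}"
proof (cases "k < num_monomials2 CARD('n) (2*d)")
  case True
  then have "(\<lambda>t. - vec_index (monomials 2 (2*d) (x t)) k) integrable_on {a..b}"
    using d card_exponents_num_monomials2[of "2*d", where 'n='n]
    by (intro integrable_continuous_interval continuous_on_minus continuous_on_vec_index_monomials x) auto
  then show ?thesis using True by (simp add: vec_index_sigma_e[OF d k])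
next
  case False
  define l where "l = k - num_monomials2 CARD('n) (2*d)"
  define i :: 'm where "i = coord (l mod CARD('m))"
  have "l div CARD('m) < card (exponents CARD('n) 1 d)"
    using False k unfolding card_exponents_num_monomials1
    by (intro less_mult_imp_div_less) (simp add: l_def mult.commute)
  then have "continuous_on {a..b}
      (\<lambda>t. (- 2 * vec_index (monomials 1 d (x t)) (l div CARD('m))) *\<^sub>R column i R)"
    by (intro continuous_intros continuous_on_vec_index_monomials x)
  moreover have "e \<in> borel_measurable (lebesgue_on {a..b})"
    using e(2) by (rule measurable_restrict_space1)
  moreover obtain B where "\<And>t. norm (e t) \<le> B" using e(1) by (auto simp: bounded_iff)
  ultimately have "(\<lambda>t. ((- 2 * vec_index (monomials 1 d (x t)) (l div CARD('m))) *\<^sub>R column i R) \<bullet> e t)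
      integrable_on {a..b}"
    by (rule integrable_continuous_inner_bounded_measurable)
  then show ?thesis
    using False by (simp add: vec_index_sigma_e[OF d k] Let_def l_def i_def inner_commute)
qed

lemma Phi_carrier_mat:
  "Phi R d e (x :: real \<Rightarrow> real^'n::{finite,linorder}) \<tau> N \<in>
    carrier_mat N (num_unknowns CARD('n) CARD('m) d)"
  for R :: "real^'m::{finite,linorder}^'m::_"
  by (simp add: Phi_def)

lemma Phi_row_has_integral:
  fixes R :: "real^'m::{finite,linorder}^'m::_" and x :: "real \<Rightarrow> real^'n::{finite,linorder}"
  assumes d: "d \<ge> 1" and "j < N" and x: "continuous_on {\<tau> j..\<tau> (Suc j)} x"
    and e: "bounded (range e)" "e \<in> borel_measurable lebesgue"
    and c: "c \<in> carrier_vec (num_unknowns CARD('n) CARD('m) d)"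
  shows "((\<lambda>t. scalar_prod (sigma_e R d (x t) (e t)) c) has_integral vec_index (Phi R d e x \<tau> N *\<^sub>v c) j)
    {\<tau> j..\<tau> (Suc j)}"
proof -
  let ?n = "num_unknowns CARD('n) CARD('m) d"
  have "((\<lambda>t. \<Sum>k<?n. vec_index (sigma_e R d (x t) (e t)) k * vec_index c k) has_integral
      (\<Sum>k<?n. integral {\<tau> j..\<tau> (Suc j)} (\<lambda>t. vec_index (sigma_e R d (x t) (e t)) k) * vec_index c k))
      {\<tau> j..\<tau> (Suc j)}"
    using integrable_vec_index_sigma_e[OF d x e]
    by (intro has_integral_sum has_integral_mult_left integrable_integral) auto
  then show ?thesis
    using \<open>j < N\<close> c by (simp add: Phi_def scalar_prod_def atLeast0LessThan)
qed

lemma vec_index_Theta_mult_vec: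
  fixes x :: "real \<Rightarrow> real^'n::{finite,linorder}"
  assumes "r \<ge> 1" "j < N" and "p \<in> coeff_vecs CARD('n) r"
  shows "vec_index (Theta r x \<tau> N *\<^sub>v p) j = value_poly r p (x (\<tau> (Suc j))) - value_poly r p (x (\<tau> j))"
  using assms dim_monomials2[of "2*r", where 'n='n]
  by (simp add: Theta_def scalar_prod_def value_poly_def right_diff_distrib sum_subtractf left_diff_distrib
      mult.commute)

lemma Xi_row_has_integral:
  assumes "continuous_on {\<tau> j..\<tau> (Suc j)} (\<lambda>t. running_cost q R (x t) (u (x t)))" and "j < N"
  shows "((\<lambda>t. running_cost q R (x t) (u (x t))) has_integral vec_index (Xi q R u x \<tau> N) j)
    {\<tau> j..\<tau> (Suc j)}"
  using integrable_integral[OF integrable_continuous_interval[OF assms(1)]] assms(2) by (simp add: Xi_def)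

subsection \<open>Polynomial systems with quadratic control cost\<close>

lemma poly_degree_le_degree_vec: "poly_degree (\<lambda>x. h x $ i) \<le> degree_vec h"
  unfolding degree_vec_def by (intro Max_ge) auto

lemma poly_degree_le_degree_mat: "poly_degree (\<lambda>x. h x $ i $ j) \<le> degree_mat h"
  unfolding degree_mat_def by (intro Max_ge) (auto intro: rev_image_eqI[of "(i, j)"])

lemma degree_bounds_of_Max:
  assumes "r \<ge> 1"
    and d: "real d \<ge> 1/2 * Max {real df + 2 * real r - 1, real dg + 2 * (2 * real r - 1), real dq,
      2 * (2 * real r - 1) + 2 * real dg}" (is "_ \<ge> 1/2 * Max ?S")
  shows "(2*r - 1) + df \<le> 2*d" and "dg + (2*r - 1) \<le> d" and "dq \<le> 2*d"
proof -
  have le: "s \<le> 2 * real d" if "s \<in> ?S" for s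
  proof -
    have "s \<le> Max ?S" by (rule Max_ge[OF _ that]) simp
    then show ?thesis using d by linarith
  qed
  have "real df + 2 * real r - 1 \<le> 2 * real d" "real dq \<le> 2 * real d"
    "2 * (2 * real r - 1) + 2 * real dg \<le> 2 * real d"
    by (rule le, simp)+
  then have "real (df + 2*r) \<le> real (2*d + 1)" "real dq \<le> real (2*d)" "real (2*r + dg) \<le> real (d + 1)"
    by simp_all
  then have "df + 2*r \<le> 2*d + 1" "dq \<le> 2*d" "2*r + dg \<le> d + 1"
    by (simp_all only: of_nat_le_iff)
  then show "(2*r - 1) + df \<le> 2*d" "dg + (2*r - 1) \<le> d" "dq \<le> 2*d"
    using \<open>r \<ge> 1\<close> by auto
qed

lemma bounded_image_continuous_bounded_noise:
  fixes x :: "real \<Rightarrow> 'a::metric_space" and e :: "real \<Rightarrow> 'b::heine_borel"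
    and F :: "'a \<times> 'b \<Rightarrow> 'c::metric_space"
  assumes F: "continuous_on UNIV F" and x: "continuous_on {a..b} x" and e: "bounded (range e)"
  shows "bounded ((\<lambda>t. F (x t, e t)) ` {a..b})"
proof (rule bounded_subset)
  have "compact (x ` {a..b} \<times> closure (range e))"
    using compact_continuous_image[OF x compact_Icc] e
    by (intro compact_Times) (auto simp: compact_closure)
  then show "bounded (F ` (x ` {a..b} \<times> closure (range e)))"
    by (intro compact_imp_bounded compact_continuous_image continuous_on_subset[OF F]) auto
  show "(\<lambda>t. F (x t, e t)) ` {a..b} \<subseteq> F ` (x ` {a..b} \<times> closure (range e))"
    using closure_subset[of "range e"] by blast
qed

lemma sampling_times_mono:
  assumes "sampled_data f g e u x \<tau> N" and "i \<le> j" "j \<le> N"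
  shows "\<tau> i \<le> \<tau> j"
  using assms(2,3)
proof (induction j rule: dec_induct)
  case (step k)
  then have "\<tau> i \<le> \<tau> k" "\<tau> k < \<tau> (Suc k)" using assms(1) by (auto simp: sampled_data_def)
  then show ?case by simp
qed simp

locale polynomial_regulator = quadratic_cost_system f g q R
  for f :: "real^'n::_ \<Rightarrow> real^'n::{finite,linorder}"
    and g :: "real^'n::_ \<Rightarrow> real^'m::{finite,linorder}^'n::_"
    and q :: "real^'n::_ \<Rightarrow> real"
    and R :: "real^'m::_^'m::_" +
  fixes r d :: nat
  assumes f_poly: "is_polynomial (\<lambda>y. f y $ i)" and f_0: "f 0 = 0"
    and g_poly: "is_polynomial (\<lambda>y. g y $ i $ j)"
    and q_poly: "is_polynomial q" and q_pd: "positive_definite_fun q"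
    and r_pos: "r \<ge> 1" and d_pos: "d \<ge> 1"
    and degree_f: "(2*r - 1) + degree_vec f \<le> 2*d"
    and degree_g: "degree_mat g + (2*r - 1) \<le> d"
    and degree_q: "poly_degree q \<le> 2*d"
begin

lemma f_in_poly_space: "(\<lambda>y. f y $ i) \<in> poly_space 1 (degree_vec f)"
  using poly_degree_le_degree_vec[of f i]
  by (intro poly_space_1_of_zero poly_space_mono[OF is_polynomial_poly_degree[OF f_poly]]) (auto simp: f_0)

lemma g_in_poly_space: "(\<lambda>y. g y $ i $ j) \<in> poly_space 0 (degree_mat g)"
  using poly_degree_le_degree_mat[of g i j]
  by (intro poly_space_mono[OF is_polynomial_poly_degree[OF g_poly]]) auto

lemma q_in_poly_space: "q \<in> poly_space 2 (2*d)"
  using q_pd degree_q positive_definite_fun_nonneg[OF q_pd]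
  by (intro poly_space_2_of_nonneg poly_space_mono[OF is_polynomial_poly_degree[OF q_poly]])
    (auto simp: positive_definite_fun_def)

lemma grad_in_poly_space: "V \<in> poly_space 2 (2*r) \<Longrightarrow> (\<lambda>y. grad V y $ i) \<in> poly_space 1 (2*r - 1)"
  using poly_space_grad[of V 2 "2*r" i] by simp

lemma greedy_in_poly_space:
  assumes "V \<in> poly_space 2 (2*r)"
  shows "(\<lambda>y. greedy V y $ i) \<in> poly_space 1 d"
proof -
  have "(\<lambda>y. (transpose (g y) *v grad V y) $ k) \<in> poly_space (0 + 1) (degree_mat g + (2*r - 1))" for k
    using g_in_poly_space grad_in_poly_space[OF assms]
    by (intro poly_space_matrix_vector_mult) (simp_all add: transpose_def)
  then have "(\<lambda>y. (transpose (g y) *v grad V y) $ k) \<in> poly_space 1 d" for k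
    by (rule poly_space_mono) (use degree_g in auto)
  then have "(\<lambda>y. (- (1/2)) * (matrix_inv R *v (transpose (g y) *v grad V y)) $ i) \<in> poly_space 1 d"
    by (intro poly_space_cmult poly_space_const_matrix_vector_mult)
  then show ?thesis unfolding greedy_def by simp
qed

lemma L_in_poly_space:
  assumes V: "V \<in> poly_space 2 (2*r)" and u: "\<And>i. (\<lambda>y. u y $ i) \<in> poly_space 1 d"
  shows "L V u \<in> poly_space 2 (2*d)"
proof -
  have "(\<lambda>y. grad V y \<bullet> f y) \<in> poly_space (1 + 1) ((2*r - 1) + degree_vec f)"
    by (intro poly_space_inner grad_in_poly_space V f_in_poly_space)
  then have drift: "(\<lambda>y. grad V y \<bullet> f y) \<in> poly_space 2 (2*d)"
    by (rule poly_space_mono) (use degree_f in auto)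
  have cross: "(\<lambda>y. w y \<bullet> (R *v u y)) \<in> poly_space 2 (2*d)"
    if "\<And>i. (\<lambda>y. w y $ i) \<in> poly_space 1 d" for w
  proof (rule poly_space_mono)
    show "(\<lambda>y. w y \<bullet> (R *v u y)) \<in> poly_space (1 + 1) (d + d)"
      by (intro poly_space_inner poly_space_const_matrix_vector_mult u that)
  qed auto
  have "(\<lambda>y. - (grad V y \<bullet> f y) + 2 * (greedy V y \<bullet> (R *v u y)) - q y - u y \<bullet> (R *v u y))
      \<in> poly_space 2 (2*d)"
    by (intro poly_space_diff poly_space_add poly_space_uminus poly_space_cmult drift cross
        q_in_poly_space u greedy_in_poly_space V)
  then show ?thesis by (simp add: L_eq[abs_def])
qed

lemma H_continuous_on:
  assumes "V \<in> poly_space 2 (2*r)"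
  shows "continuous_on S (H V)"
proof -
  have "is_polynomial (\<lambda>y. - L V (greedy V) y)"
    using poly_space_uminus[OF L_in_poly_space[OF assms greedy_in_poly_space[OF assms]]]
    by (rule is_polynomialI)
  then show ?thesis by (simp add: L_greedy is_polynomial_continuous_on)
qed

lemma closed_loop_is_polynomial:
  assumes "\<And>i. is_polynomial (\<lambda>y. u y $ i)"
  shows "is_polynomial (\<lambda>y. closed_loop u y $ i)"
  unfolding vector_add_component matrix_vector_mult_def vec_lambda_beta
  by (intro is_polynomial_add is_polynomial_sum is_polynomial_mult f_poly g_poly assms)

lemma closed_loop_globally_asymptotically_stable:
  assumes V: "V \<in> class_P" and u: "\<And>i. (\<lambda>y. u y $ i) \<in> poly_space 1 d" and L: "\<And>y. L V u y \<ge> 0"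
  shows "globally_asymptotically_stable (closed_loop u)"
proof (rule Lyapunov_globally_asymptotically_stable[OF V _ is_polynomial_continuous_on[OF q_poly] q_pd])
  show "\<exists>B. B-lipschitz_on (cball 0 \<rho>) (closed_loop u)" for \<rho>
    by (intro lipschitz_on_vec_components is_polynomial_lipschitz_on_cball closed_loop_is_polynomial
        is_polynomialI[OF u])
  show "grad V y \<bullet> closed_loop u y \<le> - q y" for y
    by (rule closed_loop_decrease[OF L])
qed

lemma optimal_loop_tendsto_0:
  assumes Vo: "Vo \<in> class_P" "\<And>y. H Vo y = 0" and z: "solution (closed_loop (greedy Vo)) z"
  shows "(z \<longlongrightarrow> 0) at_top"
proof (rule Lyapunov_tendsto_0[OF Vo(1) z is_polynomial_continuous_on[OF q_poly] q_pd])
  show "grad Vo y \<bullet> closed_loop (greedy Vo) y \<le> - q y" for y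
    by (rule closed_loop_decrease) (simp add: L_greedy Vo(2))
qed

subsection \<open>The data equation\<close>

definition policy_coefficients ::
    "(real^'n::_ \<Rightarrow> real^'m::_) \<Rightarrow> real Matrix.vec \<Rightarrow> real mat \<Rightarrow> real Matrix.vec \<Rightarrow> bool" where
  "policy_coefficients u p K l \<longleftrightarrow> K \<in> gain_mats CARD('n) CARD('m) d \<and> l \<in> coeff_vecs CARD('n) d \<and>
     feedback d K = greedy (value_poly r p) \<and>
     (\<lambda>y. scalar_prod l (monomials 2 (2*d) y)) = L (value_poly r p) u"

lemma policy_coefficients_exist:
  assumes "\<And>i. (\<lambda>y. u y $ i) \<in> poly_space 1 d"
  obtains K l where "policy_coefficients u p K l"
proof -
  obtain K where "K \<in> gain_mats CARD('n) CARD('m) d" "feedback d K = greedy (value_poly r p)"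
    by (rule poly_space_feedbackE[OF greedy_in_poly_space[OF value_poly_in_poly_space]]) blast
  moreover obtain l where "l \<in> coeff_vecs CARD('n) d"
    "L (value_poly r p) u = (\<lambda>y. scalar_prod l (monomials 2 (2*d) y))"
    using poly_space_scalar_prodE[OF L_in_poly_space[OF value_poly_in_poly_space assms]]
      card_exponents_num_monomials2[of "2*d", where 'n='n] d_pos by auto
  ultimately show thesis using that by (simp add: policy_coefficients_def)
qed

lemma data_integrand:
  assumes "policy_coefficients u p K l"
  shows "scalar_prod (sigma_e R d y w) (l @\<^sub>v stack_columns K) =
    grad (value_poly r p) y \<bullet> (f y + g y *v (u y + w)) + running_cost q R y (u y)"
proof -
  let ?V = "value_poly r p :: real^'n::_ \<Rightarrow> real"
  have K: "K \<in> gain_mats CARD('n) CARD('m) d" and l: "l \<in> coeff_vecs CARD('n) d"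
    and "feedback d K = greedy ?V" "(\<lambda>y. scalar_prod l (monomials 2 (2*d) y)) = L ?V u"
    using assms by (auto simp: policy_coefficients_def)
  then have "scalar_prod (sigma_e R d y w) (l @\<^sub>v stack_columns K) =
      - L ?V u y - 2 * (w \<bullet> (R *v greedy ?V y))"
    unfolding scalar_prod_sigma_e[OF d_pos K l] by (simp add: fun_eq_iff)
  also have "\<dots> = - L ?V u y + grad ?V y \<bullet> (g y *v w)"
    by (simp add: grad_inner_input inner_R_commute[of w])
  also have "\<dots> = grad ?V y \<bullet> (f y + g y *v (u y + w)) + running_cost q R y (u y)"
    by (simp add: L_op_def matrix_vector_right_distrib inner_add_right)
  finally show ?thesis .
qed

lemma excited_system_bounded:
  fixes x :: "real \<Rightarrow> real^'n::_" and e :: "real \<Rightarrow> real^'m::_"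
  assumes u: "\<And>i. (\<lambda>y. u y $ i) \<in> poly_space 1 d"
    and x: "continuous_on {a..b} x" and e: "bounded (range e)"
  obtains M where "\<And>t. t \<in> {a..b} \<Longrightarrow> norm (f (x t) + g (x t) *v (u (x t) + e t)) \<le> M"
proof -
  define F where "F z = (\<chi> i. f (fst z) $ i + (\<Sum>j\<in>UNIV. g (fst z) $ i $ j * (u (fst z) $ j + snd z $ j)))"
    for z :: "(real^'n::_) \<times> (real^'m::_)"
  have poly: "continuous_on UNIV (\<lambda>z :: (real^'n::_) \<times> (real^'m::_). h (fst z))"
    if "is_polynomial h" for h :: "real^'n::_ \<Rightarrow> real"
    by (rule continuous_on_compose2[OF is_polynomial_continuous_on[OF that, of UNIV]])
      (auto intro: continuous_on_fst)
  have "continuous_on UNIV (\<lambda>z :: (real^'n::_) \<times> (real^'m::_). snd z $ j)" for j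
    by (intro continuous_intros)
  then have "continuous_on UNIV F"
    unfolding F_def[abs_def]
    by (intro continuous_on_vec_lambda continuous_on_add continuous_on_sum continuous_on_mult
        poly f_poly g_poly is_polynomialI[OF u])
  from bounded_image_continuous_bounded_noise[OF this x e]
  obtain M where "\<forall>t\<in>{a..b}. norm (F (x t, e t)) \<le> M"
    by (auto simp: bounded_iff)
  moreover have "F (x t, e t) = f (x t) + g (x t) *v (u (x t) + e t)" for t
    by (simp add: F_def matrix_vector_mult_def Finite_Cartesian_Product.vec_eq_iff)
  ultimately show thesis by (intro that[of M]) simp
qed

lemma running_cost_continuous_on:
  assumes u: "\<And>i. (\<lambda>y. u y $ i) \<in> poly_space 1 d" and x: "continuous_on S x"
  shows "continuous_on S (\<lambda>t. running_cost q R (x t) (u (x t)))"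
proof -
  have "(\<lambda>y. u y \<bullet> (R *v u y)) \<in> poly_space (1 + 1) (d + d)"
    by (intro poly_space_inner poly_space_const_matrix_vector_mult u)
  then have "is_polynomial (\<lambda>y. running_cost q R y (u y))"
    unfolding running_cost_def by (intro is_polynomial_add q_poly is_polynomialI)
  from is_polynomial_continuous_on[OF this, of UNIV] show ?thesis
    by (rule continuous_on_compose2[OF _ x]) simp
qed

lemma policy_coefficients_solve_data_equation:
  assumes coeffs: "policy_coefficients u p K l" and p: "p \<in> coeff_vecs CARD('n) r"
    and u: "\<And>i. (\<lambda>y. u y $ i) \<in> poly_space 1 d"
    and data: "sampled_data f g e u x \<tau> N"
    and e: "bounded (range e)" "e \<in> borel_measurable lebesgue"
  shows "Phi R d e x \<tau> N *\<^sub>v (l @\<^sub>v stack_columns K) = Xi q R u x \<tau> N + Theta r x \<tau> N *\<^sub>v p"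
proof (rule eq_vecI)
  let ?V = "value_poly r p :: real^'n::_ \<Rightarrow> real" and ?c = "l @\<^sub>v stack_columns K"
  let ?F = "\<lambda>t y. f y + g y *v (u y + e t)"
  fix j assume "j < dim_vec (Xi q R u x \<tau> N + Theta r x \<tau> N *\<^sub>v p)"
  then have j: "j < N" by (simp add: Theta_def)
  let ?I = "{\<tau> j..\<tau> (Suc j)}"
  have \<tau>: "\<tau> 0 \<le> \<tau> j" "\<tau> j \<le> \<tau> (Suc j)" "\<tau> (Suc j) \<le> \<tau> N"
    using j by (auto intro!: sampling_times_mono[OF data])
  have sol: "caratheodory_solution ?F x (\<tau> 0) (\<tau> N)"
    using data by (simp add: sampled_data_def)
  then have "continuous_on {\<tau> 0..\<tau> N} x" by (simp add: caratheodory_solution_def)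
  then have x: "continuous_on ?I x" by (rule continuous_on_subset) (use \<tau> in auto)
  have dim_row: "dim_row (Theta r x \<tau> N) = N" by (simp add: Theta_def)
  have c: "?c \<in> carrier_vec (num_unknowns CARD('n) CARD('m) d)"
    using coeffs stack_columns_carrier_vec by (auto simp: policy_coefficients_def)
  have Phi: "((\<lambda>t. grad ?V (x t) \<bullet> ?F t (x t) + running_cost q R (x t) (u (x t))) has_integral
      vec_index (Phi R d e x \<tau> N *\<^sub>v ?c) j) ?I"
    using Phi_row_has_integral[OF d_pos j x e c, of R] by (simp add: data_integrand[OF coeffs])
  have Xi: "((\<lambda>t. running_cost q R (x t) (u (x t))) has_integral vec_index (Xi q R u x \<tau> N) j) ?I"
    by (intro Xi_row_has_integral running_cost_continuous_on u x j)
  obtain M where M: "\<And>t. t \<in> ?I \<Longrightarrow> norm (?F t (x t)) \<le> M"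
    using excited_system_bounded[OF u x e(1)] by metis
  have "((\<lambda>t. grad ?V (x t) \<bullet> ?F t (x t)) has_integral (?V (x (\<tau> (Suc j))) - ?V (x (\<tau> j)))) ?I"
    using is_polynomial_continuous_on_grad[OF is_polynomialI[OF value_poly_in_poly_space]]
    by (intro caratheodory_solution_chain_rule[OF sol \<tau> M] poly_space_GDERIV[OF value_poly_in_poly_space])
  from has_integral_unique[OF Phi has_integral_add[OF this Xi]]
  show "vec_index (Phi R d e x \<tau> N *\<^sub>v ?c) j = vec_index (Xi q R u x \<tau> N + Theta r x \<tau> N *\<^sub>v p) j"
    using j vec_index_Theta_mult_vec[OF r_pos j p, of x \<tau>] dim_row by simp
qed (simp add: Phi_def Theta_def)

lemma feasible_set_nonempty:
  fixes x :: "real \<Rightarrow> real^'n::_"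
  assumes p: "p \<in> coeff_vecs CARD('n) r" and K: "K \<in> gain_mats CARD('n) CARD('m) d"
    and L: "SOS (L (value_poly r p) (feedback d K))"
    and data: "sampled_data f g e (feedback d K) x \<tau> N"
    and e: "bounded (range e)" "e \<in> borel_measurable lebesgue"
  shows "feasible_set q R r d e (feedback d K) x \<tau> N p \<noteq> {}"
proof -
  note u = feedback_in_poly_space[OF K]
  obtain K' l where coeffs: "policy_coefficients (feedback d K) p K' l"
    using policy_coefficients_exist[OF u] by metis
  have "scalar_prod (p - p) (monomials 2 (2*r) y) = 0" for y :: "real^'n::_"
    unfolding minus_cancel_vec[OF p] using monomials2_carrier_vec[of "2*r" y] r_pos
    by (intro scalar_prod_left_zero) simp
  then have "SOS (\<lambda>y :: real^'n::_. scalar_prod (p - p) (monomials 2 (2*r) y))"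
    by (simp add: SOS_0)
  moreover have "SOS (\<lambda>y :: real^'n::_. scalar_prod l (monomials 2 (2*d) y))"
    using coeffs L by (simp add: policy_coefficients_def)
  ultimately have "(p, K', l) \<in> feasible_set q R r d e (feedback d K) x \<tau> N p"
    using coeffs p policy_coefficients_solve_data_equation[OF coeffs p u data e]
    by (simp add: feasible_set_def policy_coefficients_def)
  then show ?thesis by blast
qed

lemma feasible_imp_policy_coefficients:
  fixes x :: "real \<Rightarrow> real^'n::_"
  assumes u: "\<And>i. (\<lambda>y. u y $ i) \<in> poly_space 1 d"
    and data: "sampled_data f g e u x \<tau> N"
    and e: "bounded (range e)" "e \<in> borel_measurable lebesgue"
    and rank: "vec_space.rank N (Phi R d e x \<tau> N) = num_unknowns CARD('n) CARD('m) d"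
    and feasible: "(p, K, l) \<in> feasible_set q R r d e u x \<tau> N p_prev"
  shows "policy_coefficients u p K l"
proof -
  have p: "p \<in> coeff_vecs CARD('n) r" and K: "K \<in> gain_mats CARD('n) CARD('m) d"
    and l: "l \<in> coeff_vecs CARD('n) d"
    and eq: "Phi R d e x \<tau> N *\<^sub>v (l @\<^sub>v stack_columns K) = Xi q R u x \<tau> N + Theta r x \<tau> N *\<^sub>v p"
    using feasible by (auto simp: feasible_set_def)
  obtain K' l' where coeffs: "policy_coefficients u p K' l'"
    using policy_coefficients_exist[OF u] by metis
  then have K': "K' \<in> gain_mats CARD('n) CARD('m) d" and l': "l' \<in> coeff_vecs CARD('n) d"
    by (auto simp: policy_coefficients_def)
  have "l @\<^sub>v stack_columns K = l' @\<^sub>v stack_columns K'"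
  proof (rule inj_onD[OF inj_on_mult_mat_vec_of_full_column_rank[OF Phi_carrier_mat rank]])
    show "Phi R d e x \<tau> N *\<^sub>v (l @\<^sub>v stack_columns K) = Phi R d e x \<tau> N *\<^sub>v (l' @\<^sub>v stack_columns K')"
      using policy_coefficients_solve_data_equation[OF coeffs p u data e] eq by simp
  qed (use K K' l l' stack_columns_carrier_vec in auto)
  then have "l = l'" "stack_columns K = stack_columns K'"
    using append_vec_eq[OF l l'] by auto
  then show ?thesis using coeffs stack_columns_inject[OF K K'] by simp
qed

lemma policy_coefficients_improve:
  assumes coeffs: "policy_coefficients u p K l" and u: "\<And>i. (\<lambda>y. u y $ i) \<in> poly_space 1 d"
    and L: "SOS (L (value_poly r p) u)"
  shows "SOS (L (value_poly r p) (feedback d K))"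
proof -
  let ?V = "value_poly r p :: real^'n::_ \<Rightarrow> real"
  have "is_polynomial (\<lambda>y. (u y - greedy ?V y) $ i)" for i
    unfolding vector_minus_component
    by (intro is_polynomial_diff is_polynomialI[OF u]
        is_polynomialI[OF greedy_in_poly_space[OF value_poly_in_poly_space]])
  then have "SOS (\<lambda>y. (u y - greedy ?V y) \<bullet> (R *v (u y - greedy ?V y)))"
    by (rule SOS_quadratic_form[OF R_sym R_pd])
  from SOS_add[OF L this] have "SOS (L ?V (greedy ?V))"
    by (simp add: L_policy_improvement[of ?V _ u, abs_def, symmetric])
  then show ?thesis using coeffs by (simp add: policy_coefficients_def)
qed

end

subsection \<open>The iteration\<close>

locale sos_policy_iteration = polynomial_regulator f g q R r d
  for f :: "real^'n::_ \<Rightarrow> real^'n::{finite,linorder}"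
    and g :: "real^'n::_ \<Rightarrow> real^'m::{finite,linorder}^'n::_"
    and q :: "real^'n::_ \<Rightarrow> real"
    and R :: "real^'m::_^'m::_"
    and r d :: nat +
  fixes \<Omega> :: "(real^'n::_) set"
    and Vo :: "real^'n::_ \<Rightarrow> real"
    and p :: "nat \<Rightarrow> real Matrix.vec"
    and K :: "nat \<Rightarrow> real mat"
    and e :: "real \<Rightarrow> real^'m::_"
    and x :: "nat \<Rightarrow> nat \<Rightarrow> real \<Rightarrow> real^'n::_"
    and \<tau> :: "nat \<Rightarrow> nat \<Rightarrow> nat \<Rightarrow> real"
    and N :: "nat \<Rightarrow> nat"
  assumes Vo_class_P: "Vo \<in> class_P" and H_Vo: "H Vo y = 0"
    and p_0: "p 0 \<in> coeff_vecs CARD('n) r" and K_1: "K 1 \<in> gain_mats CARD('n) CARD('m) d"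
    and V_0_class_P: "(value_poly r (p 0) :: real^'n::_ \<Rightarrow> real) \<in> class_P"
    and L_0_SOS: "SOS (L (value_poly r (p 0)) (feedback d (K 1)))"
    and noise: "bounded (range e)" "e \<in> borel_measurable lebesgue"
begin

abbreviation V :: "nat \<Rightarrow> real^'n::_ \<Rightarrow> real" where
  "V i \<equiv> value_poly r (p i)"

abbreviation u :: "nat \<Rightarrow> real^'n::_ \<Rightarrow> real^'m::_" where
  "u i \<equiv> feedback d (K i)"

abbreviation feasible :: "nat \<Rightarrow> (real Matrix.vec \<times> real mat \<times> real Matrix.vec) set" where
  "feasible i \<equiv> feasible_set q R r d e (u i) (x i (N i)) (\<tau> i (N i)) (N i) (p (i - 1))"

definition sampled :: "nat \<Rightarrow> bool" where
  "sampled i \<longleftrightarrow> (\<forall>M. sampled_data f g e (u i) (x i M) (\<tau> i M) M)"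

definition exciting :: "nat \<Rightarrow> bool" where
  "exciting i \<longleftrightarrow> (\<exists>N0. rank_condition R d e (x i) (\<tau> i) N0 \<and> N i \<ge> N0)"

definition optimal :: "nat \<Rightarrow> bool" where
  "optimal i \<longleftrightarrow> optimal_solution \<Omega> q R r d e (u i) (x i (N i)) (\<tau> i (N i)) (N i)
     (p (i - 1)) (p i) (K (i + 1))"

definition admissible :: "nat \<Rightarrow> bool" where
  "admissible i \<longleftrightarrow> p i \<in> coeff_vecs CARD('n) r \<and> K (Suc i) \<in> gain_mats CARD('n) CARD('m) d \<and>
     SOS (L (V i) (u (Suc i)))"

lemma u_in_poly_space:
  assumes "admissible i"
  shows "(\<lambda>y. u (Suc i) y $ k) \<in> poly_space 1 d"
  using assms feedback_in_poly_space by (auto simp: admissible_def)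

lemma V_GDERIV: "GDERIV (V i) y :> grad (V i) y"
  by (rule poly_space_GDERIV[OF value_poly_in_poly_space])

lemma V_at_0: "V i 0 = 0"
  by (rule poly_space_at_0[OF value_poly_in_poly_space]) simp

lemma poly_space_class_P_of_ge:
  assumes "W \<in> poly_space 2 (2*r)" and "\<And>y. Vo y \<le> W y"
  shows "W \<in> class_P"
  using assms poly_space_at_0[OF assms(1)]
  by (intro class_P_mono[OF Vo_class_P] poly_space_GDERIV is_polynomial_continuous_on_grad
      is_polynomialI) auto

lemma
  assumes adm: "admissible i" and "sampled (Suc i)" "exciting (Suc i)" "optimal (Suc i)"
  shows optimal_imp_admissible: "admissible (Suc i)"
    and optimal_imp_greedy: "u (Suc (Suc i)) = greedy (V (Suc i))"
    and optimal_imp_L_SOS: "SOS (L (V (Suc i)) (u (Suc i)))"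
    and optimal_imp_le: "V (Suc i) y \<le> V i y"
proof -
  let ?i = "Suc i"
  obtain l where feasible: "(p ?i, K (Suc ?i), l) \<in> feasible ?i"
    using \<open>optimal ?i\<close> by (auto simp: optimal_def optimal_solution_def)
  then have p: "p ?i \<in> coeff_vecs CARD('n) r"
    and l_SOS: "SOS (\<lambda>y :: real^'n::_. scalar_prod l (monomials 2 (2*d) y))"
    and decrease: "SOS (\<lambda>y :: real^'n::_. scalar_prod (p i - p ?i) (monomials 2 (2*r) y))"
    by (auto simp: feasible_set_def)
  have coeffs: "policy_coefficients (u ?i) (p ?i) (K (Suc ?i)) l"
    using \<open>sampled ?i\<close> \<open>exciting ?i\<close>
    by (intro feasible_imp_policy_coefficients[OF u_in_poly_space[OF adm] _ noise _ feasible])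
      (auto simp: sampled_def exciting_def rank_condition_def)
  then show "u (Suc ?i) = greedy (V ?i)" by (simp add: policy_coefficients_def)
  show L_SOS: "SOS (L (V ?i) (u ?i))"
    using coeffs l_SOS by (simp add: policy_coefficients_def)
  show "admissible ?i"
    using coeffs p policy_coefficients_improve[OF coeffs u_in_poly_space[OF adm] L_SOS]
    by (simp add: admissible_def policy_coefficients_def)
  have "monomials 2 (2*r) y \<in> coeff_vecs CARD('n) r"
    using r_pos by (intro monomials2_carrier_vec) simp
  then show "V ?i y \<le> V i y"
    using minus_scalar_prod_distrib[OF _ p, of "p i"] SOS_nonneg[OF decrease, of y] adm
    by (simp add: admissible_def value_poly_def)
qed

lemma admissible_of_optimal:
  assumes "\<And>j. j \<in> {1..i} \<Longrightarrow> sampled j \<and> exciting j \<and> optimal j"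
  shows "admissible i"
  using assms
proof (induction i)
  case 0
  show ?case using p_0 K_1 L_0_SOS by (simp add: admissible_def)
next
  case (Suc i)
  then have "admissible i" "sampled (Suc i) \<and> exciting (Suc i) \<and> optimal (Suc i)" by simp_all
  then show ?case using optimal_imp_admissible by blast
qed

lemma feasible_nonempty:
  assumes "i \<ge> 1" and "\<And>j. j \<in> {1..i} \<Longrightarrow> sampled j \<and> exciting j" and "\<And>j. j \<in> {1..<i} \<Longrightarrow> optimal j"
  shows "feasible i \<noteq> {}"
proof -
  obtain k where i: "i = Suc k" using \<open>i \<ge> 1\<close> by (cases i) auto
  have "admissible k" using assms(2,3) by (intro admissible_of_optimal) (auto simp: i)
  moreover have "sampled i" using assms(1,2) by simp
  ultimately show ?thesis
    using feasible_set_nonempty[OF _ _ _ _ noise] by (simp add: i admissible_def sampled_def)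
qed

context
  assumes complete: "\<forall>i\<ge>1. sampled i \<and> exciting i \<and> optimal i"
begin

lemma admissible_all: "admissible i"
  by (rule admissible_of_optimal) (simp add: complete)

lemma L_next_nonneg: "L (V i) (u (Suc i)) y \<ge> 0"
  by (rule SOS_nonneg) (use admissible_all[of i] in \<open>simp add: admissible_def\<close>)

lemma V_Suc_le: "V (Suc i) y \<le> V i y"
  using complete by (intro optimal_imp_le[OF admissible_all]) auto

lemma V_decseq: "decseq (\<lambda>i. V i y)"
  by (rule decseq_SucI) (rule V_Suc_le)

lemma closed_loop_stable_of_class_P:
  assumes "V i \<in> class_P"
  shows "globally_asymptotically_stable (closed_loop (u (Suc i)))"
  using u_in_poly_space[OF admissible_all] L_next_nonneg
  by (rule closed_loop_globally_asymptotically_stable[OF assms])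

lemma Vo_le_V_Suc_of_class_P:
  assumes "V i \<in> class_P"
  shows "Vo y \<le> V (Suc i) y"
proof -
  obtain z where z: "solution (closed_loop (u (Suc i))) z" "z 0 = y" "(z \<longlongrightarrow> 0) at_top"
    using closed_loop_stable_of_class_P[OF assms] unfolding globally_asymptotically_stable_def by metis
  have "L (V (Suc i)) (u (Suc i)) y \<ge> 0" for y
    using complete by (intro SOS_nonneg[OF optimal_imp_L_SOS[OF admissible_all]]) auto
  then have "Vo (z 0) \<le> V (Suc i) (z 0)"
    by (intro optimal_value_le[OF _ _ H_Vo V_GDERIV V_at_0 _ z(1,3)] class_P_GDERIV class_P_zero
        Vo_class_P)
  then show ?thesis by (simp add: z(2))
qed

lemma V_class_P: "V i \<in> class_P"
proof (induction i)
  case 0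
  show ?case by (rule V_0_class_P)
next
  case (Suc i)
  show ?case
    by (rule poly_space_class_P_of_ge[OF value_poly_in_poly_space Vo_le_V_Suc_of_class_P[OF Suc]])
qed

lemma closed_loop_stable:
  assumes "i \<ge> 1"
  shows "globally_asymptotically_stable (closed_loop (u i))"
  using closed_loop_stable_of_class_P[OF V_class_P, of "i - 1"] assms by simp

lemma Vo_le_V: "Vo y \<le> V i y"
  using Vo_le_V_Suc_of_class_P[OF V_class_P, of y i] V_Suc_le[of i y] by linarith

lemma H_V_nonpos:
  assumes "i \<ge> 1"
  shows "H (V i) y \<le> 0"
proof -
  obtain k where "i = Suc k" using assms by (cases i) auto
  then have "u (Suc i) = greedy (V i)"
    using complete by (auto intro: optimal_imp_greedy[OF admissible_all])
  then show ?thesis using L_next_nonneg[of i y] by (simp add: L_greedy)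
qed

lemma V_limit_exists:
  obtains W where "W \<in> poly_space 2 (2*r)" "\<And>y. (\<lambda>i. V i y) \<longlonglongrightarrow> W y"
    "\<And>y. Vo y \<le> W y" "\<And>y. H W y \<le> 0"
proof -
  have "\<exists>c. (\<lambda>i. V i y) \<longlonglongrightarrow> c" for y
    using decseq_convergent[OF V_decseq, of "Vo y"] Vo_le_V by metis
  then obtain W where W: "\<And>y. (\<lambda>i. V i y) \<longlonglongrightarrow> W y" by metis
  have "W \<in> poly_space 2 (2*r)"
    by (rule poly_space_pointwise_limit[OF value_poly_in_poly_space W])
  moreover have "Vo y \<le> W y" for y
    by (rule LIMSEQ_le_const[OF W]) (use Vo_le_V in blast)
  moreover have "H W y \<le> 0" for y
  proof (rule LIMSEQ_le_const2)
    show "(\<lambda>i. H (V i) y) \<longlonglongrightarrow> H W y"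
      by (rule H_tendsto[OF grad_pointwise_limit[OF value_poly_in_poly_space W]])
    show "\<exists>n. \<forall>i\<ge>n. H (V i) y \<le> 0" using H_V_nonpos by blast
  qed
  ultimately show thesis using W that by blast
qed

lemma V_limit_suboptimality:
  "\<exists>W. W \<in> poly_space 2 (2*r) \<inter> class_P \<and> (\<forall>y. (\<lambda>i. V i y) \<longlonglongrightarrow> W y) \<and>
    (\<forall>y z. solution (closed_loop (greedy Vo)) z \<and> z 0 = y \<longrightarrow>
      (\<exists>I. has_improper_integral (\<lambda>t. H W (z t)) I \<and> 0 \<le> W y - Vo y \<and> ereal (W y - Vo y) \<le> - I))"
proof -
  obtain W where W: "W \<in> poly_space 2 (2*r)" "\<And>y. (\<lambda>i. V i y) \<longlonglongrightarrow> W y"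
    "\<And>y. Vo y \<le> W y" "\<And>y. H W y \<le> 0"
    using V_limit_exists by metis
  have "W \<in> class_P" by (rule poly_space_class_P_of_ge[OF W(1,3)])
  moreover have "\<exists>I. has_improper_integral (\<lambda>t. H W (z t)) I \<and> ereal (W (z 0) - Vo (z 0)) \<le> - I"
    if z: "solution (closed_loop (greedy Vo)) z" for z
    by (rule optimal_loop_bound[OF class_P_GDERIV[OF Vo_class_P] class_P_zero[OF Vo_class_P] H_Vo
          poly_space_GDERIV[OF W(1)] poly_space_at_0[OF W(1)] W(4) H_continuous_on[OF W(1)] z
          optimal_loop_tendsto_0[OF Vo_class_P H_Vo z]]) simp
  ultimately show ?thesis using W by (intro exI[of _ W]) auto
qed

end

end

theorem theoremV6:
  fixes f :: "real^'n::_ \<Rightarrow> real^'n::{finite,linorder}"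
    and g :: "real^'n::_ \<Rightarrow> real^'m::{finite,linorder}^'n::_"
    and q :: "real^'n::_ \<Rightarrow> real"
    and R :: "real^'m::_^'m::_"
    and r d :: nat
    and \<Omega> :: "(real^'n::_) set"
    and V\<^sub>o :: "real^'n::_ \<Rightarrow> real"
    and u\<^sub>o :: "real^'n::_ \<Rightarrow> real^'m::_"
    and p :: "nat \<Rightarrow> real Matrix.vec"
    and K :: "nat \<Rightarrow> real mat"
    and e :: "real \<Rightarrow> real^'m::_"
    and x :: "nat \<Rightarrow> nat \<Rightarrow> real \<Rightarrow> real^'n::_"
    and \<tau> :: "nat \<Rightarrow> nat \<Rightarrow> nat \<Rightarrow> real"
    and N :: "nat \<Rightarrow> nat"
  assumes f_poly: "\<forall>i. is_polynomial (\<lambda>y. f y $ i)" and f_0: "f 0 = 0"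
    and g_poly: "\<forall>i j. is_polynomial (\<lambda>y. g y $ i $ j)"
    and q_poly: "is_polynomial q" and q_pd: "positive_definite_fun q"
    and R_sym: "transpose R = R" and R_pd: "positive_definite_mat R"
    and r_pos: "r \<ge> 1" and d_pos: "d \<ge> 1"
    and d_ge: "real d \<ge> 1/2 * Max {real (degree_vec f) + 2 * real r - 1,
                 real (degree_mat g) + 2 * (2 * real r - 1),
                 real (poly_degree q),
                 2 * (2 * real r - 1) + 2 * real (degree_mat g)}"
    and Omega: "compact \<Omega>" "0 \<in> interior \<Omega>"
    and A2: "V\<^sub>o \<in> class_P" "\<forall>y. H_op f g q R V\<^sub>o y = 0"
    and u\<^sub>o: "u\<^sub>o = (\<lambda>y. - (1/2) *\<^sub>R (matrix_inv R *v (transpose (g y) *v grad V\<^sub>o y)))"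
    and A3: "p 0 \<in> carrier_vec (num_monomials2 CARD('n) (2*r))"
        "K 1 \<in> carrier_mat CARD('m) (num_monomials1 CARD('n) d)"
        "(value_poly r (p 0) :: real^'n::_ \<Rightarrow> real) \<in> poly_space 2 (2*r) \<inter> class_P"
        "SOS (L_op f g q R (value_poly r (p 0)) (feedback d (K 1)))"
    and noise: "bounded (range e)" "e \<in> borel_measurable lebesgue"
  shows
    "(\<forall>i\<ge>1.
        (\<forall>j\<in>{1..i}. (\<forall>M. sampled_data f g e (feedback d (K j)) (x j M) (\<tau> j M) M) \<and>
                    (\<exists>N0. rank_condition R d e (x j) (\<tau> j) N0 \<and> N j \<ge> N0)) \<and>
        (\<forall>j\<in>{1..<i}. optimal_solution \<Omega> q R r d e (feedback d (K j))
                        (x j (N j)) (\<tau> j (N j)) (N j) (p (j - 1)) (p j) (K (j + 1)))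
      \<longrightarrow> feasible_set q R r d e (feedback d (K i))
             (x i (N i)) (\<tau> i (N i)) (N i) (p (i - 1)) \<noteq> {})
   \<and> ((\<forall>i\<ge>1.
         (\<forall>M. sampled_data f g e (feedback d (K i)) (x i M) (\<tau> i M) M) \<and>
         (\<exists>N0. rank_condition R d e (x i) (\<tau> i) N0 \<and> N i \<ge> N0) \<and>
         optimal_solution \<Omega> q R r d e (feedback d (K i))
           (x i (N i)) (\<tau> i (N i)) (N i) (p (i - 1)) (p i) (K (i + 1)))
      \<longrightarrow>
        (\<forall>i\<ge>1. globally_asymptotically_stable (\<lambda>y. f y + g y *v feedback d (K i) y))
      \<and> (\<forall>i\<ge>1. (value_poly r (p i) :: real^'n::_ \<Rightarrow> real) \<in> class_P \<and>
           (\<forall>x0 :: real^'n::_. V\<^sub>o x0 \<le> value_poly r (p i) x0 \<and>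
                            value_poly r (p i) x0 \<le> value_poly r (p (i - 1)) x0))
      \<and> (\<exists>Vstar :: real^'n::_ \<Rightarrow> real. Vstar \<in> poly_space 2 (2*r) \<inter> class_P \<and>
           (\<forall>x0. (\<lambda>i. value_poly r (p i) x0) \<longlonglongrightarrow> Vstar x0) \<and>
           (\<forall>x0 z. solution (\<lambda>y. f y + g y *v u\<^sub>o y) z \<and> z 0 = x0 \<longrightarrow>
              (\<exists>I. has_improper_integral (\<lambda>t. H_op f g q R Vstar (z t)) I \<and>
                   0 \<le> Vstar x0 - V\<^sub>o x0 \<and> ereal (Vstar x0 - V\<^sub>o x0) \<le> - I))))"
proof -
  interpret sos_policy_iteration f g q R r d \<Omega> V\<^sub>o p K e x \<tau> N
    by unfold_locales (use assms degree_bounds_of_Max[OF r_pos d_ge] in auto)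
  have u\<^sub>o_greedy: "u\<^sub>o = greedy V\<^sub>o"
    by (simp add: u\<^sub>o greedy_def[abs_def])
  show ?thesis
    unfolding u\<^sub>o_greedy sampled_def[symmetric] exciting_def[symmetric] optimal_def[symmetric]
  proof (intro conjI allI impI)
    show "feasible i \<noteq> {}"
      if "1 \<le> i" "(\<forall>j\<in>{1..i}. sampled j \<and> exciting j) \<and> (\<forall>j\<in>{1..<i}. optimal j)" for i
      using that by (intro feasible_nonempty) blast+
  next
    assume complete: "\<forall>i\<ge>1. sampled i \<and> exciting i \<and> optimal i"
    show "globally_asymptotically_stable (closed_loop (u i))" if "1 \<le> i" for i
      by (rule closed_loop_stable[OF complete that])
    show "V i \<in> class_P" for i by (rule V_class_P[OF complete])
    show "V\<^sub>o y \<le> V i y" for i y by (rule Vo_le_V[OF complete])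
    show "V i y \<le> V (i - 1) y" if "1 \<le> i" for i y
      using V_Suc_le[OF complete, of "i - 1" y] that by simp
  qed (rule V_limit_suboptimality)
qed

end
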